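(* In the setting of the context (invertible fractional $\mathcal{O}_D$-ideal $\mathfrak{a}$, a branch of the vanishing locus of $\mathcal{D}\theta_{D,\mathfrak a}$ through the cusp $\infty$ given by $z\mapsto(z,\varphi(z))$ with $\varphi(z)=\frac{\alpha^\sigma}{\alpha}z+C+\frac{\varepsilon(q)}{2\pi i}$, $q=e(z/\alpha)$, associated standard form $[a,b,c]$, $g=\gcd(a,c)$ and $S=e\bigl(\frac{C\alpha}{N(\mathfrak a)^2\sqrt D}\bigr)$), the following hold. (i) $C\in\frac1{2\pi i}K^\times\log K^\times$; in fact $e\bigl(\frac{g\alpha C}{N(\mathfrak a)^2\sqrt D}\bigr)\in K\setminus\mathbb{Q}$. (ii) $S\in K^{1/g}$. (iii) For each $\beta$ completing $\alpha$ to a $\mathbb{Z}$-basis of $(\mathfrak a^2)^\vee$ there exists $A\in\mathbb{C}^\times$ such that, with the local parameter $Q=Aq$ of the cusp, $e(\nu z+\nu^\sigma\varphi(z))=S^{\mathrm{tr}(\beta\nu)}Q^{\mathrm{tr}(\alpha\nu)}e^{\nu^\sigma\varepsilon(q)}$ for all $\nu\in\mathfrak a^2$; the number $A$ is transcendental of Gelfond–Schneider type, more precisely of the form $x^y$ with $x,y\in K\setminus\mathbb{Q}$. (iv) The coefficients $a_n$ of $\varepsilon=\sum_{n\ge1}a_nQ^n$, expanded in a local parameter $Q$ as in (iii), lie in the number field $K(S)$.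
   Context: $D>0$ non-square discriminant, $K=\mathbb{Q}(\sqrt D)\subset\mathbb{R}$, $\sigma$ conjugation, $\mathrm{tr}$ the trace, $N$ the norm, $e(x)=e^{2\pi ix}$. $\mathfrak a$ is an invertible fractional $\mathcal{O}_D$-ideal with $\mathbb{Z}$-basis $\boldsymbol\omega=(\omega_1,\omega_2)$, $\mathfrak a^\vee$ its trace dual, and for a lattice $M$, $M^\vee=\{x:\mathrm{tr}(xM)\subset\mathbb{Z}\}$. $X_{D,\mathfrak a}=\mathbb{H}^2/\mathrm{SL}(\mathfrak a^\vee\oplus\mathfrak a)$ where $\mathrm{SL}(\mathfrak a^\vee\oplus\mathfrak a)=\mathrm{SL}_2(K)\cap\begin{pmatrix}\mathcal{O}_D&\mathfrak a^\vee\mathfrak a^{-1}\\\mathfrak a(\mathfrak a^\vee)^{-1}&\mathcal{O}_D\end{pmatrix}$, acting by $(z_1,z_2)\mapsto(\gamma z_1,\gamma^\sigma z_2)$. For odd characteristics $(m,m')$ ($m,m'\in\{0,\frac12\}^2$, $4m\cdot m'$ odd) and $\rho(x)=(x_1+m_1)\omega_1+(x_2+m_2)\omega_2$ put $D_2\theta^{\boldsymbol\omega}[m;m'](z_1,z_2)=\sum_{x\in\mathbb{Z}^2}(-1)^{2x\cdot m'}\rho(x)^\sigma e(\frac12\rho(x)^2z_1+\frac12(\rho(x)^\sigma)^2z_2)$ and $\mathcal{D}\theta_{D,\mathfrak a}=\prod_{\text{odd}}D_2\theta^{\boldsymbol\omega}[m;m']$ (its vanishing locus in $X_{D,\mathfrak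 a}$ is the Teichmüller curve $W_D$, viewed in $X_{D,\mathfrak a}$, so that $\infty$ corresponds to the cusp $\mathfrak a$ of $X_D$). Every branch of this vanishing locus through the cusp $\infty$ lifts to $\mathbb{H}^2$ as the graph $\{(z,\varphi(z)):\mathrm{Im}z\gg0\}$ with $\varphi(z)=\frac{\alpha^\sigma}{\alpha}z+C+\frac{\varepsilon(q)}{2\pi i}$, where $q=e(z/\alpha)$ is a local parameter of the branch, $\alpha\in(\mathfrak a^2)^\vee$ is primitive and is a multiminimizer for $\mathfrak a$ (i.e. $x\mapsto\mathrm{tr}(\alpha x^2)$ is positive definite on $\mathfrak a$ and attains its minimum on some nontrivial coset of $\mathfrak a$ in $\frac12\mathfrak a$ at more than one pair $\pm x$), $C\in\mathbb{C}$, and $\varepsilon\in q\mathbb{C}[[q]]$. To $\alpha$ corresponds a standard quadratic form $[a,b,c]$ ($a>0>c$, $a+b+c<0$, $b^2-4ac=D$): writing $\omega_1,\omega_2$ for the basis of $\mathfrak a$ with $\omega_2>\omega_1>0$ in which $\mathrm{tr}(\alpha x^2)$ is diagonal, $a\lambda^2+b\lambda+c=0$ for $\lambda=\omega_2/\omega_1$ with $a,b,c$ coprime. $g=\gcd(a,c)$, and $S=e(\frac{C\alpha}{N(\mathfrak a)^2\sqrt D})$, which does not depend on the chosen lift. A number is transcendental of Gelfond–Schneider type if it is transcendental of the form $x^y$ with $x,y$ algebraic.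
   Formalization: In S and in (i), N(𝔞)² is replaced by the norm of (𝔞²)^∨, i.e. S=e(√D·N(𝔞)²·αC), since the printed S depends on the lift and fails (i) for D=5; in (iii) the exponent of S is ±tr(βν), with sign the orientation of (α,β), since β and −β cannot both satisfy the printed formula. *)

theory Defs
  imports "HOL-Analysis.Analysis" "HOL-Computational_Algebra.Computational_Algebra"
begin

section \<open>The real quadratic field and its lattices\<close>

text \<open>
  The field $K = Q(\sqrt D)$ is used as a subset of the reals, and its image under
  \<^const>\<open>of_real\<close> as a subset of the complex numbers.  The maps \<open>qconj\<close>, \<open>qtr\<close> are meaningful on
  \<open>quad_field D\<close> only.
\<close>

definition nonsquare_discriminant :: "int \<Rightarrow> bool" where
  "nonsquare_discriminant D \<longleftrightarrow> D > 0 \<and> (D mod 4 = 0 \<or> D mod 4 = 1) \<and> \<not> (\<exists>k::int. D = k\<^sup>2)"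

definition quad_field :: "int \<Rightarrow> real set" where
  "quad_field D = {of_rat p + of_rat q * sqrt (of_int D) | p q. True}"

definition qconj :: "int \<Rightarrow> real \<Rightarrow> real" where
  "qconj D x = (THE y. \<exists>p q. x = of_rat p + of_rat q * sqrt (of_int D)
                           \<and> y = of_rat p - of_rat q * sqrt (of_int D))"

definition qtr :: "int \<Rightarrow> real \<Rightarrow> real" where
  "qtr D x = x + qconj D x"

definition is_zbasis :: "real set \<Rightarrow> real \<Rightarrow> real \<Rightarrow> bool" where
  "is_zbasis M x y \<longleftrightarrow> M = {of_int m * x + of_int n * y | m n. True}
     \<and> (\<forall>m n::int. of_int m * x + of_int n * y = 0 \<longrightarrow> m = 0 \<and> n = 0)"

definition quad_order :: "int \<Rightarrow> real set" where
  "quad_order D = {of_int m + of_int n * ((of_int D + sqrt (of_int D)) / 2) | m n. True}"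

definition fractional_ideal :: "int \<Rightarrow> real set \<Rightarrow> bool" where
  "fractional_ideal D I \<longleftrightarrow> I \<subseteq> quad_field D \<and> (\<exists>x y. is_zbasis I x y)
     \<and> (\<forall>r\<in>quad_order D. \<forall>x\<in>I. r * x \<in> I)"

definition ideal_mult :: "real set \<Rightarrow> real set \<Rightarrow> real set" where
  "ideal_mult I J = {\<Sum>i<n. f i * h i | (n::nat) f h. \<forall>i<n. f i \<in> I \<and> h i \<in> J}"

definition invertible_ideal :: "int \<Rightarrow> real set \<Rightarrow> bool" where
  "invertible_ideal D I \<longleftrightarrow> fractional_ideal D I
     \<and> (\<exists>J. fractional_ideal D J \<and> ideal_mult I J = quad_order D)"

definition trace_dual :: "int \<Rightarrow> real set \<Rightarrow> real set" where
  "trace_dual D M = {x \<in> quad_field D. \<forall>y\<in>M. qtr D (x * y) \<in> \<int>}"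

text \<open>
  The norm of a lattice is its covolume in $R^2$ under $(id, \sigma)$ relative to that of
  \<open>quad_order D\<close>, which is $\sqrt D$; it does not depend on the basis.
\<close>

definition lattice_norm :: "int \<Rightarrow> real set \<Rightarrow> real" where
  "lattice_norm D M = (THE n. \<exists>x y. is_zbasis M x y
      \<and> n = \<bar>x * qconj D y - qconj D x * y\<bar> / sqrt (of_int D))"

definition primitive_in :: "real set \<Rightarrow> real \<Rightarrow> bool" where
  "primitive_in M x \<longleftrightarrow> x \<in> M \<and> x \<noteq> 0 \<and> (\<forall>n::nat. n \<ge> 2 \<longrightarrow> x / of_nat n \<notin> M)"

section \<open>Theta derivatives\<close>

definition ee :: "complex \<Rightarrow> complex" where
  "ee x = exp (2 * of_real pi * \<i> * x)"

definition odd_characteristics :: "((real \<times> real) \<times> (real \<times> real)) set" where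
  "odd_characteristics = {(m, m').
     m \<in> {0, 1/2} \<times> {0, 1/2} \<and> m' \<in> {0, 1/2} \<times> {0, 1/2} \<and>
     (\<exists>k::int. odd k \<and> 4 * (fst m * fst m' + snd m * snd m') = of_int k)}"

text \<open>For a characteristic, $2 x \cdot m'$ is an integer, so the floor below is exact.\<close>

definition D2_theta ::
  "int \<Rightarrow> real \<Rightarrow> real \<Rightarrow> real \<times> real \<Rightarrow> real \<times> real \<Rightarrow> complex \<Rightarrow> complex \<Rightarrow> complex" where
  "D2_theta D \<omega>\<^sub>1 \<omega>\<^sub>2 m m' z\<^sub>1 z\<^sub>2 =
     (\<Sum>\<^sub>\<infinity>(x\<^sub>1, x\<^sub>2)\<in>(UNIV :: (int \<times> int) set).
        let \<rho> = (of_int x\<^sub>1 + fst m) * \<omega>\<^sub>1 + (of_int x\<^sub>2 + snd m) * \<omega>\<^sub>2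
        in (-1) powi \<lfloor>2 * (of_int x\<^sub>1 * fst m' + of_int x\<^sub>2 * snd m')\<rfloor>
             * of_real (qconj D \<rho>)
             * ee (of_real (\<rho>\<^sup>2) * z\<^sub>1 / 2 + of_real ((qconj D \<rho>)\<^sup>2) * z\<^sub>2 / 2))"

definition theta_product :: "int \<Rightarrow> real \<Rightarrow> real \<Rightarrow> complex \<Rightarrow> complex \<Rightarrow> complex" where
  "theta_product D \<omega>\<^sub>1 \<omega>\<^sub>2 z\<^sub>1 z\<^sub>2 =
     (\<Prod>(m, m')\<in>odd_characteristics. D2_theta D \<omega>\<^sub>1 \<omega>\<^sub>2 m m' z\<^sub>1 z\<^sub>2)"

section \<open>Branches through the cusp\<close>

definition multiminimizer :: "int \<Rightarrow> real set \<Rightarrow> real \<Rightarrow> bool" where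
  "multiminimizer D I \<alpha> \<longleftrightarrow>
     (\<forall>x\<in>I. x \<noteq> 0 \<longrightarrow> qtr D (\<alpha> * x\<^sup>2) > 0) \<and>
     (\<exists>x\<^sub>0. 2 * x\<^sub>0 \<in> I \<and> x\<^sub>0 \<notin> I \<and>
        (let P = {x\<^sub>0 + y | y. y \<in> I};
             is_min = (\<lambda>x. x \<in> P \<and> (\<forall>u\<in>P. qtr D (\<alpha> * x\<^sup>2) \<le> qtr D (\<alpha> * u\<^sup>2)))
         in \<exists>x y. is_min x \<and> is_min y \<and> x \<noteq> y \<and> x \<noteq> - y))"

text \<open>
  The lift of a branch to the product of half planes: the graph of \<open>\<phi>\<close> over the half plane
  $Im\, z > T$, where the theta product formed with the basis \<open>\<omega>\<^sub>1, \<omega>\<^sub>2\<close> vanishes.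
\<close>

definition branch_lift ::
  "int \<Rightarrow> real \<Rightarrow> real \<Rightarrow> real \<Rightarrow> complex \<Rightarrow> complex fps \<Rightarrow> real \<Rightarrow> (complex \<Rightarrow> complex) \<Rightarrow> bool" where
  "branch_lift D \<omega>\<^sub>1 \<omega>\<^sub>2 \<alpha> C \<epsilon> T \<phi> \<longleftrightarrow> T \<ge> 0 \<and> fps_nth \<epsilon> 0 = 0 \<and>
     (\<forall>z. Im z > T \<longrightarrow>
        (let q = ee (z / of_real \<alpha>)
         in ereal (norm q) < fps_conv_radius \<epsilon> \<and>
            \<phi> z = of_real (qconj D \<alpha> / \<alpha>) * z + C + eval_fps \<epsilon> q / (2 * of_real pi * \<i>) \<and>
            Im (\<phi> z) > 0 \<and>
            theta_product D \<omega>\<^sub>1 \<omega>\<^sub>2 z (\<phi> z) = 0))"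

definition standard_form :: "int \<Rightarrow> int \<Rightarrow> int \<Rightarrow> int \<Rightarrow> bool" where
  "standard_form D a b c \<longleftrightarrow> a > 0 \<and> c < 0 \<and> a + b + c < 0 \<and> b\<^sup>2 - 4 * a * c = D"

text \<open>Diagonality of $x \mapsto tr(\alpha x^2)$ means that its mixed coefficient vanishes.\<close>

definition associated_form :: "int \<Rightarrow> real set \<Rightarrow> real \<Rightarrow> int \<Rightarrow> int \<Rightarrow> int \<Rightarrow> bool" where
  "associated_form D I \<alpha> a b c \<longleftrightarrow> standard_form D a b c \<and> Gcd {a, b, c} = 1 \<and>
     (\<exists>\<eta>\<^sub>1 \<eta>\<^sub>2. is_zbasis I \<eta>\<^sub>1 \<eta>\<^sub>2 \<and> \<eta>\<^sub>2 > \<eta>\<^sub>1 \<and> \<eta>\<^sub>1 > 0 \<and> qtr D (\<alpha> * \<eta>\<^sub>1 * \<eta>\<^sub>2) = 0 \<and>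
        (let l = \<eta>\<^sub>2 / \<eta>\<^sub>1 in of_int a * l\<^sup>2 + of_int b * l + of_int c = 0))"

text \<open>
  The normalisation of the constants.  Another lift of the branch arises by translating by
  $(\mu, \mu^\sigma)$ with $\mu$ in the dual $M$ of the lattice $I^2$ of exponents; this adds
  $\alpha\mu^\sigma - \alpha^\sigma\mu$ to $C\alpha$, and since $\alpha$ is primitive in $M$
  these differences run through $N(M)\sqrt D$ times the integers.  The quantity $C\alpha$ is therefore
  divided by $N(M)\sqrt D$, where the norm is that of $M$, the lattice which contains $\alpha$,
  and not that of $I^2$.  For invertible $I$ one has $N(M) = 1/(D\,N(I)^2)$.
\<close>

definition branch_exponent :: "int \<Rightarrow> real set \<Rightarrow> real \<Rightarrow> complex \<Rightarrow> complex" where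
  "branch_exponent D I \<alpha> C =
     C * of_real \<alpha> / of_real (lattice_norm D (trace_dual D (ideal_mult I I)) * sqrt (of_int D))"

definition branch_S :: "int \<Rightarrow> real set \<Rightarrow> real \<Rightarrow> complex \<Rightarrow> complex" where
  "branch_S D I \<alpha> C = ee (branch_exponent D I \<alpha> C)"

text \<open>
  The formula satisfied by the local parameter $Q = A q$ attached to a basis \<open>\<alpha>, \<beta>\<close>.  Replacing
  \<open>\<beta>\<close> by \<open>- \<beta>\<close> changes the exponent of \<open>S\<close> to its negative while \<open>S\<close> involves
  \<open>\<alpha>\<close> only, hence the sign \<open>s\<close>, which is 1 for a positively oriented basis.
  The traces are integers, so the floors are exact.
\<close>

definition adapted_parameter ::
  "int \<Rightarrow> real set \<Rightarrow> real \<Rightarrow> real \<Rightarrow> complex \<Rightarrow> complex fps \<Rightarrow> real \<Rightarrow> (complex \<Rightarrow> complex)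
     \<Rightarrow> complex \<Rightarrow> bool" where
  "adapted_parameter D I \<alpha> \<beta> S \<epsilon> T \<phi> A \<longleftrightarrow> A \<noteq> 0 \<and>
     (\<forall>\<nu>\<in>ideal_mult I I. \<forall>z. Im z > T \<longrightarrow>
        (let q = ee (z / of_real \<alpha>); Q = A * q;
             s = (if \<alpha> * qconj D \<beta> - qconj D \<alpha> * \<beta> > 0 then 1 else - 1 :: int)
         in ee (of_real \<nu> * z + of_real (qconj D \<nu>) * \<phi> z) =
              S powi (s * \<lfloor>qtr D (\<beta> * \<nu>)\<rfloor>) * Q powi \<lfloor>qtr D (\<alpha> * \<nu>)\<rfloor>
                * exp (of_real (qconj D \<nu>) * eval_fps \<epsilon> q)))"

section \<open>Arithmetic of the constants\<close>

text \<open>Complex powers are multivalued: \<open>z\<close> is a value of $x^y$ for some branch of the logarithm of \<open>x\<close>.\<close>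

definition is_power_value :: "complex \<Rightarrow> complex \<Rightarrow> complex \<Rightarrow> bool" where
  "is_power_value x y z \<longleftrightarrow> (\<exists>l. exp l = x \<and> z = exp (y * l))"

definition gelfond_schneider_type :: "complex \<Rightarrow> bool" where
  "gelfond_schneider_type z \<longleftrightarrow> \<not> algebraic z \<and>
     (\<exists>x y. algebraic x \<and> algebraic y \<and> is_power_value x y z)"

definition quad_field_adjoin :: "int \<Rightarrow> complex \<Rightarrow> complex set" where
  "quad_field_adjoin D s = \<Inter>{F. of_real ` quad_field D \<subseteq> F \<and> s \<in> F \<and>
     (\<forall>x\<in>F. \<forall>y\<in>F. x - y \<in> F \<and> x * y \<in> F) \<and> (\<forall>x\<in>F. inverse x \<in> F)}"

end

theory Submission
  imports
    Defs
    "HOL-Complex_Analysis.Laurent_Convergence"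
    "HOL-Real_Asymp.Real_Asymp"
    "Jordan_Normal_Form.Char_Poly"
begin

text \<open>
  Some factor of the theta product vanishes at infinitely many points of the branch approaching the cusp.
  In the basis \<open>\<eta>1, \<eta>2\<close> of the ideal which diagonalizes $tr(\alpha x^2)$, its
  characteristic has to be $(1/2, 1/2)$, since otherwise a single pair \<open>\<plusminus>\<rho>\<close>
  contributes to the leading term. For $(1/2, 1/2)$ the two pairs
  $(\eta_1 \pm \eta_2)/2$ contribute, and the cancellation of the leading terms gives
  $e(C \sigma(\eta_1\eta_2)) = ((\sigma\eta_1 - \sigma\eta_2)/(\sigma\eta_1 + \sigma\eta_2))^2$.
  As $\eta_1\eta_2$ is $g$ times a primitive vector of the square of the ideal orthogonal to
  $\alpha$, this number is $S^{\pm g}$. The higher coefficients of the theta factor give a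
  recursion for the coefficients of $\varepsilon$ over $K(S)$.

  The number $A$ is a power with base $S^{\pm g}$ and exponent in $K \setminus Q$. Its absolute
  value is a real power of a positive real number, for which the Gelfond--Schneider theorem is
  accessible by interpolation determinants, without complex analysis: exponential polynomials with
  real frequencies have few real zeros by Rolle's theorem, so the determinant does not vanish.
\<close>

subsection \<open>Integral actions on finitely generated modules\<close>

text \<open>Oddness of the characteristic makes \<rho> and -\<rho> contribute equally, so a single
  pair can never cancel; two pairs cancel only if the constant C has a prescribed exponential. The
  factor g has its origin in the relation a \<eta>2^2 + b \<eta>1 \<eta>2 + c \<eta>1^2 = 0: modulo
  \<eta>1 \<eta>2 it becomes a \<eta>2^2 + c \<eta>1^2 = 0, and the torsion of that quotient has
  order gcd(a, c). The theta product vanishes on the whole branch, but the vanishing factor may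
  change from point to point. Points on the imaginary axis and a subsequence on which one fixed
  factor vanishes are enough: decay to all orders along a sequence tending to the cusp forces a
  formal identity. The number A is transcendental and enters the recursion for \<epsilon>, which
  therefore does not run inside K(S) as it stands. It is homogeneous, however, if the coefficient of
  q^n is measured against A^n, and these quotients are precisely the coefficients with respect to
  Q.\<close>

definition int_span :: "'a::field_char_0 set \<Rightarrow> nat \<Rightarrow> 'a set" where
  "int_span V h = {\<Sum>y\<in>V. of_int (m y) * y | m. (\<Sum>y\<in>V. \<bar>m y\<bar>) \<le> int h}"

text \<open>The number \<open>h\<close> bounds the row sums of an integer matrix for multiplication
  by \<open>u\<close> on the module generated by \<open>V\<close>. This size is subadditive and
  submultiplicative, so it takes over the role of heights and conjugates of algebraic
  integers.\<close>

definition int_acts :: "'a::field_char_0 set \<Rightarrow> 'a \<Rightarrow> nat \<Rightarrow> bool" where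
  "int_acts V u h \<longleftrightarrow> (\<forall>x\<in>V. u * x \<in> int_span V h)"

lemma int_span_0 [simp]: "0 \<in> int_span V h"
  by (auto simp: int_span_def intro!: exI[of _ "\<lambda>_. 0"])

lemma int_span_base: "finite V \<Longrightarrow> x \<in> V \<Longrightarrow> x \<in> int_span V 1"
  unfolding int_span_def
proof (intro CollectI exI[of _ "\<lambda>y. if y = x then 1 else 0"] conjI)
  assume "finite V" "x \<in> V"
  then show "x = (\<Sum>y\<in>V. of_int (if y = x then 1 else 0) * y)"
    by (simp add: if_distrib[of of_int] if_distrib[of "\<lambda>a. a * _"] cong: if_cong)
  show "(\<Sum>y\<in>V. \<bar>if y = x then 1 else 0\<bar>) \<le> int 1"
    using \<open>finite V\<close> \<open>x \<in> V\<close> by (simp add: if_distrib cong: if_cong)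
qed

lemma int_span_mono: "x \<in> int_span V h \<Longrightarrow> h \<le> h' \<Longrightarrow> x \<in> int_span V h'"
  by (force simp: int_span_def)

lemma int_span_add:
  assumes "x \<in> int_span V h" "y \<in> int_span V k"
  shows "x + y \<in> int_span V (h + k)"
proof -
  from assms obtain m n where m: "x = (\<Sum>y\<in>V. of_int (m y) * y)" "(\<Sum>y\<in>V. \<bar>m y\<bar>) \<le> int h"
    and n: "y = (\<Sum>y\<in>V. of_int (n y) * y)" "(\<Sum>y\<in>V. \<bar>n y\<bar>) \<le> int k"
    by (auto simp: int_span_def)
  have "(\<Sum>y\<in>V. \<bar>m y + n y\<bar>) \<le> (\<Sum>y\<in>V. \<bar>m y\<bar> + \<bar>n y\<bar>)"
    by (intro sum_mono) auto
  then show ?thesis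
    unfolding int_span_def using m n
    by (auto intro!: exI[of _ "\<lambda>y. m y + n y"] simp: sum.distrib algebra_simps)
qed

lemma int_span_scale:
  assumes "x \<in> int_span V h"
  shows "of_int k * x \<in> int_span V (nat \<bar>k\<bar> * h)"
proof -
  from assms obtain m where m: "x = (\<Sum>y\<in>V. of_int (m y) * y)" "(\<Sum>y\<in>V. \<bar>m y\<bar>) \<le> int h"
    by (auto simp: int_span_def)
  have "(\<Sum>y\<in>V. \<bar>k * m y\<bar>) \<le> int (nat \<bar>k\<bar> * h)"
    using m(2) by (simp add: abs_mult sum_distrib_left[symmetric] mult_left_mono)
  then show ?thesis
    unfolding int_span_def using m(1)
    by (auto intro!: exI[of _ "\<lambda>y. k * m y"] simp: sum_distrib_left algebra_simps)
qed

lemma int_span_sum: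
  "finite A \<Longrightarrow> (\<And>a. a \<in> A \<Longrightarrow> f a \<in> int_span V (h a)) \<Longrightarrow> sum f A \<in> int_span V (sum h A)"
  by (induction A rule: finite_induct) (auto intro!: int_span_add)

text \<open>Sizes multiply under composition. Two sets \<open>V\<close> and \<open>W\<close> are
  allowed because adjoining a further number changes the module.\<close>

lemma int_span_trans:
  assumes "finite V" "x \<in> int_span V h" "\<And>y. y \<in> V \<Longrightarrow> c * y \<in> int_span W k"
  shows "c * x \<in> int_span W (h * k)"
proof -
  from assms(2) obtain m where m: "x = (\<Sum>y\<in>V. of_int (m y) * y)" "(\<Sum>y\<in>V. \<bar>m y\<bar>) \<le> int h"
    by (auto simp: int_span_def)
  have "(\<Sum>y\<in>V. of_int (m y) * (c * y)) \<in> int_span W (\<Sum>y\<in>V. nat \<bar>m y\<bar> * k)"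
    by (intro int_span_sum int_span_scale assms)
  moreover have "(\<Sum>y\<in>V. of_int (m y) * (c * y)) = c * x"
    by (simp add: m(1) sum_distrib_left mult_ac)
  moreover have "(\<Sum>y\<in>V. nat \<bar>m y\<bar> * k) \<le> h * k"
  proof -
    have "int (\<Sum>y\<in>V. nat \<bar>m y\<bar>) \<le> int h" using m(2) by simp
    then have "(\<Sum>y\<in>V. nat \<bar>m y\<bar>) \<le> h" by linarith
    then show ?thesis by (simp add: sum_distrib_right[symmetric])
  qed
  ultimately show ?thesis by (metis int_span_mono)
qed

lemma int_acts_mono: "int_acts V u h \<Longrightarrow> h \<le> k \<Longrightarrow> int_acts V u k"
  by (auto simp: int_acts_def intro: int_span_mono)

lemma int_acts_of_int:
  assumes "finite V"
  shows "int_acts V (of_int k) (nat \<bar>k\<bar>)"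
  unfolding int_acts_def using int_span_scale[OF int_span_base[OF assms]] by fastforce

lemma int_acts_add: "int_acts V u h \<Longrightarrow> int_acts V w k \<Longrightarrow> int_acts V (u + w) (h + k)"
  by (auto simp: int_acts_def distrib_right intro: int_span_add)

lemma int_acts_mult:
  assumes "finite V" "int_acts V u h" "int_acts V w k"
  shows "int_acts V (u * w) (h * k)"
  using int_span_trans[OF assms(1), of _ k u V h] assms(2,3)
  by (auto simp: int_acts_def mult.assoc mult.commute[of h])

lemma int_acts_sum:
  assumes "finite V" "finite A" "\<And>a. a \<in> A \<Longrightarrow> int_acts V (f a) (h a)"
  shows "int_acts V (sum f A) (sum h A)"
  using assms(2,3)
proof (induction A rule: finite_induct)
  case empty
  then show ?case using int_acts_of_int[OF assms(1), of 0] by simp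
qed (auto intro!: int_acts_add assms(1))

lemma int_acts_prod:
  assumes "finite V" "finite A" "\<And>a. a \<in> A \<Longrightarrow> int_acts V (f a) (h a)"
  shows "int_acts V (prod f A) (prod h A)"
  using assms(2,3)
proof (induction A rule: finite_induct)
  case empty
  then show ?case using int_acts_of_int[OF assms(1), of 1] by simp
qed (auto intro!: int_acts_mult assms(1))

lemma int_acts_power: "finite V \<Longrightarrow> int_acts V u h \<Longrightarrow> int_acts V (u ^ n) (h ^ n)"
  using int_acts_of_int[of V 1] by (induction n) (auto intro!: int_acts_mult)

text \<open>Determinant trick: the vector listing \<open>V\<close> is an eigenvector, with
  eigenvalue \<open>u\<close>, of the matrix of coefficients. The element \<open>x\<close>
  guarantees that this vector is not zero.\<close>

lemma int_acts_matrix: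
  fixes u :: "'a::field_char_0"
  assumes "finite V" "int_acts V u h" "x \<in> V" "x \<noteq> 0"
  obtains M where "M \<in> carrier_mat (card V) (card V)"
    "\<And>i j. i < card V \<Longrightarrow> j < card V \<Longrightarrow> \<bar>M $$ (i, j)\<bar> \<le> int h"
    "poly (map_poly of_int (char_poly M)) u = 0"
proof -
  define n where "n = card V"
  obtain e where e: "bij_betw e {0..<n} V"
    using ex_bij_betw_nat_finite[OF assms(1)] by (auto simp: n_def)
  have "\<forall>x\<in>V. \<exists>m. u * x = (\<Sum>y\<in>V. of_int (m y) * y) \<and> (\<Sum>y\<in>V. \<bar>m y\<bar>) \<le> int h"
    using assms(2) by (auto simp: int_acts_def int_span_def)
  then obtain m where m: "\<And>x. x \<in> V \<Longrightarrow> u * x = (\<Sum>y\<in>V. of_int (m x y) * y)"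
    "\<And>x. x \<in> V \<Longrightarrow> (\<Sum>y\<in>V. \<bar>m x y\<bar>) \<le> int h" by metis
  define M where "M = mat n n (\<lambda>(i, j). m (e i) (e j))"
  define v where "v = vec n e"
  have eV: "e i \<in> V" if "i < n" for i using e that by (auto simp: bij_betw_def)
  have M: "M \<in> carrier_mat n n" by (simp add: M_def)
  let ?M = "map_mat of_int M :: 'a mat"
  have "?M *\<^sub>v v = u \<cdot>\<^sub>v v"
  proof
    fix i assume i: "i < dim_vec (u \<cdot>\<^sub>v v)"
    then have "vec_index (?M *\<^sub>v v) i = (\<Sum>j = 0..<n. of_int (m (e i) (e j)) * e j)"
      by (simp add: M_def v_def scalar_prod_def)
    also have "\<dots> = (\<Sum>y\<in>V. of_int (m (e i) y) * y)"
      by (rule sum.reindex_bij_betw[OF e])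
    finally show "vec_index (?M *\<^sub>v v) i = vec_index (u \<cdot>\<^sub>v v) i"
      using m(1)[OF eV, of i] i by (simp add: v_def)
  qed (simp_all add: M_def v_def)
  moreover have "v \<noteq> 0\<^sub>v n"
  proof
    assume v: "v = 0\<^sub>v n"
    obtain i where "i < n" "e i = x" using e assms(3) by (force simp: bij_betw_def)
    then show False using assms(4) arg_cong[OF v, of "\<lambda>v. vec_index v i"] by (simp add: v_def)
  qed
  ultimately have "eigenvalue ?M u"
    unfolding eigenvalue_def eigenvector_def by (intro exI[of _ v]) (simp add: M_def v_def)
  then have "poly (char_poly ?M) u = 0"
    using eigenvalue_root_char_poly[of ?M n u] M by simp
  then have "poly (map_poly of_int (char_poly M)) u = 0"
    by (simp add: of_int_hom.char_poly_hom[OF M])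
  moreover have "\<bar>M $$ (i, j)\<bar> \<le> int h" if "i < n" "j < n" for i j
  proof -
    have "\<bar>m (e i) (e j)\<bar> \<le> (\<Sum>y\<in>V. \<bar>m (e i) y\<bar>)"
      by (rule member_le_sum) (use eV that assms(1) in auto)
    then show ?thesis using m(2)[OF eV, of i] that by (simp add: M_def)
  qed
  ultimately show ?thesis using M that by (simp add: n_def)
qed

lemma int_acts_imp_algebraic:
  assumes "finite V" "int_acts V u h" "x \<in> V" "x \<noteq> 0"
  shows "algebraic u"
proof -
  obtain M where M: "M \<in> carrier_mat (card V) (card V)"
    "poly (map_poly of_int (char_poly M)) u = 0"
    using int_acts_matrix[OF assms] by metis
  have "char_poly M \<noteq> 0" using degree_monic_char_poly[OF M(1)] by auto
  then show ?thesis
    by (intro algebraicI[of "map_poly of_int (char_poly M)"]) (auto simp: coeff_map_poly M)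
qed

text \<open>The module is built one number at a time, passing from \<open>V\<close> to its products
  with the powers of \<open>u\<close> below the degree of an integer polynomial annihilating
  \<open>u\<close>. The factor \<delta> collects the leading coefficients.\<close>

lemma ex_int_acts:
  fixes U :: "'a::field_char_0 set"
  assumes "finite U" "\<And>u. u \<in> U \<Longrightarrow> algebraic u"
  shows "\<exists>V \<delta> h. finite V \<and> 1 \<in> V \<and> \<delta> \<ge> 1 \<and> (\<forall>u\<in>U. int_acts V (of_nat \<delta> * u) h)"
  using assms
proof (induction U rule: finite_induct)
  case empty
  then show ?case by (intro exI[of _ "{1}"] exI[of _ 1]) auto
next
  case (insert u U)
  then obtain V \<delta> h where V: "finite V" "1 \<in> V" "\<delta> \<ge> 1" "\<And>w. w \<in> U \<Longrightarrow> int_acts V (of_nat \<delta> * w) h"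
    by (metis insertCI)
  have "algebraic u" using insert.prems by auto
  then obtain p :: "'a poly" where p: "\<And>i. coeff p i \<in> \<int>" "p \<noteq> 0" "poly p u = 0"
    by (auto simp: algebraic_def)
  define d where "d = degree p"
  obtain P where P: "\<And>i. coeff p i = of_int (P i)"
  proof -
    have "\<forall>i. \<exists>k. coeff p i = of_int k" using p(1) by (auto simp: Ints_def)
    then show ?thesis using that by metis
  qed
  have "d > 0"
  proof (rule ccontr)
    assume "\<not> d > 0"
    then obtain c where "p = [:c:]" by (auto simp: d_def elim: degree_eq_zeroE)
    then show False using p(2,3) by simp
  qed
  define W where "W = (\<lambda>(x, k). x * u ^ k) ` (V \<times> {..<d})"
  have W: "finite W" using V by (auto simp: W_def)
  have WI: "x * u ^ k \<in> W" if "x \<in> V" "k < d" for x k using that by (auto simp: W_def)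
  have lift: "int_acts W w k" if "int_acts V w k" for w k
    unfolding int_acts_def
  proof
    fix y assume "y \<in> W"
    then obtain x i where y: "x \<in> V" "i < d" "y = x * u ^ i" by (auto simp: W_def)
    have "u ^ i * z \<in> int_span W 1" if "z \<in> V" for z
      using int_span_base[OF W WI[OF that y(2)]] by (simp add: mult.commute)
    then have "u ^ i * (w * x) \<in> int_span W (k * 1)"
      using that y(1) by (intro int_span_trans[OF V(1)]) (auto simp: int_acts_def)
    then show "w * y \<in> int_span W k" by (simp add: y mult_ac)
  qed
  define lc where "lc = P d"
  have lc: "lc \<noteq> 0" using p(2) P[of d] by (auto simp: lc_def d_def)
  define h' where "h' = (\<Sum>j<d. nat \<bar>P j\<bar>) + nat \<bar>lc\<bar>"
  have u: "int_acts W (of_int lc * u) h'"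
    unfolding int_acts_def
  proof
    fix y assume "y \<in> W"
    then obtain x i where y: "x \<in> V" "i < d" "y = x * u ^ i" by (auto simp: W_def)
    show "of_int lc * u * y \<in> int_span W h'"
    proof (cases "Suc i < d")
      case True
      have "of_int lc * (x * u ^ Suc i) \<in> int_span W (nat \<bar>lc\<bar> * 1)"
        by (intro int_span_scale int_span_base W WI y True)
      then show ?thesis by (auto simp: y mult_ac h'_def intro: int_span_mono)
    next
      \<comment> \<open>The power of \<open>u\<close> reaches the degree of \<open>p\<close>; the
        equation for \<open>u\<close> lowers it again at the price of the leading
        coefficient.\<close>
      case False
      then have i: "d = Suc i" using y by auto
      have "0 = poly p u" using p by simp
      also have "\<dots> = (\<Sum>j\<le>d. of_int (P j) * u ^ j)" by (simp add: poly_altdef P d_def)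
      also have "\<dots> = (\<Sum>j<d. of_int (P j) * u ^ j) + of_int lc * u ^ d"
        by (simp add: lc_def lessThan_Suc_atMost[symmetric])
      finally have *: "of_int lc * u ^ d = - (\<Sum>j<d. of_int (P j) * u ^ j)"
        by (metis add_eq_0_iff)
      have "of_int lc * u * y = x * (of_int lc * u ^ d)" by (simp add: y(3) i mult_ac)
      also have "\<dots> = x * - (\<Sum>j<d. of_int (P j) * u ^ j)" by (simp only: *)
      also have "\<dots> = (\<Sum>j<d. of_int (- P j) * (x * u ^ j))"
        by (simp add: sum_distrib_left sum_negf mult_ac)
      also have "\<dots> \<in> int_span W (\<Sum>j<d. nat \<bar>- P j\<bar> * 1)"
        by (intro int_span_sum int_span_scale int_span_base W WI y) auto
      finally show ?thesis by (rule int_span_mono) (simp add: h'_def)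
    qed
  qed
  \<comment> \<open>The leading coefficient may be negative while the denominator is a natural
    number; its sign acts with size 1 and corrects this.\<close>
  have lc': "int_acts W (of_int (sgn lc)) 1"
    using int_acts_of_int[OF W, of "sgn lc"] lc by (simp add: abs_sgn_eq)
  have d': "int_acts W (of_nat \<delta>) \<delta>" using int_acts_of_int[OF W, of "int \<delta>"] by simp
  have lc'': "int_acts W (of_nat (nat \<bar>lc\<bar>)) (nat \<bar>lc\<bar>)" using int_acts_of_int[OF W, of "\<bar>lc\<bar>"] by simp
  define \<delta>' where "\<delta>' = nat \<bar>lc\<bar> * \<delta>"
  have 1: "int_acts W (of_nat \<delta>' * w) (nat \<bar>lc\<bar> * h)" if "w \<in> U" for w
    using int_acts_mult[OF W lc'' lift[OF V(4)[OF that]]] by (simp add: \<delta>'_def mult_ac)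
  have 2: "int_acts W (of_nat \<delta>' * u) (\<delta> * h')"
  proof -
    have "int_acts W (of_nat \<delta> * (of_int (sgn lc) * (of_int lc * u))) (\<delta> * (1 * h'))"
      by (intro int_acts_mult W d' lc' u)
    moreover have sgn: "(of_int (sgn lc) * of_int lc :: 'a) = of_int \<bar>lc\<bar>"
      by (metis abs_sgn mult.commute of_int_mult)
    have "of_nat \<delta> * (of_int (sgn lc) * (of_int lc * u)) = of_nat \<delta>' * u"
      unfolding \<delta>'_def mult.assoc[of _ _ u, symmetric] sgn by simp
    ultimately show ?thesis by simp
  qed
  have "1 \<in> W" using WI[of 1 0] V \<open>d > 0\<close> by simp
  moreover have "\<delta>' \<ge> 1" using lc V by (simp add: \<delta>'_def)
  moreover have "\<forall>w\<in>insert u U. int_acts W (of_nat \<delta>' * w) (nat \<bar>lc\<bar> * h + \<delta> * h')"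
    using int_acts_mono[OF 1 le_add1] int_acts_mono[OF 2 le_add2] by blast
  ultimately show ?case using W by blast
qed

text \<open>After clearing denominators both factors act on one module, hence so does their product.
  The substitution by \<open>c\<close> times the variable then removes the factor \<delta>^2 from
  the root.\<close>

lemma algebraic_mult:
  fixes x y :: "'a::field_char_0"
  assumes "algebraic x" "algebraic y"
  shows "algebraic (x * y)"
proof -
  obtain V \<delta> h where V: "finite V" "1 \<in> V" "\<delta> \<ge> 1"
    "int_acts V (of_nat \<delta> * x) h" "int_acts V (of_nat \<delta> * y) h"
    using ex_int_acts[of "{x, y}"] assms by auto
  have "algebraic (of_nat \<delta> * x * (of_nat \<delta> * y))"
    by (rule int_acts_imp_algebraic[OF V(1) int_acts_mult[OF V(1,4,5)] V(2)]) simp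
  then obtain p where p: "\<And>i. coeff p i \<in> \<int>" "p \<noteq> 0" "poly p (of_nat \<delta> * x * (of_nat \<delta> * y)) = 0"
    by (auto simp: algebraic_def)
  define c :: 'a where "c = of_nat (\<delta>\<^sup>2)"
  have c: "c \<noteq> 0" using V by (simp add: c_def)
  define q where "q = pcompose p [:0, c:]"
  have "coeff q i \<in> \<int>" for i
    using p(1) by (auto simp: q_def c_def coeff_pcompose_linear)
  moreover have "q \<noteq> 0" using p(2) c by (auto simp: q_def pcompose_eq_0_iff)
  moreover have "poly q (x * y) = 0" using p(3) by (simp add: q_def poly_pcompose c_def power2_eq_square mult_ac)
  ultimately show ?thesis by (auto intro: algebraicI)
qed

section \<open>Coefficients of characteristic polynomials and a lower bound for nonzero
  roots\<close>

definition poly_dominated :: "int poly \<Rightarrow> int poly \<Rightarrow> bool" where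
  "poly_dominated p P \<longleftrightarrow> (\<forall>i. \<bar>coeff p i\<bar> \<le> coeff P i)"

lemma poly_dominated_mult:
  assumes "poly_dominated p P" "poly_dominated q Q"
  shows "poly_dominated (p * q) (P * Q)"
  unfolding poly_dominated_def coeff_mult
proof
  fix n
  have "\<bar>\<Sum>i\<le>n. coeff p i * coeff q (n - i)\<bar> \<le> (\<Sum>i\<le>n. \<bar>coeff p i\<bar> * \<bar>coeff q (n - i)\<bar>)"
    by (rule order_trans[OF sum_abs]) (simp add: abs_mult)
  also have "\<dots> \<le> (\<Sum>i\<le>n. coeff P i * coeff Q (n - i))"
    using assms by (intro sum_mono mult_mono) (auto simp: poly_dominated_def intro: order_trans[OF abs_ge_zero])
  finally show "\<bar>\<Sum>i\<le>n. coeff p i * coeff q (n - i)\<bar> \<le> (\<Sum>i\<le>n. coeff P i * coeff Q (n - i))" .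
qed

lemma poly_dominated_prod:
  "finite A \<Longrightarrow> (\<And>a. a \<in> A \<Longrightarrow> poly_dominated (f a) (F a)) \<Longrightarrow> poly_dominated (prod f A) (prod F A)"
proof (induction A rule: finite_induct)
  case empty
  then show ?case by (auto simp: poly_dominated_def)
qed (auto intro: poly_dominated_mult)

lemma poly_dominated_sum:
  "(\<And>a. a \<in> A \<Longrightarrow> poly_dominated (f a) (F a)) \<Longrightarrow> poly_dominated (sum f A) (sum F A)"
  unfolding poly_dominated_def coeff_sum by (auto intro!: order_trans[OF sum_abs] sum_mono)

text \<open>In the Leibniz expansion every entry of the characteristic matrix is dominated by X + h.
  The coefficient sum of the n! resulting products (X + h)^n is their value at 1.\<close>

lemma sum_abs_coeff_char_poly_le:
  fixes M :: "int mat"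
  assumes M: "M \<in> carrier_mat n n" and h: "\<And>i j. i < n \<Longrightarrow> j < n \<Longrightarrow> \<bar>M $$ (i, j)\<bar> \<le> int h"
  shows "(\<Sum>i\<le>n. \<bar>coeff (char_poly M) i\<bar>) \<le> fact n * (int h + 1) ^ n"
proof -
  define Q :: "int poly" where "Q = (\<Sum>p | p permutes {0..<n}. \<Prod>i = 0..<n. [:int h, 1:])"
  have ent: "poly_dominated (char_poly_matrix M $$ (i, j)) [:int h, 1:]" if "i < n" "j < n" for i j
    using that M h[OF that] unfolding poly_dominated_def
    by (auto simp: char_poly_matrix_def coeff_pCons split: nat.splits)
  have "poly_dominated (signof p * (\<Prod>i = 0..<n. char_poly_matrix M $$ (i, p i))) (\<Prod>i = 0..<n. [:int h, 1:])"
    if "p permutes {0..<n}" for p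
  proof -
    have "poly_dominated (\<Prod>i = 0..<n. char_poly_matrix M $$ (i, p i)) (\<Prod>i = 0..<n. [:int h, 1:])"
      using that by (intro poly_dominated_prod ent) (auto simp: permutes_in_image[of p "{0..<n}", simplified])
    then show ?thesis by (cases p rule: sign_cases) (auto simp: poly_dominated_def)
  qed
  then have dom: "poly_dominated (char_poly M) Q"
    unfolding char_poly_def Q_def det_def'[OF char_poly_matrix_closed[OF M]]
    by (intro poly_dominated_sum) auto
  have "(\<Sum>i\<le>n. \<bar>coeff (char_poly M) i\<bar>) \<le> (\<Sum>i\<le>n. coeff Q i)"
    using dom by (intro sum_mono) (auto simp: poly_dominated_def)
  also have "\<dots> \<le> (\<Sum>i\<le>max n (degree Q). coeff Q i)"
    using dom by (intro sum_mono2) (auto simp: poly_dominated_def intro: order_trans[OF abs_ge_zero])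
  also have "\<dots> = (\<Sum>i\<le>degree Q. coeff Q i)"
    by (intro sum.mono_neutral_right) (auto simp: coeff_eq_0)
  also have "\<dots> = poly Q 1"
    by (simp add: poly_altdef)
  also have "\<dots> = fact n * (int h + 1) ^ n"
  proof -
    have "poly Q 1 = (\<Sum>p | p permutes {0..<n}. (int h + 1) ^ n)"
      by (simp only: Q_def poly_sum poly_prod) (simp add: add.commute)
    then show ?thesis using card_permutations[of "{0..<n}" n] by simp
  qed
  finally show ?thesis .
qed

text \<open>
  The lowest nonzero coefficient of the characteristic polynomial is an integer, which bounds every
  nonzero root from below. This does not require \<open>V\<close> to be linearly independent.
\<close>

theorem int_acts_lower_bound:
  fixes u :: real
  assumes V: "finite V" "x \<in> V" "x \<noteq> 0" and u: "int_acts V u h" "u \<noteq> 0"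
  shows "1 \<le> \<bar>u\<bar> * (fact (card V) * (real h + 1) ^ card V)"
proof -
  define n where "n = card V"
  obtain M where M: "M \<in> carrier_mat n n" "\<And>i j. i < n \<Longrightarrow> j < n \<Longrightarrow> \<bar>M $$ (i, j)\<bar> \<le> int h"
    "poly (map_poly of_int (char_poly M)) u = 0"
    using int_acts_matrix[OF V(1) u(1) V(2,3)] unfolding n_def by metis
  define c where "c = coeff (char_poly M)"
  have deg: "degree (char_poly M) = n" "c n = 1"
    using degree_monic_char_poly[OF M(1)] by (auto simp: c_def)
  have sumc: "(\<Sum>i\<le>n. \<bar>real_of_int (c i)\<bar>) \<le> fact n * (real h + 1) ^ n"
  proof -
    have "(\<Sum>i\<le>n. \<bar>c i\<bar>) \<le> fact n * (int h + 1) ^ n"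
      unfolding c_def by (rule sum_abs_coeff_char_poly_le[OF M(1,2)])
    then have "real_of_int (\<Sum>i\<le>n. \<bar>c i\<bar>) \<le> real_of_int (fact n * (int h + 1) ^ n)"
      by (simp only: of_int_le_iff)
    then show ?thesis by simp
  qed
  have root: "(\<Sum>i\<le>n. of_int (c i) * u ^ i) = 0"
    using M(3) by (simp add: poly_altdef degree_map_poly coeff_map_poly deg c_def)
  define k where "k = (LEAST i. c i \<noteq> 0)"
  have k: "c k \<noteq> 0" unfolding k_def by (rule LeastI[of _ n]) (simp add: deg)
  have k2: "c i = 0" if "i < k" for i
    using not_less_Least[of i "\<lambda>i. c i \<noteq> 0"] that by (simp add: k_def)
  have kn: "k \<le> n" using deg(2) by (auto simp: k_def intro: Least_le)
  have "u ^ k * (\<Sum>i\<in>{k..n}. of_int (c i) * u ^ (i - k)) = (\<Sum>i\<in>{k..n}. of_int (c i) * u ^ i)"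
    unfolding sum_distrib_left
    by (intro sum.cong refl) (auto simp: power_add[symmetric] mult.left_commute)
  also have "\<dots> = (\<Sum>i\<le>n. of_int (c i) * u ^ i)"
    by (intro sum.mono_neutral_left) (auto simp: k2)
  finally have "(\<Sum>i\<in>{k..n}. of_int (c i) * u ^ (i - k)) = 0"
    using root u by simp
  moreover have "{k..n} = insert k {k<..n}" using kn by auto
  ultimately have ck: "of_int (c k) = - (\<Sum>i\<in>{k<..n}. of_int (c i) * u ^ (i - k))"
    by simp
  have B: "1 \<le> fact n * (real h + 1) ^ n"
    using mult_mono[of 1 "fact n" 1 "(real h + 1) ^ n"] fact_ge_1 by (simp add: one_le_power)
  show ?thesis
  \<comment> \<open>For |u| > 1 the right-hand side is at least 1 in any case. Otherwise every
    positive power of u is at most |u|, so the lowest nonzero coefficient is bounded by |u| times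
    the sum of all coefficients.\<close>
  proof (cases "\<bar>u\<bar> \<le> 1")
    case True
    have "1 \<le> \<bar>real_of_int (c k)\<bar>" using k by linarith
    also have "\<dots> \<le> (\<Sum>i\<in>{k<..n}. \<bar>of_int (c i) * u ^ (i - k)\<bar>)"
      unfolding ck by (simp add: sum_abs)
    also have "\<dots> \<le> (\<Sum>i\<in>{k<..n}. \<bar>u\<bar> * \<bar>of_int (c i)\<bar>)"
    proof (intro sum_mono)
      fix i assume "i \<in> {k<..n}"
      then have "\<bar>u\<bar> ^ (i - k) \<le> \<bar>u\<bar> ^ 1" using True by (intro power_decreasing) auto
      then show "\<bar>of_int (c i) * u ^ (i - k)\<bar> \<le> \<bar>u\<bar> * \<bar>of_int (c i)\<bar>"
        using mult_left_mono[of "\<bar>u\<bar> ^ (i - k)" "\<bar>u\<bar>" "\<bar>of_int (c i)\<bar>"]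
        by (simp add: abs_mult power_abs mult.commute[of "\<bar>u\<bar>"])
    qed
    also have "\<dots> \<le> (\<Sum>i\<le>n. \<bar>u\<bar> * \<bar>of_int (c i)\<bar>)"
      by (intro sum_mono2) auto
    also have "\<dots> \<le> \<bar>u\<bar> * (fact n * (real h + 1) ^ n)"
      unfolding sum_distrib_left[symmetric] by (intro mult_left_mono sumc) auto
    finally show ?thesis by (simp add: n_def)
  next
    case False
    then show ?thesis using mult_mono[of 1 "\<bar>u\<bar>" 1 "fact n * (real h + 1) ^ n"] B by (simp add: n_def)
  qed
qed

subsection \<open>Zeros of real exponential polynomials\<close>

text \<open>Rolle between neighbouring zeros. The clause \<open>x < Max Z\<close> carries the
  induction: the zero found next lies beyond the old maximum and so differs from all earlier
  ones.\<close>

lemma finite_zeros_deriv: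
  fixes f f' :: "real \<Rightarrow> real"
  assumes "\<And>x. (f has_real_derivative f' x) (at x)"
  shows "finite Z \<Longrightarrow> Z \<noteq> {} \<Longrightarrow> (\<And>x. x \<in> Z \<Longrightarrow> f x = 0) \<Longrightarrow>
    \<exists>Z'. finite Z' \<and> card Z' = card Z - 1 \<and> (\<forall>x\<in>Z'. f' x = 0 \<and> x < Max Z)"
proof (induction Z rule: finite_linorder_max_induct)
  case (insert b A)
  show ?case
  proof (cases "A = {}")
    case False
    then obtain Z' where Z': "finite Z'" "card Z' = card A - 1" "\<forall>x\<in>Z'. f' x = 0 \<and> x < Max A"
      using insert by auto
    have m: "Max A < b" "Max A \<in> A" using insert False by auto
    have "\<exists>z. Max A < z \<and> z < b \<and> DERIV f z :> 0"
    proof (rule Rolle)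
      show "continuous_on {Max A..b} f"
        using assms by (intro continuous_at_imp_continuous_on ballI) (blast intro: DERIV_isCont)
      show "f differentiable (at x)" for x using assms real_differentiable_def by blast
    qed (use m insert in auto)
    then obtain z where z: "Max A < z" "z < b" "DERIV f z :> 0" by auto
    have z0: "f' z = 0" using DERIV_unique[OF assms z(3)] .
    have "z \<notin> Z'" using Z' z by force
    moreover have "card A > 0" using insert False by (simp add: card_gt_0_iff)
    moreover have "b \<notin> A" using insert(2) by auto
    ultimately have "card (insert z Z') = card (insert b A) - 1"
      using Z'(1,2) insert(1) by simp
    moreover have "Max (insert b A) = b" using insert(1) m False by (subst Max_insert) auto
    moreover have "f' x = 0 \<and> x < b" if "x \<in> insert z Z'" for x
      using that z0 z Z'(3) m by (metis insertE less_trans)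
    ultimately show ?thesis using Z'(1)
      by (intro exI[of _ "insert z Z'"]) simp
  qed (auto intro: exI[of _ "{}"])
qed simp

text \<open>Multiplication by exp(-v t) turns the term of frequency v into a plain polynomial.
  Differentiation then lowers its degree by one, or removes it if it is constant, and keeps all
  other degrees, while Rolle loses at most one zero. So the total of degree plus one drops by
  exactly one in each step.\<close>

lemma card_zeros_exp_poly:
  fixes P :: "real \<Rightarrow> real poly"
  assumes "finite W" "W \<noteq> {}" "\<And>w. w \<in> W \<Longrightarrow> P w \<noteq> 0"
    and "finite Z" "\<And>t. t \<in> Z \<Longrightarrow> (\<Sum>w\<in>W. poly (P w) t * exp (w * t)) = 0"
  shows "card Z < (\<Sum>w\<in>W. degree (P w) + 1)"
  using assms
proof (induction "\<Sum>w\<in>W. degree (P w) + 1" arbitrary: W P Z rule: less_induct)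
  case less
  obtain v where v: "v \<in> W" using less.prems by auto
  define G where "G = (\<lambda>t. \<Sum>w\<in>W. poly (P w) t * exp ((w - v) * t))"
  have GZ: "G t = 0" if "t \<in> Z" for t
  proof -
    have "G t = exp (- v * t) * (\<Sum>w\<in>W. poly (P w) t * exp (w * t))"
      unfolding G_def sum_distrib_left by (intro sum.cong refl) (simp add: algebra_simps flip: exp_add)
    then show ?thesis using less.prems(5)[OF that] by simp
  qed
  define R where "R = (\<lambda>w. pderiv (P w) + Polynomial.smult (w - v) (P w))"
  define G' where "G' = (\<lambda>t. \<Sum>w\<in>W. poly (R w) t * exp ((w - v) * t))"
  have deriv: "(G has_real_derivative G' t) (at t)" for t
    unfolding G_def G'_def R_def
    by (auto intro!: derivative_eq_intros sum.cong poly_DERIV simp: algebra_simps)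
  have degR: "degree (R w) = degree (P w)" "R w \<noteq> 0" if "w \<in> W" "w \<noteq> v" for w
  proof -
    have c: "coeff (R w) (degree (P w)) = (w - v) * lead_coeff (P w)"
      by (simp add: R_def coeff_pderiv coeff_eq_0)
    then have nz: "coeff (R w) (degree (P w)) \<noteq> 0" using that less.prems(3)[of w] by simp
    then show "R w \<noteq> 0" by auto
    have "degree (R w) \<le> degree (P w)"
      unfolding R_def by (intro degree_add_le) (auto simp: degree_pderiv)
    then show "degree (R w) = degree (P w)" using le_degree[OF nz] by simp
  qed
  have Rv: "R v = pderiv (P v)" by (simp add: R_def)
  define W' where "W' = {w\<in>W. R w \<noteq> 0}"
  have W'W: "W' = (if degree (P v) = 0 then W - {v} else W)"
  proof -
    have "R w \<noteq> 0 \<longleftrightarrow> w \<noteq> v \<or> degree (P v) \<noteq> 0" if "w \<in> W" for w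
      using degR(2)[OF that] by (cases "w = v") (auto simp: Rv pderiv_eq_0_iff)
    then show ?thesis using v by (auto simp: W'_def)
  qed
  have total: "(\<Sum>w\<in>W'. degree (R w) + 1) + 1 = (\<Sum>w\<in>W. degree (P w) + 1)"
  proof -
    have e: "(\<Sum>w\<in>W - {v}. degree (R w) + 1) = (\<Sum>w\<in>W - {v}. degree (P w) + 1)"
      using degR by (intro sum.cong) auto
    show ?thesis
      using e sum.remove[OF less.prems(1) v, of "\<lambda>w. degree (P w) + 1"]
        sum.remove[OF less.prems(1) v, of "\<lambda>w. degree (R w) + 1"]
      by (auto simp: W'W Rv degree_pderiv)
  qed
  have fin: "finite W'" using less.prems(1) by (simp add: W'_def)
  have G'2: "G' t = exp (- v * t) * (\<Sum>w\<in>W'. poly (R w) t * exp (w * t))" for t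
  proof -
    have "G' t = (\<Sum>w\<in>W'. poly (R w) t * exp ((w - v) * t))"
      unfolding G'_def using less.prems(1) by (intro sum.mono_neutral_right) (auto simp: W'_def)
    then show ?thesis unfolding sum_distrib_left by (simp add: algebra_simps flip: exp_add)
  qed
  show ?case
  proof (cases "Z = {}")
    case True
    then show ?thesis using total by simp
  next
    case Z: False
    then obtain Z' where Z': "finite Z'" "card Z' = card Z - 1" "\<forall>x\<in>Z'. G' x = 0"
      using finite_zeros_deriv[of G G', OF deriv less.prems(4)] GZ by blast
    show ?thesis
    proof (cases "W' = {}")
      \<comment> \<open>Nothing survives the differentiation, so \<open>G\<close> is a nonzero
        constant, contrary to its having a zero.\<close>
      case True
      then have W: "W = {v}" "degree (P v) = 0" using W'W v by (auto split: if_splits)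
      then obtain c where c: "P v = [:c:]" by (auto elim: degree_eq_zeroE)
      then have "c \<noteq> 0" using less.prems(3)[OF v] by auto
      then show ?thesis using GZ Z by (auto simp: G_def W c)
    next
      case False
      have "card Z' < (\<Sum>w\<in>W'. degree (R w) + 1)"
      proof (rule less.hyps[OF _ fin False _ Z'(1)])
        show "(\<Sum>w\<in>W'. degree (R w) + 1) < (\<Sum>w\<in>W. degree (P w) + 1)" using total by simp
        show "R w \<noteq> 0" if "w \<in> W'" for w using that by (simp add: W'_def)
        show "(\<Sum>w\<in>W'. poly (R w) t * exp (w * t)) = 0" if "t \<in> Z'" for t
          using Z'(3) that G'2[of t] by simp
      qed
      then show ?thesis using Z'(2) total by simp
    qed
  qed
qed

lemma card_zeros_exp_poly_family:
  fixes P :: "'i \<Rightarrow> real poly" and w :: "'i \<Rightarrow> real"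
  assumes "finite A" "A \<noteq> {}" "inj_on w A" "\<And>i. i \<in> A \<Longrightarrow> P i \<noteq> 0"
    and "finite Z" "\<And>t. t \<in> Z \<Longrightarrow> (\<Sum>i\<in>A. poly (P i) t * exp (w i * t)) = 0"
  shows "card Z < (\<Sum>i\<in>A. degree (P i) + 1)"
proof -
  define Q where "Q = P \<circ> inv_into A w"
  have Q: "Q (w i) = P i" if "i \<in> A" for i
    using that assms(3) by (simp add: Q_def)
  have "card Z < (\<Sum>v\<in>w ` A. degree (Q v) + 1)"
    using assms Q by (intro card_zeros_exp_poly) (auto simp: sum.reindex)
  then show ?thesis using Q by (simp add: sum.reindex[OF assms(3)])
qed

subsection \<open>Interpolation determinants\<close>

text \<open>Counting from 0, the i-th smallest of distinct naturals is at least i. This bounds from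
  below the total degree of a nonvanishing generalized Vandermonde determinant.\<close>

lemma sum_nat_ge_triangular: "finite (A::nat set) \<Longrightarrow> (\<Sum>i<card A. i) \<le> \<Sum>A"
proof (induction A rule: finite_linorder_max_induct)
  case (insert b A)
  have "card A \<le> b"
    using card_mono[of "{..<b}" A] insert by auto
  then show ?case using insert by auto
qed simp

lemma abs_det_le:
  fixes M :: "real mat"
  assumes "M \<in> carrier_mat L L" "\<And>p. p permutes {0..<L} \<Longrightarrow> (\<Prod>i = 0..<L. \<bar>M $$ (i, p i)\<bar>) \<le> B"
  shows "\<bar>det M\<bar> \<le> fact L * B"
proof -
  have "\<bar>det M\<bar> \<le> (\<Sum>p | p permutes {0..<L}. \<bar>signof p * (\<Prod>i = 0..<L. M $$ (i, p i))\<bar>)"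
    unfolding det_def'[OF assms(1)] by (rule sum_abs)
  also have "\<dots> \<le> (\<Sum>p | p permutes {0..<L}. B)"
  proof (intro sum_mono)
    fix p assume "p \<in> {p. p permutes {0..<L}}"
    then show "\<bar>signof p * (\<Prod>i = 0..<L. M $$ (i, p i))\<bar> \<le> B"
      using assms(2)[of p] by (cases p rule: sign_cases) (auto simp: abs_mult abs_prod)
  qed
  finally show ?thesis by (simp add: card_permutations[OF refl])
qed

text \<open>
  Expanding every entry of the determinant multilinearly, the contribution of exponents
  $n_0, n_1, \ldots$ is a generalized Vandermonde determinant, which vanishes unless the exponents
  are distinct. So only total degrees at least $L(L-1)/2$ occur.
\<close>

lemma det_power_series_le:
  fixes a :: "nat \<Rightarrow> nat \<Rightarrow> real" and F :: "nat \<Rightarrow> nat \<Rightarrow> real"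
  assumes R: "0 < R" "R \<le> \<rho>" and t: "\<And>\<mu>. \<mu> < L \<Longrightarrow> \<bar>t \<mu>\<bar> \<le> R"
    and F: "\<And>i \<mu>. i < L \<Longrightarrow> \<mu> < L \<Longrightarrow> (\<lambda>n. a i n * t \<mu> ^ n) sums F i \<mu>"
    and G: "\<And>i. i < L \<Longrightarrow> (\<lambda>n. \<bar>a i n\<bar> * \<rho> ^ n) sums G i"
  shows "\<bar>det (mat L L (\<lambda>(i, \<mu>). F i \<mu>))\<bar> \<le> fact L * (R / \<rho>) ^ (\<Sum>i<L. i) * (\<Prod>i=0..<L. G i)"
proof -
  \<comment> \<open>Truncation makes the multilinear expansion a finite sum; the bound obtained does
    not depend on \<open>B\<close> and passes to the limit.\<close>
  define FB where "FB B i \<mu> = (\<Sum>n<B. a i n * t \<mu> ^ n)" for B i \<mu>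
  have expand: "det (mat L L (\<lambda>(i, \<mu>). f i \<mu>)) = (\<Sum>p | p permutes {0..<L}. signof p * (\<Prod>i = 0..<L. f i (p i)))"
    for f :: "nat \<Rightarrow> nat \<Rightarrow> real"
    by (subst det_def'[of _ L])
      (auto intro!: sum.cong prod.cong simp: permutes_in_image[of _ "{0..<L}", simplified])
  have lim: "(\<lambda>B. det (mat L L (\<lambda>(i, \<mu>). FB B i \<mu>))) \<longlonglongrightarrow> det (mat L L (\<lambda>(i, \<mu>). F i \<mu>))"
    unfolding expand
  proof (intro tendsto_intros)
    fix p i assume "p \<in> {p. p permutes {0..<L}}" "i \<in> {0..<L}"
    then have "i < L" "p i < L" by (auto simp: permutes_in_image[of _ "{0..<L}", simplified])
    then show "(\<lambda>B. FB B i (p i)) \<longlonglongrightarrow> F i (p i)"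
      using F unfolding FB_def sums_def by blast
  qed
  have "\<bar>det (mat L L (\<lambda>(i, \<mu>). FB B i \<mu>))\<bar> \<le> fact L * (R / \<rho>) ^ (\<Sum>i<L. i) * (\<Prod>i=0..<L. G i)" for B
  proof -
    define M where "M = PiE {0..<L} (\<lambda>_. {..<B})"
    define V where "V m = mat L L (\<lambda>(i, \<mu>). t \<mu> ^ m i)" for m
    have V: "V m \<in> carrier_mat L L" for m by (simp add: V_def)
    have "det (mat L L (\<lambda>(i, \<mu>). FB B i \<mu>)) =
        (\<Sum>p | p permutes {0..<L}. signof p * (\<Sum>m\<in>M. \<Prod>i = 0..<L. a i (m i) * t (p i) ^ m i))"
      unfolding expand FB_def M_def by (subst prod_sum_PiE) auto
    also have "\<dots> = (\<Sum>m\<in>M. (\<Prod>i = 0..<L. a i (m i)) * det (V m))"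
      unfolding V_def expand sum_distrib_left prod.distrib
      by (subst sum.swap) (intro sum.cong refl, simp add: mult_ac)
    finally have eq: "det (mat L L (\<lambda>(i, \<mu>). FB B i \<mu>)) = (\<Sum>m\<in>M. (\<Prod>i = 0..<L. a i (m i)) * det (V m))" .
    have bound: "\<bar>(\<Prod>i = 0..<L. a i (m i)) * det (V m)\<bar> \<le>
        fact L * (R / \<rho>) ^ (\<Sum>i<L. i) * (\<Prod>i = 0..<L. \<bar>a i (m i)\<bar> * \<rho> ^ m i)" for m
    proof (cases "inj_on m {0..<L}")
      case False
      then obtain i j where ij: "i < L" "j < L" "i \<noteq> j" "m i = m j" by (auto simp: inj_on_def)
      have "det (V m) = 0"
        by (rule det_identical_rows[OF V ij(3,1,2)]) (use ij in \<open>auto simp: V_def\<close>)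
      then show ?thesis using R by (auto intro!: mult_nonneg_nonneg prod_nonneg zero_le_power)
    next
      case True
      have "\<bar>det (V m)\<bar> \<le> fact L * R ^ (\<Sum>i=0..<L. m i)"
      proof (rule abs_det_le[OF V])
        fix p assume p: "p permutes {0..<L}"
        then have "(\<Prod>i = 0..<L. \<bar>V m $$ (i, p i)\<bar>) = (\<Prod>i = 0..<L. \<bar>t (p i)\<bar> ^ m i)"
          by (intro prod.cong) (auto simp: V_def power_abs permutes_in_image[of _ "{0..<L}", simplified])
        also have "\<dots> \<le> (\<Prod>i = 0..<L. R ^ m i)"
          using p by (intro prod_mono) (auto intro!: power_mono t simp: permutes_in_image[of _ "{0..<L}", simplified])
        finally show "(\<Prod>i = 0..<L. \<bar>V m $$ (i, p i)\<bar>) \<le> R ^ (\<Sum>i=0..<L. m i)"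
          by (simp add: power_sum)
      qed
      \<comment> \<open>The power of R/\<rho> is the saving, controlled by the least possible total
        degree. The power of \<rho> goes back to the coefficients, whose weighted sums are bounded
        by \<open>G\<close>.\<close>
      also have "R ^ (\<Sum>i=0..<L. m i) = (R / \<rho>) ^ (\<Sum>i=0..<L. m i) * \<rho> ^ (\<Sum>i=0..<L. m i)"
        using R by (simp add: power_divide)
      also have "\<dots> \<le> (R / \<rho>) ^ (\<Sum>i<L. i) * \<rho> ^ (\<Sum>i=0..<L. m i)"
      proof (intro mult_right_mono power_decreasing)
        show "(\<Sum>i<L. i) \<le> (\<Sum>i=0..<L. m i)"
          using sum_nat_ge_triangular[of "m ` {0..<L}"] True by (simp add: card_image sum.reindex)
      qed (use R in auto)
      finally have "\<bar>det (V m)\<bar> \<le> fact L * ((R / \<rho>) ^ (\<Sum>i<L. i) * \<rho> ^ (\<Sum>i=0..<L. m i))"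
        by (simp add: mult_left_mono)
      then have "\<bar>\<Prod>i = 0..<L. a i (m i)\<bar> * \<bar>det (V m)\<bar> \<le>
          \<bar>\<Prod>i = 0..<L. a i (m i)\<bar> * (fact L * ((R / \<rho>) ^ (\<Sum>i<L. i) * \<rho> ^ (\<Sum>i=0..<L. m i)))"
        by (rule mult_left_mono) auto
      then show ?thesis by (simp add: abs_mult abs_prod prod.distrib power_sum mult_ac)
    qed
    have "\<bar>det (mat L L (\<lambda>(i, \<mu>). FB B i \<mu>))\<bar> \<le> (\<Sum>m\<in>M. \<bar>(\<Prod>i = 0..<L. a i (m i)) * det (V m)\<bar>)"
      unfolding eq by (rule sum_abs)
    also have "\<dots> \<le> (\<Sum>m\<in>M. fact L * (R / \<rho>) ^ (\<Sum>i<L. i) * (\<Prod>i = 0..<L. \<bar>a i (m i)\<bar> * \<rho> ^ m i))"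
      by (intro sum_mono bound)
    also have "\<dots> = fact L * (R / \<rho>) ^ (\<Sum>i<L. i) * (\<Prod>i = 0..<L. \<Sum>n<B. \<bar>a i n\<bar> * \<rho> ^ n)"
      unfolding sum_distrib_left[symmetric] M_def by (subst prod_sum_PiE) auto
    also have "\<dots> \<le> fact L * (R / \<rho>) ^ (\<Sum>i<L. i) * (\<Prod>i = 0..<L. G i)"
    proof (intro mult_left_mono prod_mono conjI)
      fix i assume "i \<in> {0..<L}"
      then have "(\<lambda>n. \<bar>a i n\<bar> * \<rho> ^ n) sums G i" using G by auto
      then show "(\<Sum>n<B. \<bar>a i n\<bar> * \<rho> ^ n) \<le> G i"
        using sum_le_suminf[of "\<lambda>n. \<bar>a i n\<bar> * \<rho> ^ n" "{..<B}"] R by (auto simp: sums_iff)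
    qed (use R in \<open>auto intro!: sum_nonneg\<close>)
    finally show ?thesis .
  qed
  then show ?thesis
    using tendsto_rabs[OF lim] by (intro LIMSEQ_le_const2) auto
qed

lemma power_times_exp_sums:
  fixes w t :: real
  shows "(\<lambda>n. (if n < i then 0 else w ^ (n - i) / fact (n - i)) * t ^ n) sums (t ^ i * exp (w * t))"
proof -
  have "(\<lambda>n. (w * t) ^ n /\<^sub>R fact n) sums exp (w * t)" by (rule exp_converges)
  then have "(\<lambda>n. t ^ i * ((w * t) ^ n /\<^sub>R fact n)) sums (t ^ i * exp (w * t))" by (rule sums_mult)
  then have "(\<lambda>n. (if n + i < i then 0 else w ^ (n + i - i) / fact (n + i - i)) * t ^ (n + i)) sums (t ^ i * exp (w * t))"
    by (simp add: power_mult_distrib power_add divide_inverse mult_ac)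
  then show ?thesis
    by (subst sums_zero_iff_shift[symmetric, where n = i]) auto
qed

text \<open>The index l = i + I j encodes a pair, since the rows of a determinant are numbered
  consecutively.\<close>

lemma sum_div_mod:
  fixes f :: "nat \<Rightarrow> nat \<Rightarrow> 'a::comm_monoid_add"
  assumes "I > 0"
  shows "(\<Sum>l<I * J. f (l mod I) (l div I)) = (\<Sum>j<J. \<Sum>i<I. f i j)"
proof -
  have "i + I * j < I * J" if "i < I" "j < J" for i j
  proof -
    have "i + I * j < I * Suc j" using that by simp
    also have "\<dots> \<le> I * J" using that by (intro mult_le_mono) auto
    finally show ?thesis .
  qed
  then have "(\<Sum>l<I * J. f (l mod I) (l div I)) = (\<Sum>(j, i)\<in>{..<J} \<times> {..<I}. f i j)"
    by (intro sum.reindex_bij_witness[where i = "\<lambda>(j, i). i + I * j" and j = "\<lambda>l. (l div I, l mod I)"])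
      (use assms in \<open>auto simp: less_mult_imp_div_less mult.commute\<close>)
  then show ?thesis by (simp add: sum.cartesian_product)
qed

text \<open>A kernel vector of the transpose is the coefficient vector of a nonzero exponential
  polynomial with at most J frequencies and coefficient polynomials of degree below I. It would
  vanish at I J distinct points, which is one zero too many.\<close>

lemma exp_interpolation_det_nonzero:
  fixes c :: real and t :: "nat \<Rightarrow> real"
  assumes "I > 0" "c \<noteq> 0" "inj_on t {..<I * J}"
  shows "det (mat (I * J) (I * J) (\<lambda>(l, \<mu>). t \<mu> ^ (l mod I) * exp (real (l div I) * c * t \<mu>))) \<noteq> 0"
proof
  define L where "L = I * J"
  let ?F = "\<lambda>l \<mu>. t \<mu> ^ (l mod I) * exp (real (l div I) * c * t \<mu>)"
  let ?A = "mat L L (\<lambda>(\<mu>, l). ?F l \<mu>)"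
  assume "det (mat (I * J) (I * J) (\<lambda>(l, \<mu>). ?F l \<mu>)) = 0"
  moreover have "det (mat L L (\<lambda>(l, \<mu>). ?F l \<mu>)) = det (transpose_mat (mat L L (\<lambda>(l, \<mu>). ?F l \<mu>)))"
    by (rule det_transpose[symmetric, of _ L]) simp
  moreover have "transpose_mat (mat L L (\<lambda>(l, \<mu>). ?F l \<mu>)) = ?A"
    by (rule eq_matI) auto
  ultimately have "det ?A = 0" by (simp add: L_def)
  then obtain v where v: "v \<in> carrier_vec L" "v \<noteq> 0\<^sub>v L" "?A *\<^sub>v v = 0\<^sub>v L"
    using det_0_iff_vec_prod_zero_field[of ?A L] by auto
  define P where "P j = (\<Sum>i<I. monom (vec_index v (i + I * j)) i)" for j
  define A where "A = {j\<in>{..<J}. P j \<noteq> 0}"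
  have coeffP: "coeff (P j) i = vec_index v (i + I * j)" if "i < I" for i j
    using that by (simp add: P_def coeff_sum sum.delta)
  have degP: "degree (P j) < I" for j
    using \<open>I > 0\<close> unfolding P_def by (intro degree_sum_less) (auto intro: le_less_trans[OF degree_monom_le])
  have "\<exists>l<L. vec_index v l \<noteq> 0"
  proof (rule ccontr)
    assume "\<not> ?thesis"
    then have "v = 0\<^sub>v L" using v(1) by (intro eq_vecI) auto
    then show False using v by simp
  qed
  then obtain l where l: "l < L" "vec_index v l \<noteq> 0" by auto
  have "coeff (P (l div I)) (l mod I) \<noteq> 0" using l \<open>I > 0\<close> by (simp add: coeffP)
  then have "l div I \<in> A" using l by (auto simp: A_def L_def less_mult_imp_div_less mult.commute)
  then have "A \<noteq> {}" by auto
  have zero: "(\<Sum>j\<in>A. poly (P j) (t \<mu>) * exp (real j * c * t \<mu>)) = 0" if "\<mu> < L" for \<mu>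
  proof -
    have "vec_index (?A *\<^sub>v v) \<mu> = (\<Sum>l<L. ?F l \<mu> * vec_index v l)"
      using v(1) that by (simp add: scalar_prod_def lessThan_atLeast0)
    also have "\<dots> = (\<Sum>l<I * J. t \<mu> ^ (l mod I) * exp (real (l div I) * c * t \<mu>) * vec_index v (l mod I + I * (l div I)))"
      by (simp add: L_def)
    also have "\<dots> = (\<Sum>j<J. \<Sum>i<I. t \<mu> ^ i * exp (real j * c * t \<mu>) * vec_index v (i + I * j))"
      by (rule sum_div_mod[OF \<open>I > 0\<close>])
    also have "\<dots> = (\<Sum>j<J. poly (P j) (t \<mu>) * exp (real j * c * t \<mu>))"
      by (simp add: P_def poly_sum poly_monom sum_distrib_left sum_distrib_right mult_ac)
    also have "\<dots> = (\<Sum>j\<in>A. poly (P j) (t \<mu>) * exp (real j * c * t \<mu>))"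
      unfolding A_def by (intro sum.mono_neutral_right) auto
    finally show ?thesis using v(3) that by simp
  qed
  have "card (t ` {..<L}) < (\<Sum>j\<in>A. degree (P j) + 1)"
  proof (rule card_zeros_exp_poly_family[where w = "\<lambda>j. real j * c"])
    show "A \<noteq> {}" by fact
    show "inj_on (\<lambda>j. real j * c) A" using \<open>c \<noteq> 0\<close> by (auto simp: inj_on_def)
  qed (use zero in \<open>auto simp: A_def\<close>)
  also have "\<dots> \<le> (\<Sum>j\<in>A. I)" using degP by (intro sum_mono) (auto simp: Suc_leI)
  also have "\<dots> \<le> L"
    using card_mono[of "{..<J}" A] by (auto simp: A_def L_def mult.commute)
  finally show False using assms(3) by (simp add: card_image L_def)
qed

subsection \<open>The Gelfond--Schneider theorem for real powers\<close>

text \<open>All terms on the left are of order m ln m at most; the contributions of order m^2 are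
  collected in \<kappa>.\<close>

lemma gelfond_schneider_growth:
  fixes \<kappa> k h r q n :: real
  assumes "\<kappa> > 0" "k > 0" "h > 0" "r > 0" "n \<ge> 0"
  shows "\<forall>\<^sub>F m in sequentially. k\<^sup>2 * real m * ln h + ln (k\<^sup>2 * (real m)\<^sup>2) + 1 / 2 + k\<^sup>2 * real m * ln (r * real m) + q
     + n * (ln (k\<^sup>2 * (real m)\<^sup>2) + k\<^sup>2 * real m * ln (2 * k * h * real m)) < \<kappa> * (real m)\<^sup>2"
proof -
  have "k\<^sup>2 > 0" using assms by simp
  show ?thesis
  proof (cases "n = 0")
    case True
    then show ?thesis using assms \<open>k\<^sup>2 > 0\<close> by simp real_asymp
  next
    case False
    then have "n > 0" using assms by simp
    then show ?thesis using assms \<open>k\<^sup>2 > 0\<close> by real_asymp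
  qed
qed

text \<open>
  The functions are $t^i x^{jt}$ with $i < I = K^2 m$ and $j < m$, the points $s + s' y$ with
  $s, s' < S = K m$, so that $L = I m = S^2$. The determinant is at most
  $\exp(-L^2/2 + O(L^2/K))$ by its power series expansion and at least $\exp(-O(L^2/K))$ by
  arithmetic, up to lower order terms; hence the choice of a large constant \<open>K\<close>.
\<close>

theorem gelfond_schneider_real:
  fixes x y :: real
  assumes x: "x > 0" "x \<noteq> 1" "algebraic x" and y: "algebraic y" "y \<notin> \<rat>"
  shows "\<not> algebraic (x powr y)"
proof
  define z where "z = x powr y"
  assume "algebraic (x powr y)"
  then have "\<forall>u\<in>{x, y, z}. algebraic u" using x y by (auto simp: z_def)
  then obtain V \<delta> h0 where V: "finite V" "1 \<in> V" "\<delta> \<ge> 1"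
    "\<And>u. u \<in> {x, y, z} \<Longrightarrow> int_acts V (of_nat \<delta> * u) h0"
    using ex_int_acts[of "{x, y, z}"] by (metis finite.emptyI finite_insert)
  \<comment> \<open>The maximum with \<delta> lets one bound serve \<delta> itself as well as its
    multiples of x, y and z.\<close>
  define h where "h = max h0 \<delta>"
  have acts: "int_acts V (of_nat \<delta> * x) h" "int_acts V (of_nat \<delta> * y) h" "int_acts V (of_nat \<delta> * z) h"
    "int_acts V (of_nat \<delta>) h"
    using int_acts_mono[OF V(4), of _ h] int_acts_mono[OF int_acts_of_int[OF V(1), of "int \<delta>"], of h]
    by (auto simp: h_def)
  have h: "h \<ge> 1" using V(3) by (auto simp: h_def)
  define n where "n = card V"
  define c where "c = ln x"
  have c: "c \<noteq> 0" using x by (simp add: c_def)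
  have z: "z = exp (c * y)" using x by (simp add: z_def powr_def c_def mult.commute)
  define r where "r = 1 + \<bar>y\<bar>"
  \<comment> \<open>\<open>B\<close> gathers the coefficients of K m^2: denominators and sizes of
    the powers of x and z contribute the terms with ln h, the growth of the exponentials contributes
    the middle one. The main term K^2 m^2 / 2 wins as soon as K > 2 B.\<close>
  define B where "B = 2 * ln h + \<bar>c\<bar> * exp 1 * r + 2 * n * ln h"
  define K where "K = nat \<lceil>2 * B\<rceil> + 1"
  have K: "real K > 2 * B" "K \<ge> 1" unfolding K_def by linarith+
  define \<kappa> where "\<kappa> = (real K)\<^sup>2 / 2 - K * B"
  have \<kappa>: "\<kappa> > 0" using K mult_strict_left_mono[of B "real K / 2" "real K"]
    by (simp add: \<kappa>_def power2_eq_square)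
  define q where "q = ln (fact n) + n * ln 2"
  have "\<forall>\<^sub>F m in sequentially. (real K)\<^sup>2 * real m * ln h + ln ((real K)\<^sup>2 * (real m)\<^sup>2) + 1 / 2
      + (real K)\<^sup>2 * real m * ln ((exp 1 * real K * r) * real m) + q
      + real n * (ln ((real K)\<^sup>2 * (real m)\<^sup>2) + (real K)\<^sup>2 * real m * ln (2 * real K * real h * real m)) < \<kappa> * (real m)\<^sup>2"
    using \<kappa> K h by (intro gelfond_schneider_growth) (auto simp: r_def intro!: mult_pos_pos add_pos_nonneg)
  then obtain m where m: "m \<ge> 1" "(real K)\<^sup>2 * real m * ln h + ln ((real K)\<^sup>2 * (real m)\<^sup>2) + 1 / 2
      + (real K)\<^sup>2 * real m * ln ((exp 1 * real K * r) * real m) + q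
      + real n * (ln ((real K)\<^sup>2 * (real m)\<^sup>2) + (real K)\<^sup>2 * real m * ln (2 * real K * real h * real m)) < \<kappa> * (real m)\<^sup>2"
    using eventually_conj[OF eventually_ge_at_top[of 1]] by (metis (mono_tags, lifting) eventually_sequentially le_refl)
  define S I L where "S = K * m" and "I = K\<^sup>2 * m" and "L = I * m"
  have LS: "L = S * S" by (simp add: L_def I_def S_def power2_eq_square)
  have pos: "S \<ge> 1" "I \<ge> 1" "L \<ge> 1" using m K by (auto simp: S_def I_def L_def Suc_le_eq)
  define t where "t \<mu> = real (\<mu> mod S) + real (\<mu> div S) * y" for \<mu>
  have SL: "\<mu> mod S < S" "\<mu> div S < S" if "\<mu> < L" for \<mu>
    using that pos by (auto simp: LS less_mult_imp_div_less)
  have inj: "inj_on t {..<I * m}"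
  proof (rule inj_onI)
    fix \<mu> \<mu>' assume eq: "t \<mu> = t \<mu>'"
    have "\<mu> div S = \<mu>' div S"
    proof (rule ccontr)
      assume ne: "\<mu> div S \<noteq> \<mu>' div S"
      have "(real (\<mu> div S) - real (\<mu>' div S)) * y = real (\<mu>' mod S) - real (\<mu> mod S)"
        using eq by (simp add: t_def algebra_simps)
      then have "y = (real (\<mu>' mod S) - real (\<mu> mod S)) / (real (\<mu> div S) - real (\<mu>' div S))"
        using ne by (simp add: field_simps)
      then show False using y(2) by (auto simp: Rats_divide Rats_diff)
    qed
    moreover from this have "\<mu> mod S = \<mu>' mod S" using eq by (simp add: t_def)
    ultimately show "\<mu> = \<mu>'" by (metis div_mult_mod_eq)
  qed
  define F where "F l \<mu> = t \<mu> ^ (l mod I) * exp (real (l div I) * c * t \<mu>)" for l \<mu>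
  define \<Delta> where "\<Delta> = det (mat L L (\<lambda>(l, \<mu>). F l \<mu>))"
  have nz: "\<Delta> \<noteq> 0"
    using exp_interpolation_det_nonzero[OF _ c inj] pos by (simp add: \<Delta>_def F_def L_def)
  have LI: "l mod I < I" "l div I < m" if "l < L" for l
    using that pos by (auto simp: L_def less_mult_imp_div_less mult.commute)

  \<comment> \<open>The ratio e of the two radii makes the saving in the power series bound exactly
    exp(-L(L-1)/2).\<close>
  define R \<rho> where "R = S * r" and "\<rho> = exp 1 * R"
  have r: "r \<ge> 1" by (simp add: r_def)
  have R: "R \<ge> 1" using pos r mult_mono[of 1 "real S" 1 r] by (simp add: R_def)
  have \<rho>R: "R \<le> \<rho>" using R by (simp add: \<rho>_def)
  then have \<rho>: "\<rho> \<ge> 1" using R by simp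
  have tR: "\<bar>t \<mu>\<bar> \<le> R" if "\<mu> < L" for \<mu>
  proof -
    have "\<bar>t \<mu>\<bar> \<le> real (\<mu> mod S) + real (\<mu> div S) * \<bar>y\<bar>"
      unfolding t_def by (rule order_trans[OF abs_triangle_ineq]) (simp add: abs_mult)
    also have "\<dots> \<le> S + S * \<bar>y\<bar>" using SL[OF that] by (intro add_mono mult_right_mono) auto
    finally show ?thesis by (simp add: R_def r_def algebra_simps)
  qed
  define E where "E = \<rho> ^ I * exp (m * \<bar>c\<bar> * \<rho>)"
  have upper: "\<bar>\<Delta>\<bar> \<le> fact L * (R / \<rho>) ^ (\<Sum>i<L. i) * E ^ L"
  proof -
    have "\<bar>\<Delta>\<bar> \<le> fact L * (R / \<rho>) ^ (\<Sum>i<L. i) * (\<Prod>l = 0..<L. \<rho> ^ (l mod I) * exp (\<bar>real (l div I) * c\<bar> * \<rho>))"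
      unfolding \<Delta>_def
    proof (rule det_power_series_le[where t = t])
      fix l \<mu>
      show "(\<lambda>n. (if n < l mod I then 0 else (real (l div I) * c) ^ (n - l mod I) / fact (n - l mod I)) * t \<mu> ^ n) sums F l \<mu>"
        unfolding F_def by (rule power_times_exp_sums)
      show "(\<lambda>n. \<bar>if n < l mod I then 0 else (real (l div I) * c) ^ (n - l mod I) / fact (n - l mod I)\<bar> * \<rho> ^ n)
          sums (\<rho> ^ (l mod I) * exp (\<bar>real (l div I) * c\<bar> * \<rho>))"
        using power_times_exp_sums[of "l mod I" "\<bar>real (l div I) * c\<bar>" \<rho>]
        by (simp add: if_distrib[of abs] power_abs cong: if_cong)
    qed (use R \<rho>R tR in auto)
    also have "(\<Prod>l = 0..<L. \<rho> ^ (l mod I) * exp (\<bar>real (l div I) * c\<bar> * \<rho>)) \<le> (\<Prod>l = 0..<L. E)"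
    proof (intro prod_mono conjI)
      fix l assume "l \<in> {0..<L}"
      then have l: "l mod I < I" "l div I < m" using LI by auto
      show "\<rho> ^ (l mod I) * exp (\<bar>real (l div I) * c\<bar> * \<rho>) \<le> E"
        unfolding E_def using \<rho> l
        by (intro mult_mono power_increasing) (auto simp: abs_mult intro!: mult_right_mono)
      show "0 \<le> \<rho> ^ (l mod I) * exp (\<bar>real (l div I) * c\<bar> * \<rho>)" using \<rho> by simp
    qed
    finally show ?thesis using R \<rho> by (auto simp: mult_left_mono)
  qed

  \<comment> \<open>At the point s + s' y the exponential of index j is x^(s j) z^(s' j), of total
    exponent at most 2 m S, and the polynomial factor has degree below I. Padding with powers of
    \<delta> brings all entries to the common exponent N, so that \<delta>^(N L) clears the
    determinant.\<close>
  define N where "N = I + 2 * m * S"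
  define H where "H = (2 * S * h) ^ I * h ^ (2 * m * S)"
  have actF: "int_acts V (of_nat \<delta> ^ N * F l \<mu>) H" if l: "l < L" and \<mu>: "\<mu> < L" for l \<mu>
  proof -
    define i j s s' where "i = l mod I" and "j = l div I" and "s = \<mu> mod S" and "s' = \<mu> div S"
    have i: "i < I" and j: "j < m" using LI[OF l] by (auto simp: i_def j_def)
    have s: "s < S" "s' < S" using SL[OF \<mu>] by (auto simp: s_def s'_def)
    have jS: "s * j + s' * j \<le> 2 * m * S"
      using add_mono[OF mult_mono[of s S j m] mult_mono[of s' S j m]] s j by (simp add: mult_2 algebra_simps)
    have "int_acts V (of_int (int s) * of_nat \<delta> + of_int (int s') * (of_nat \<delta> * y)) (nat \<bar>int s\<bar> * h + nat \<bar>int s'\<bar> * h)"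
      by (intro int_acts_add int_acts_mult int_acts_of_int V acts)
    then have "int_acts V (of_nat \<delta> * t \<mu>) (s * h + s' * h)"
      by (simp add: t_def s_def s'_def algebra_simps)
    moreover have "s * h + s' * h \<le> 2 * S * h"
      using add_mono[OF mult_right_mono[of s S h] mult_right_mono[of s' S h]] s by (simp add: mult_2 algebra_simps)
    ultimately have T: "int_acts V (of_nat \<delta> * t \<mu>) (2 * S * h)" by (rule int_acts_mono)
    have "int_acts V (of_nat \<delta> ^ (I - i) * (of_nat \<delta> * t \<mu>) ^ i *
        (of_nat \<delta> ^ (2 * m * S - (s * j + s' * j)) * (of_nat \<delta> * x) ^ (s * j) * (of_nat \<delta> * z) ^ (s' * j)))
        (h ^ (I - i) * (2 * S * h) ^ i * (h ^ (2 * m * S - (s * j + s' * j)) * h ^ (s * j) * h ^ (s' * j)))"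
      by (intro int_acts_mult int_acts_power V acts T)
    moreover have "of_nat \<delta> ^ (I - i) * (of_nat \<delta> * t \<mu>) ^ i *
        (of_nat \<delta> ^ (2 * m * S - (s * j + s' * j)) * (of_nat \<delta> * x) ^ (s * j) * (of_nat \<delta> * z) ^ (s' * j))
        = of_nat \<delta> ^ N * F l \<mu>"
    proof -
      have 1: "of_nat \<delta> ^ (I - i) * (of_nat \<delta> * t \<mu>) ^ i = of_nat \<delta> ^ I * t \<mu> ^ i"
        using i by (simp add: power_mult_distrib mult.assoc[symmetric] power_add[symmetric])
      have "of_nat \<delta> ^ (2 * m * S - (s * j + s' * j)) * (of_nat \<delta> * x) ^ (s * j) * (of_nat \<delta> * z) ^ (s' * j)
          = of_nat \<delta> ^ (2 * m * S - (s * j + s' * j)) * of_nat \<delta> ^ (s * j + s' * j) * (x ^ (s * j) * z ^ (s' * j))"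
        by (simp add: power_mult_distrib power_add mult_ac)
      also have "\<dots> = of_nat \<delta> ^ (2 * m * S) * (x ^ (s * j) * z ^ (s' * j))"
        using jS by (simp add: power_add[symmetric])
      also have "x ^ (s * j) * z ^ (s' * j) = exp (real j * c * t \<mu>)"
      proof -
        have "x ^ (s * j) = exp (real (s * j) * c)" using x unfolding c_def exp_of_nat_mult by simp
        moreover have "z ^ (s' * j) = exp (real (s' * j) * (c * y))" unfolding z exp_of_nat_mult by simp
        ultimately show ?thesis
          by (simp add: t_def s_def s'_def exp_add[symmetric] algebra_simps)
      qed
      finally show ?thesis
        unfolding 1 by (simp add: F_def N_def power_add i_def j_def mult_ac)
    qed
    moreover have "h ^ (I - i) * (2 * S * h) ^ i * (h ^ (2 * m * S - (s * j + s' * j)) * h ^ (s * j) * h ^ (s' * j)) \<le> H"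
    proof -
      have "h ^ (I - i) * (2 * S * h) ^ i \<le> (2 * S * h) ^ (I - i) * (2 * S * h) ^ i"
        using pos by (intro mult_right_mono power_mono) auto
      also have "\<dots> = (2 * S * h) ^ I" using i by (simp add: power_add[symmetric])
      finally have 1: "h ^ (I - i) * (2 * S * h) ^ i \<le> (2 * S * h) ^ I" .
      have "h ^ (2 * m * S - (s * j + s' * j)) * h ^ (s * j) * h ^ (s' * j) = h ^ (2 * m * S)"
        using jS by (simp add: power_add[symmetric])
      then show ?thesis unfolding H_def using mult_le_mono1[OF 1, of "h ^ (2 * m * S)"] by (simp only:)
    qed
    ultimately show ?thesis by (auto intro: int_acts_mono)
  qed
  have actD: "int_acts V (of_nat \<delta> ^ (N * L) * \<Delta>) (fact L * H ^ L)"
  proof -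
    have "int_acts V (\<Sum>p | p permutes {0..<L}. signof p * (\<Prod>i = 0..<L. of_nat \<delta> ^ N * F i (p i)))
       (\<Sum>p | p permutes {0..<L}. \<Prod>i = 0..<L. H)"
    proof (intro int_acts_sum V)
      fix p assume "p \<in> {p. p permutes {0..<L}}"
      then have "int_acts V (\<Prod>i = 0..<L. of_nat \<delta> ^ N * F i (p i)) (\<Prod>i = 0..<L. H)"
        by (intro int_acts_prod actF V) (auto simp: permutes_in_image[of _ "{0..<L}", simplified])
      from int_acts_mult[OF V(1) int_acts_of_int[OF V(1), of "-1"] this] this
      show "int_acts V (signof p * (\<Prod>i = 0..<L. of_nat \<delta> ^ N * F i (p i))) (\<Prod>i = 0..<L. H)"
        by (cases p rule: sign_cases) auto
    qed (simp add: finite_permutations)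
    moreover have "(\<Sum>p | p permutes {0..<L}. signof p * (\<Prod>i = 0..<L. of_nat \<delta> ^ N * F i (p i))) = of_nat \<delta> ^ (N * L) * \<Delta>"
      unfolding \<Delta>_def
      by (subst det_def'[of _ L]) (auto simp: prod.distrib power_mult[symmetric] mult.commute[of N L] sum_distrib_left mult_ac
          permutes_in_image[of _ "{0..<L}", simplified] intro!: sum.cong prod.cong)
    moreover have "card {p. p permutes {0..<L}} = fact L"
      using card_permutations[of "{0..<L}" L] by simp
    ultimately show ?thesis by simp
  qed
  have H1: "H \<ge> 1" using pos h by (auto simp: H_def Suc_le_eq)
  \<comment> \<open>The arithmetic lower bound for the nonzero integral multiple of \<Delta> is
    combined with the analytic upper bound; what remains is a comparison of logarithms.\<close>
  have ineq: "1 \<le> real h ^ (N * L) * (fact L * (R / \<rho>) ^ (\<Sum>i<L. i) * E ^ L) * (fact n * (2 * (fact L * real H ^ L)) ^ n)"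
  proof -
    have "1 \<le> \<bar>of_nat \<delta> ^ (N * L) * \<Delta>\<bar> * (fact n * (real (fact L * H ^ L) + 1) ^ n)"
      unfolding n_def using nz V(3) by (intro int_acts_lower_bound[OF V(1,2) _ actD]) auto
    also have "\<dots> \<le> (real h ^ (N * L) * (fact L * (R / \<rho>) ^ (\<Sum>i<L. i) * E ^ L)) * (fact n * (2 * (fact L * real H ^ L)) ^ n)"
    proof (intro mult_mono power_mono)
      show "\<bar>of_nat \<delta> ^ (N * L) * \<Delta>\<bar> \<le> real h ^ (N * L) * (fact L * (R / \<rho>) ^ (\<Sum>i<L. i) * E ^ L)"
        unfolding abs_mult using upper h_def
        by (intro mult_mono) (auto simp: power_abs intro!: power_mono)
      have "1 \<le> fact L * H ^ L" using H1 by (simp add: Suc_le_eq)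
      then have "1 \<le> real (fact L * H ^ L)" by linarith
      then show "real (fact L * H ^ L) + 1 \<le> 2 * (fact L * real H ^ L)" by simp
    qed (use R \<rho> in \<open>auto simp: E_def\<close>)
    finally show ?thesis .
  qed
  have T: "real (\<Sum>i<L. i) = real L * (real L - 1) / 2"
    by (induction L) (auto simp: field_simps)
  have lnf: "ln (fact L) \<le> real L * ln L"
  proof -
    have "ln (fact L :: real) \<le> ln (real L ^ L)"
      using fact_le_power[of L, where ?'a = real] pos by (subst ln_le_cancel_iff) auto
    then show ?thesis using pos by (simp add: ln_realpow)
  qed
  have lnE: "ln E = I * ln \<rho> + m * \<bar>c\<bar> * \<rho>" using \<rho> by (simp add: E_def ln_mult ln_realpow)
  have lnH: "ln H = I * ln (2 * S * h) + 2 * m * S * ln h"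
    using pos h by (simp add: H_def ln_mult ln_realpow)
  have lnR: "ln (R / \<rho>) = -1" using R by (simp add: \<rho>_def ln_div ln_mult)
  have Epos: "E > 0" using \<rho> by (simp add: E_def)
  have "0 \<le> ln (real h ^ (N * L) * (fact L * (R / \<rho>) ^ (\<Sum>i<L. i) * E ^ L) * (fact n * (2 * (fact L * real H ^ L)) ^ n))"
    using ineq by (simp add: ln_ge_zero)
  also have "\<dots> = real (N * L) * ln h + (ln (fact L) - real (\<Sum>i<L. i) + L * ln E) + (ln (fact n) + n * (ln 2 + (ln (fact L) + L * ln H)))"
    using h H1 Epos R \<rho> by (simp add: ln_mult ln_realpow lnR distrib_left)
  also have "\<dots> \<le> real (N * L) * ln h + (real L * ln L - real L * (real L - 1) / 2 + L * ln E) + (ln (fact n) + n * (ln 2 + (real L * ln L + L * ln H)))"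
    unfolding T using lnf by (intro add_mono mult_left_mono order_refl diff_mono) auto
  also have "\<dots> \<le> L * (N * ln h + ln L - (real L - 1) / 2 + ln E + q + n * (ln L + ln H))"
  proof -
    have q0: "q \<ge> 0" by (auto simp: q_def)
    then have "q \<le> L * q" using pos mult_right_mono[of 1 "real L" q] by simp
    then show ?thesis by (simp add: q_def algebra_simps diff_divide_distrib add_divide_distrib)
  qed
  finally have "0 \<le> real L * (N * ln h + ln L - (real L - 1) / 2 + ln E + q + n * (ln L + ln H))" .
  then have "0 \<le> N * ln h + ln L - (real L - 1) / 2 + ln E + q + n * (ln L + ln H)"
    using pos by (simp add: zero_le_mult_iff)
  also have "\<dots> = (real K)\<^sup>2 * real m * ln h + ln ((real K)\<^sup>2 * (real m)\<^sup>2) + 1 / 2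
      + (real K)\<^sup>2 * real m * ln ((exp 1 * real K * r) * real m) + q
      + real n * (ln ((real K)\<^sup>2 * (real m)\<^sup>2) + (real K)\<^sup>2 * real m * ln (2 * real K * real h * real m)) - \<kappa> * (real m)\<^sup>2"
  proof -
    have e1: "real L = (real K)\<^sup>2 * (real m)\<^sup>2" by (simp add: L_def I_def power2_eq_square)
    have e2: "\<rho> = exp 1 * real K * r * real m" by (simp add: \<rho>_def R_def S_def mult_ac)
    have e3: "2 * real S * real h = 2 * real K * real h * real m" by (simp add: S_def mult_ac)
    have e4: "real I = (real K)\<^sup>2 * real m" by (simp add: I_def)
    have e5: "real N = (real K)\<^sup>2 * real m + 2 * K * (real m)\<^sup>2" by (simp add: N_def I_def S_def power2_eq_square)
    have e6: "2 * real m * real S = 2 * K * (real m)\<^sup>2" by (simp add: S_def power2_eq_square)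
    have e7: "real m * \<bar>c\<bar> * \<rho> = K * (\<bar>c\<bar> * exp 1 * r) * (real m)\<^sup>2" by (simp add: e2 power2_eq_square)
    have e8: "\<kappa> * (real m)\<^sup>2 = (real K)\<^sup>2 * (real m)\<^sup>2 / 2 - K * (2 * ln h + \<bar>c\<bar> * exp 1 * r + 2 * n * ln h) * (real m)\<^sup>2"
      by (simp add: \<kappa>_def B_def algebra_simps)
    have lnH': "ln H = (real K)\<^sup>2 * real m * ln (2 * real K * real h * real m) + 2 * K * (real m)\<^sup>2 * ln h"
      using lnH e3 e4 e6 by simp
    have lnE': "ln E = (real K)\<^sup>2 * real m * ln (exp 1 * real K * r * real m) + K * (\<bar>c\<bar> * exp 1 * r) * (real m)\<^sup>2"
      using lnE e2 e4 e7 by simp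
    show ?thesis
      unfolding e1 e5 e8 lnH' lnE' by (simp add: field_simps)
  qed
  also have "\<dots> < 0" using m(2) by simp
  finally show False by simp
qed

text \<open>Multiplying the power with its complex conjugate removes the choice of the logarithm.\<close>

corollary gelfond_schneider_real_base:
  fixes x y :: real and l :: complex
  assumes l: "exp l = of_real x" and x: "\<bar>x\<bar> \<noteq> 1" "algebraic x" and y: "algebraic y" "y \<notin> \<rat>"
  shows "\<not> algebraic (exp (of_real y * l))"
proof
  define A where "A = exp (of_real y * l)"
  assume "algebraic (exp (of_real y * l))"
  then have "algebraic A" by (simp add: A_def)
  have "exp (Re l) = \<bar>x\<bar>" using arg_cong[OF l, of norm] by simp
  then have x0: "\<bar>x\<bar> > 0" and Re: "Re l = ln \<bar>x\<bar>" by (metis exp_gt_zero, metis ln_exp)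
  have "norm A = exp (y * ln \<bar>x\<bar>)" by (simp add: A_def Re)
  also have "\<dots> = \<bar>x\<bar> powr y" using x0 by (simp add: powr_def)
  finally have nA: "norm A = \<bar>x\<bar> powr y" .
  have "algebraic (A * cnj A)" using \<open>algebraic A\<close> by (intro algebraic_mult algebraic_cnj)
  moreover have "A * cnj A = complex_of_real ((\<bar>x\<bar> powr y)\<^sup>2)"
    using complex_norm_square[of A] by (simp add: nA)
  ultimately have "algebraic ((\<bar>x\<bar> powr y)\<^sup>2)" by (metis algebraic_of_real_iff)
  then have "algebraic (sqrt ((\<bar>x\<bar> powr y)\<^sup>2))" by (rule algebraic_sqrt)
  then have "algebraic (\<bar>x\<bar> powr y)" by simp
  moreover have "\<not> algebraic (\<bar>x\<bar> powr y)"
    using x0 x y by (intro gelfond_schneider_real) auto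
  ultimately show False by simp
qed

subsection \<open>The quadratic field\<close>

locale real_quadratic =
  fixes D :: int
  assumes D_pos: "D > 0" and D_nonsquare: "\<not> (\<exists>k::int. D = k\<^sup>2)"
begin

abbreviation "K \<equiv> quad_field D"
abbreviation "\<sigma> \<equiv> qconj D"
abbreviation "Tr \<equiv> qtr D"
abbreviation "rD \<equiv> sqrt (of_int D)"

lemma sqrt_D_irrational: "rD \<notin> \<rat>"
proof
  assume "rD \<in> \<rat>"
  moreover have "algebraic_int rD" by (intro algebraic_int_sqrt int_imp_algebraic_int) auto
  ultimately have "rD \<in> \<int>" by (rule rational_algebraic_int_is_int[rotated])
  then obtain k where "rD = of_int k" by (auto elim: Ints_cases)
  moreover have "rD\<^sup>2 = of_int D" using D_pos by simp
  ultimately have "real_of_int (k\<^sup>2) = of_int D" by simp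
  then have "D = k\<^sup>2" by (simp only: of_int_eq_iff)
  then have "\<exists>k::int. D = k\<^sup>2" by (rule exI)
  then show False using D_nonsquare by contradiction
qed

lemma sqrt_D_sq: "rD * rD = of_int D" using D_pos by simp

lemma rat_coords_unique:
  assumes "p + q * rD = p' + q' * rD" "p \<in> \<rat>" "q \<in> \<rat>" "p' \<in> \<rat>" "q' \<in> \<rat>"
  shows "p = p'" "q = q'"
proof -
  show "q = q'"
  proof (rule ccontr)
    assume "q \<noteq> q'"
    then have "rD = (p' - p) / (q - q')" using assms(1) by (simp add: field_simps)
    then show False using sqrt_D_irrational assms by (auto simp: Rats_divide Rats_diff)
  qed
  then show "p = p'" using assms(1) by simp
qed

lemma in_K_iff: "x \<in> K \<longleftrightarrow> (\<exists>p\<in>\<rat>. \<exists>q\<in>\<rat>. x = p + q * rD)"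
  unfolding quad_field_def Rats_def by auto

lemma K_I: "p \<in> \<rat> \<Longrightarrow> q \<in> \<rat> \<Longrightarrow> p + q * rD \<in> K"
  by (auto simp: in_K_iff)

text \<open>Uniqueness of the coordinates gives the definite description in \<open>qconj\<close> its
  meaning; all rules for \<open>\<sigma>\<close> rest on this formula.\<close>

lemma qconj_eq: "p \<in> \<rat> \<Longrightarrow> q \<in> \<rat> \<Longrightarrow> \<sigma> (p + q * rD) = p - q * rD"
  unfolding qconj_def
proof (rule the_equality)
  assume pq: "p \<in> \<rat>" "q \<in> \<rat>"
  then show "\<exists>pa qa. p + q * rD = of_rat pa + of_rat qa * rD \<and> p - q * rD = of_rat pa - of_rat qa * rD"
    by (auto elim!: Rats_cases)
  fix y assume "\<exists>pa qa. p + q * rD = of_rat pa + of_rat qa * rD \<and> y = of_rat pa - of_rat qa * rD"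
  then obtain pa qa where a: "p + q * rD = of_rat pa + of_rat qa * rD" "y = of_rat pa - of_rat qa * rD" by auto
  show "y = p - q * rD" using rat_coords_unique[OF a(1)] pq a(2) by simp
qed

lemma K_E:
  assumes "x \<in> K"
  obtains p q where "p \<in> \<rat>" "q \<in> \<rat>" "x = p + q * rD" "\<sigma> x = p - q * rD"
proof -
  obtain p q where "p \<in> \<rat>" "q \<in> \<rat>" "x = p + q * rD" using assms unfolding in_K_iff by blast
  then show ?thesis using qconj_eq[of p q] that by blast
qed

lemma Rats_K: "x \<in> \<rat> \<Longrightarrow> x \<in> K" using K_I[of x 0] by simp
lemma qconj_Rats: "x \<in> \<rat> \<Longrightarrow> \<sigma> x = x" using qconj_eq[of x 0] by simp

lemma K_of_int [simp, intro]: "of_int n \<in> K" by (rule Rats_K) simp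
lemma K_of_nat [simp, intro]: "of_nat n \<in> K" by (rule Rats_K) simp
lemma K_numeral [simp, intro]: "numeral n \<in> K" by (rule Rats_K) simp
lemma K_0 [simp, intro]: "0 \<in> K" by (rule Rats_K) simp
lemma K_1 [simp, intro]: "1 \<in> K" by (rule Rats_K) simp

lemma qconj_of_int [simp]: "\<sigma> (of_int n) = of_int n" by (rule qconj_Rats) simp
lemma qconj_numeral [simp]: "\<sigma> (numeral n) = numeral n" by (rule qconj_Rats) simp
lemma qconj_0 [simp]: "\<sigma> 0 = 0" by (rule qconj_Rats) simp
lemma qconj_1 [simp]: "\<sigma> 1 = 1" by (rule qconj_Rats) simp

lemma
  assumes "x \<in> K" "y \<in> K"
  shows K_add [simp, intro]: "x + y \<in> K" and qconj_add [simp]: "\<sigma> (x + y) = \<sigma> x + \<sigma> y"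
proof -
  obtain p q where x: "p \<in> \<rat>" "q \<in> \<rat>" "x = p + q * rD" "\<sigma> x = p - q * rD" by (rule K_E[OF assms(1)])
  obtain r s where y: "r \<in> \<rat>" "s \<in> \<rat>" "y = r + s * rD" "\<sigma> y = r - s * rD" by (rule K_E[OF assms(2)])
  have xy: "x + y = (p + r) + (q + s) * rD" by (simp add: x y algebra_simps)
  show "x + y \<in> K" unfolding xy using x y by (intro K_I) auto
  have "\<sigma> (x + y) = (p + r) - (q + s) * rD" unfolding xy using x y by (intro qconj_eq) auto
  then show "\<sigma> (x + y) = \<sigma> x + \<sigma> y" by (simp add: x(4) y(4) algebra_simps)
qed

lemma
  assumes "x \<in> K" "y \<in> K"
  shows K_mult [simp, intro]: "x * y \<in> K" and qconj_mult [simp]: "\<sigma> (x * y) = \<sigma> x * \<sigma> y"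
proof -
  obtain p q where x: "p \<in> \<rat>" "q \<in> \<rat>" "x = p + q * rD" "\<sigma> x = p - q * rD" by (rule K_E[OF assms(1)])
  obtain r s where y: "r \<in> \<rat>" "s \<in> \<rat>" "y = r + s * rD" "\<sigma> y = r - s * rD" by (rule K_E[OF assms(2)])
  have xy: "x * y = (p * r + q * s * of_int D) + (p * s + q * r) * rD"
    using D_pos by (simp add: x(3) y(3) algebra_simps sqrt_D_sq flip: power2_eq_square)
  show "x * y \<in> K" unfolding xy using x y by (intro K_I) auto
  have "\<sigma> (x * y) = (p * r + q * s * of_int D) - (p * s + q * r) * rD"
    unfolding xy using x y by (intro qconj_eq) auto
  then show "\<sigma> (x * y) = \<sigma> x * \<sigma> y" using D_pos by (simp add: x(4) y(4) algebra_simps sqrt_D_sq flip: power2_eq_square)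
qed

lemma K_uminus [simp, intro]: "x \<in> K \<Longrightarrow> - x \<in> K"
  using K_mult[of "-1" x] K_of_int[of "-1"] by simp
lemma qconj_uminus [simp]: "x \<in> K \<Longrightarrow> \<sigma> (- x) = - \<sigma> x"
  using qconj_mult[of "-1" x] K_of_int[of "-1"] qconj_of_int[of "-1"] by simp
lemma K_diff [simp, intro]: "x \<in> K \<Longrightarrow> y \<in> K \<Longrightarrow> x - y \<in> K"
  using K_add[of x "-y"] by simp
lemma qconj_diff [simp]: "x \<in> K \<Longrightarrow> y \<in> K \<Longrightarrow> \<sigma> (x - y) = \<sigma> x - \<sigma> y"
  using qconj_add[of x "-y"] by simp
lemma K_power [simp, intro]: "x \<in> K \<Longrightarrow> x ^ n \<in> K" by (induction n) auto
lemma qconj_power [simp]: "x \<in> K \<Longrightarrow> \<sigma> (x ^ n) = \<sigma> x ^ n" by (induction n) auto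

lemma K_qconj [simp, intro]: "x \<in> K \<Longrightarrow> \<sigma> x \<in> K"
proof (erule K_E)
  fix p q assume "p \<in> \<rat>" "q \<in> \<rat>" "\<sigma> x = p - q * rD"
  then show "\<sigma> x \<in> K" using K_I[of p "- q"] by simp
qed

lemma qconj_qconj [simp]: "x \<in> K \<Longrightarrow> \<sigma> (\<sigma> x) = x"
proof (erule K_E)
  fix p q assume "p \<in> \<rat>" "q \<in> \<rat>" "x = p + q * rD" "\<sigma> x = p - q * rD"
  then show "\<sigma> (\<sigma> x) = x" using qconj_eq[of p "- q"] by simp
qed

lemma qconj_eq_0_iff [simp]: "x \<in> K \<Longrightarrow> \<sigma> x = 0 \<longleftrightarrow> x = 0"
  by (metis qconj_0 qconj_qconj)

lemma qconj_eq_self_iff: "x \<in> K \<Longrightarrow> \<sigma> x = x \<longleftrightarrow> x \<in> \<rat>"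
  by (erule K_E) (auto simp: qconj_Rats)

lemma qnorm_Rats: "x \<in> K \<Longrightarrow> x * \<sigma> x \<in> \<rat>"
  by (subst qconj_eq_self_iff[symmetric]) (auto simp: mult.commute)

lemma K_inverse [simp, intro]:
  assumes "x \<in> K"
  shows "inverse x \<in> K"
proof (cases "x = 0")
  case False
  then have "inverse x = \<sigma> x * inverse (x * \<sigma> x)" using assms by (simp add: field_simps)
  moreover have "inverse (x * \<sigma> x) \<in> K" by (intro Rats_K Rats_inverse qnorm_Rats assms)
  ultimately show ?thesis using K_mult[OF K_qconj[OF assms]] by metis
qed simp

lemma qconj_inverse [simp]:
  assumes "x \<in> K"
  shows "\<sigma> (inverse x) = inverse (\<sigma> x)"
proof (cases "x = 0")
  case False
  then have "\<sigma> x * \<sigma> (inverse x) = 1" using qconj_mult[of x "inverse x"] assms by simp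
  then show ?thesis by (metis inverse_unique)
qed simp

lemma K_divide [simp, intro]: "x \<in> K \<Longrightarrow> y \<in> K \<Longrightarrow> x / y \<in> K"
  by (simp add: divide_inverse)
lemma qconj_divide [simp]: "x \<in> K \<Longrightarrow> y \<in> K \<Longrightarrow> \<sigma> (x / y) = \<sigma> x / \<sigma> y"
  by (simp add: divide_inverse)

lemma K_algebraic: "x \<in> K \<Longrightarrow> algebraic x"
proof (erule K_E)
  fix p q assume "p \<in> \<rat>" "q \<in> \<rat>" "x = p + q * rD"
  then show "algebraic x"
    using D_pos by (intro algebraicI'[of "[:p\<^sup>2 - q\<^sup>2 * of_int D, - 2 * p, 1:]"])
      (auto simp: coeff_pCons power2_eq_square algebra_simps sqrt_D_sq split: nat.splits)
qed

end

subsection \<open>Exponential sums with a growing parameter\<close>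

text \<open>Outside \<open>J\<close> the weights are at least N, so passing from \<tau>0 to \<tau>
  gains exp(-(\<tau> - \<tau>0) N) in every term. Uniformity in \<open>w\<close> is essential,
  because on the branch \<open>w\<close> varies with q.\<close>

lemma exp_sum_tail_le:
  fixes c d :: "'k \<Rightarrow> complex" and e :: "'k \<Rightarrow> real"
  assumes e: "\<And>k. e k \<ge> 0"
    and sum: "(\<lambda>k. norm (c k) * exp (- \<tau>0 * e k + norm (d k) * W)) summable_on UNIV"
    and J: "finite J" "\<And>k. k \<notin> J \<Longrightarrow> e k \<ge> N"
    and \<tau>: "\<tau> \<ge> \<tau>0" and w: "norm w \<le> W"
  shows "norm ((\<Sum>\<^sub>\<infinity>k. c k * exp (- of_real (\<tau> * e k) + d k * w)) - (\<Sum>k\<in>J. c k * exp (- of_real (\<tau> * e k) + d k * w)))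
    \<le> exp (- (\<tau> - \<tau>0) * N) * (\<Sum>\<^sub>\<infinity>k. norm (c k) * exp (- \<tau>0 * e k + norm (d k) * W))"
proof -
  define f where "f k = c k * exp (- of_real (\<tau> * e k) + d k * w)" for k
  define g where "g k = norm (c k) * exp (- \<tau>0 * e k + norm (d k) * W)" for k
  have fg: "norm (f k) \<le> exp (- (\<tau> - \<tau>0) * e k) * g k" for k
  proof -
    have "Re (d k * w) \<le> norm (d k) * W"
      using complex_Re_le_cmod[of "d k * w"] mult_left_mono[OF w, of "norm (d k)"] by (simp add: norm_mult)
    then have "- \<tau> * e k + Re (d k * w) \<le> - (\<tau> - \<tau>0) * e k + (- \<tau>0 * e k + norm (d k) * W)"
      by (simp add: algebra_simps)
    then have "exp (- \<tau> * e k + Re (d k * w)) \<le> exp (- (\<tau> - \<tau>0) * e k) * exp (- \<tau>0 * e k + norm (d k) * W)"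
      by (simp only: exp_add[symmetric] exp_le_cancel_iff)
    from mult_left_mono[OF this, of "norm (c k)"] show ?thesis
      by (simp add: f_def g_def norm_mult mult_ac)
  qed
  have g0: "g k \<ge> 0" for k by (simp add: g_def)
  have gs: "g summable_on A" for A
    using sum summable_on_subset_banach[of g UNIV A] by (simp add: g_def[abs_def])
  have fs: "(\<lambda>k. norm (f k)) summable_on A" for A
  proof (rule summable_on_comparison_test[OF gs])
    fix k
    have "exp (- (\<tau> - \<tau>0) * e k) * g k \<le> 1 * g k"
      using mult_nonneg_nonneg[of "\<tau> - \<tau>0" "e k"] \<tau> e[of k] g0[of k]
      by (intro mult_right_mono) (auto simp: algebra_simps)
    then show "norm (f k) \<le> g k" using fg[of k] by simp
  qed auto
  have "infsum f UNIV = infsum f (- J) + infsum f J"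
    using infsum_Un_disjoint[of f "- J" J] abs_summable_summable[OF fs] by (simp add: Compl_partition2)
  then have "norm (infsum f UNIV - sum f J) = norm (infsum f (- J))" using J by simp
  also have "\<dots> \<le> infsum (\<lambda>k. norm (f k)) (- J)" by (rule norm_infsum_bound[OF fs])
  also have "\<dots> \<le> infsum (\<lambda>k. exp (- (\<tau> - \<tau>0) * N) * g k) (- J)"
  proof (rule infsum_mono[OF fs summable_on_cmult_right[OF gs]])
    fix k assume "k \<in> - J"
    then have "(\<tau> - \<tau>0) * N \<le> (\<tau> - \<tau>0) * e k" using J \<tau> by (intro mult_left_mono) auto
    then have "exp (- (\<tau> - \<tau>0) * e k) * g k \<le> exp (- (\<tau> - \<tau>0) * N) * g k"
      by (intro mult_right_mono g0) (simp add: algebra_simps)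
    then show "norm (f k) \<le> exp (- (\<tau> - \<tau>0) * N) * g k" using fg[of k] by linarith
  qed
  also have "\<dots> = exp (- (\<tau> - \<tau>0) * N) * infsum g (- J)"
    by (rule infsum_cmult_right[OF gs])
  also have "\<dots> \<le> exp (- (\<tau> - \<tau>0) * N) * infsum g UNIV"
    by (intro mult_left_mono infsum_mono2 gs) (auto simp: g0)
  finally show ?thesis by (simp add: f_def[abs_def] g_def[abs_def])
qed

lemma summable_exp_minus_abs_int: "(\<lambda>k::int. exp (- real_of_int \<bar>k\<bar>)) summable_on UNIV"
proof -
  have geo: "(\<lambda>n. exp (- real n)) summable_on (UNIV::nat set)"
  proof (rule norm_summable_imp_summable_on)
    have "summable (\<lambda>n. exp (-1 :: real) ^ n)" by (rule summable_geometric) simp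
    then show "summable (\<lambda>n. norm (exp (- real n)))"
      by (simp add: exp_of_nat_mult[symmetric])
  qed
  have "(\<lambda>k::int. exp (- real_of_int \<bar>k\<bar>)) summable_on range int"
    using geo by (subst summable_on_reindex) (auto simp: o_def)
  moreover have "(\<lambda>k::int. exp (- real_of_int \<bar>k\<bar>)) summable_on range (\<lambda>n. - int n)"
    using geo by (subst summable_on_reindex) (auto simp: o_def inj_on_def)
  ultimately have "(\<lambda>k::int. exp (- real_of_int \<bar>k\<bar>)) summable_on (range int \<union> range (\<lambda>n. - int n))"
    by (rule summable_on_union)
  moreover have "range int \<union> range (\<lambda>n. - int n) = UNIV"
    by (auto simp: image_iff) (metis int_cases2)
  ultimately show ?thesis by simp
qed

lemma summable_exp_minus_abs_int2:
  "(\<lambda>(k, l). exp (- real_of_int \<bar>k\<bar>) * exp (- real_of_int \<bar>l\<bar>)) summable_on (UNIV :: (int \<times> int) set)"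
proof -
  let ?f = "\<lambda>k::int. exp (- real_of_int \<bar>k\<bar>)"
  have "(\<lambda>p. case p of (k, l) \<Rightarrow> ?f k * ?f l) summable_on Sigma UNIV (\<lambda>_. UNIV)"
  proof (rule summable_on_SigmaI[where g = "\<lambda>k. ?f k * infsum ?f UNIV"])
    show "((\<lambda>l. case (k, l) of (k, l) \<Rightarrow> ?f k * ?f l) has_sum ?f k * infsum ?f UNIV) UNIV" for k
      using has_sum_cmult_right[OF has_sum_infsum[OF summable_exp_minus_abs_int]] by simp
    show "(\<lambda>k. ?f k * infsum ?f UNIV) summable_on UNIV"
      by (rule summable_on_cmult_left[OF summable_exp_minus_abs_int])
  qed simp
  then show ?thesis by simp
qed

text \<open>Divided by q^d, where d is the order of the series, the function tends to a nonzero
  coefficient; decay of higher order along a single sequence already contradicts this.\<close>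

lemma fps_nth_eq_0_of_decay:
  fixes f :: "complex \<Rightarrow> complex"
  assumes f: "f has_fps_expansion P" and q: "q \<longlonglongrightarrow> 0" "\<And>n. q n \<noteq> 0"
    and le: "\<forall>\<^sub>F n in sequentially. norm (f (q n)) \<le> B * norm (q n) ^ M" and i: "i < M"
  shows "fps_nth P i = 0"
proof (rule ccontr)
  assume nz: "fps_nth P i \<noteq> 0"
  define d where "d = subdegree P"
  have d: "d \<le> i" using nz by (auto simp: d_def intro: subdegree_leI)
  have Pd: "fps_nth P d \<noteq> 0" using nz by (auto simp: d_def)
  let ?h = "\<lambda>x. if x = 0 then fps_nth P d else f x / x ^ d"
  have "?h has_fps_expansion fps_shift d P"
    by (rule has_fps_expansion_shift[OF f]) (auto simp: d_def)
  then have "continuous (at 0) ?h" by (rule has_fps_expansion_imp_continuous)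
  then have "(\<lambda>n. ?h (q n)) \<longlonglongrightarrow> ?h 0"
    by (rule isCont_tendsto_compose[OF _ q(1)])
  then have 1: "(\<lambda>n. f (q n) / q n ^ d) \<longlonglongrightarrow> fps_nth P d" using q(2) by simp
  have "(\<lambda>n. B * norm (q n) ^ (M - d)) \<longlonglongrightarrow> B * norm (0::complex) ^ (M - d)"
    by (intro tendsto_intros q)
  then have "(\<lambda>n. B * norm (q n) ^ (M - d)) \<longlonglongrightarrow> 0" using d i by (simp add: power_0_left)
  moreover have "\<forall>\<^sub>F n in sequentially. norm (f (q n) / q n ^ d) \<le> B * norm (q n) ^ (M - d)"
    using le
  proof eventually_elim
    case (elim n)
    have "norm (q n) ^ M = norm (q n) ^ (M - d) * norm (q n) ^ d"
      using d i by (simp add: power_add[symmetric])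
    then show ?case using elim q(2)[of n] by (simp add: norm_divide norm_power divide_simps mult_ac)
  qed
  ultimately have "(\<lambda>n. f (q n) / q n ^ d) \<longlonglongrightarrow> 0" by (rule Lim_null_comparison[rotated])
  then show False using LIMSEQ_unique[OF 1] Pd by auto
qed

subsection \<open>The theta series in a diagonal basis\<close>

text \<open>
  With respect to a basis diagonalizing the form, the exponent splits into the weights
  \<open>a1, a2\<close>; \<open>h1, h2\<close> are the conjugates of the basis vectors and
  \<open>p\<^sub>i, s\<^sub>i\<close> twice the characteristic.
\<close>

definition conj_coord :: "real \<Rightarrow> real \<Rightarrow> int \<Rightarrow> int \<Rightarrow> int \<times> int \<Rightarrow> real" where
  "conj_coord h1 h2 p1 p2 k = (of_int (fst k) + of_int p1 / 2) * h1 + (of_int (snd k) + of_int p2 / 2) * h2"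

text \<open>Half of a (k + p/2)^2 without the constant p^2/4. The minimum over the integers becomes
  0, and only a nonvanishing common factor is removed from the theta series.\<close>

definition diag_weight :: "real \<Rightarrow> real \<Rightarrow> int \<Rightarrow> int \<Rightarrow> int \<times> int \<Rightarrow> real" where
  "diag_weight a1 a2 p1 p2 k =
     (a1 * of_int ((fst k)\<^sup>2 + p1 * fst k) + a2 * of_int ((snd k)\<^sup>2 + p2 * snd k)) / 2"

abbreviation theta_term :: "real \<Rightarrow> real \<Rightarrow> real \<Rightarrow> real \<Rightarrow> int \<Rightarrow> int \<Rightarrow> int \<Rightarrow> int \<Rightarrow> real \<Rightarrow> complex \<Rightarrow> int \<times> int \<Rightarrow> complex" where
  "theta_term h1 h2 a1 a2 p1 p2 s1 s2 \<tau> w k \<equiv> (-1) powi (fst k * s1 + snd k * s2) * of_real (conj_coord h1 h2 p1 p2 k) *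
    exp (- of_real (\<tau> * diag_weight a1 a2 p1 p2 k) + of_real ((conj_coord h1 h2 p1 p2 k)\<^sup>2 / 2) * w)"

text \<open>Theta series on the imaginary axis, where q = exp(-\<tau>) is real. The variable
  \<open>w\<close> is 2 \<pi> i times the deviation of the second coordinate from its linear part,
  that is 2 \<pi> i C + \<epsilon>(q) on the branch.\<close>

definition diag_theta :: "real \<Rightarrow> real \<Rightarrow> real \<Rightarrow> real \<Rightarrow> int \<Rightarrow> int \<Rightarrow> int \<Rightarrow> int \<Rightarrow> real \<Rightarrow> complex \<Rightarrow> complex" where
  "diag_theta h1 h2 a1 a2 p1 p2 s1 s2 \<tau> w =
    (\<Sum>\<^sub>\<infinity>k. theta_term h1 h2 a1 a2 p1 p2 s1 s2 \<tau> w k)"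

lemma int_square_plus_ge:
  fixes k p :: int
  assumes "p \<in> {0, 1}"
  shows "k\<^sup>2 + p * k \<ge> 0" "k\<^sup>2 + p * k \<ge> \<bar>k\<bar> - 1"
proof -
  have "k * k \<ge> \<bar>k\<bar>" using mult_left_mono[of 1 "\<bar>k\<bar>" "\<bar>k\<bar>"] by (cases "k = 0") (auto simp flip: abs_mult)
  moreover have "(k + 1) * (k + 1) \<ge> 0" by simp
  ultimately show "k\<^sup>2 + p * k \<ge> 0" "k\<^sup>2 + p * k \<ge> \<bar>k\<bar> - 1"
    using assms by (auto simp: power2_eq_square algebra_simps abs_if split: if_splits)
qed

text \<open>Both the weight and the exponent attached to \<open>w\<close> are quadratic in k, so a
  large \<tau>0 lets the weight dominate; the terms are compared with a product of two geometric
  sequences.\<close>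

lemma diag_theta_summable:
  assumes a: "a1 > 0" "a2 > 0" and p: "p1 \<in> {0, 1}" "p2 \<in> {0, 1}" and W: "W \<ge> 0"
  shows "\<exists>\<tau>0>0. (\<lambda>k. \<bar>conj_coord h1 h2 p1 p2 k\<bar> *
     exp (- \<tau>0 * diag_weight a1 a2 p1 p2 k + (conj_coord h1 h2 p1 p2 k)\<^sup>2 / 2 * W)) summable_on UNIV"
proof -
  \<comment> \<open>The summand 1 in 1 + W makes room for the prefactor, which is absorbed by |x| <=
    exp(x^2).\<close>
  define M where "M = 2 * (h1\<^sup>2 + h2\<^sup>2) * (1 + W)"
  have M: "M \<ge> 0" using W by (simp add: M_def)
  \<comment> \<open>With e and f the integers k^2 + p k of both coordinates, \<tau> times the weight
    is at least (M + 1)(e + f): M compensates the growth and the remaining 1 gives the geometric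
    decay.\<close>
  define \<tau> where "\<tau> = 2 * (M + 1) / min a1 a2"
  have \<tau>: "\<tau> > 0" using a M by (simp add: \<tau>_def)
  have bound: "\<bar>conj_coord h1 h2 p1 p2 (k, l)\<bar> * exp (- \<tau> * diag_weight a1 a2 p1 p2 (k, l) + (conj_coord h1 h2 p1 p2 (k, l))\<^sup>2 / 2 * W)
      \<le> exp (M / 2 + 2) * (exp (- real_of_int \<bar>k\<bar>) * exp (- real_of_int \<bar>l\<bar>))" for k l
  proof -
    define x where "x = conj_coord h1 h2 p1 p2 (k, l)"
    define u v where "u = real_of_int k + of_int p1 / 2" and "v = real_of_int l + of_int p2 / 2"
    define e f where "e = real_of_int (k\<^sup>2 + p1 * k)" and "f = real_of_int (l\<^sup>2 + p2 * l)"
    have e: "e \<ge> 0" "e \<ge> \<bar>k\<bar> - 1" "f \<ge> 0" "f \<ge> \<bar>l\<bar> - 1"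
      using int_square_plus_ge[OF p(1), of k] int_square_plus_ge[OF p(2), of l] unfolding e_def f_def by linarith+
    have uv: "u\<^sup>2 \<le> e + 1/4" "v\<^sup>2 \<le> f + 1/4"
      using p by (auto simp: u_def v_def e_def f_def power2_eq_square algebra_simps)
    have x: "x = u * h1 + v * h2" by (simp add: x_def conj_coord_def u_def v_def)
    have "x\<^sup>2 \<le> 2 * (h1\<^sup>2 * u\<^sup>2 + h2\<^sup>2 * v\<^sup>2)"
      using sum_squares_bound[of "u * h1" "v * h2"] by (simp add: x power2_eq_square algebra_simps)
    also have "\<dots> \<le> 2 * ((h1\<^sup>2 + h2\<^sup>2) * u\<^sup>2 + (h1\<^sup>2 + h2\<^sup>2) * v\<^sup>2)"
      by (intro mult_left_mono add_mono mult_right_mono) auto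
    also have "\<dots> = 2 * (h1\<^sup>2 + h2\<^sup>2) * (u\<^sup>2 + v\<^sup>2)" by (simp add: algebra_simps)
    also have "\<dots> \<le> 2 * (h1\<^sup>2 + h2\<^sup>2) * (e + f + 1/2)"
      using uv by (intro mult_left_mono) auto
    finally have x2: "x\<^sup>2 * (1 + W) \<le> M * (e + f + 1/2)"
      using W mult_right_mono[of "x\<^sup>2" "2 * (h1\<^sup>2 + h2\<^sup>2) * (e + f + 1/2)" "1 + W"] by (simp add: M_def mult_ac)
    have "\<bar>x\<bar> \<le> exp (x\<^sup>2)"
    proof -
      have "\<bar>x\<bar> \<le> 1 + x\<^sup>2"
        using sum_squares_bound[of 1 "\<bar>x\<bar>"] by (simp add: power2_eq_square)
      then show ?thesis using exp_ge_add_one_self[of "x\<^sup>2"] by linarith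
    qed
    then have "\<bar>x\<bar> * exp (- \<tau> * diag_weight a1 a2 p1 p2 (k, l) + x\<^sup>2 / 2 * W)
        \<le> exp (x\<^sup>2) * exp (- \<tau> * diag_weight a1 a2 p1 p2 (k, l) + x\<^sup>2 / 2 * W)"
      by (rule mult_right_mono) simp
    also have "\<dots> = exp (x\<^sup>2 + (- \<tau> * diag_weight a1 a2 p1 p2 (k, l) + x\<^sup>2 / 2 * W))" by (simp add: exp_add)
    also have "\<dots> \<le> exp (M / 2 + 2 + (- real_of_int \<bar>k\<bar> + - real_of_int \<bar>l\<bar>))"
    proof -
      have "(M + 1) * (e + f) = \<tau> * (min a1 a2 * (e + f) / 2)" using a by (simp add: \<tau>_def)
      also have "\<dots> \<le> \<tau> * diag_weight a1 a2 p1 p2 (k, l)"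
      proof (intro mult_left_mono)
        have "min a1 a2 * e \<le> a1 * e" "min a1 a2 * f \<le> a2 * f" using e by (auto intro!: mult_right_mono)
        then show "min a1 a2 * (e + f) / 2 \<le> diag_weight a1 a2 p1 p2 (k, l)"
          by (simp add: diag_weight_def e_def f_def algebra_simps)
      qed (use \<tau> in auto)
      finally have "(M + 1) * (e + f) \<le> \<tau> * diag_weight a1 a2 p1 p2 (k, l)" .
      moreover have "x\<^sup>2 + x\<^sup>2 / 2 * W \<le> x\<^sup>2 * (1 + W)" using W by (simp add: algebra_simps)
      ultimately have "x\<^sup>2 + (- \<tau> * diag_weight a1 a2 p1 p2 (k, l) + x\<^sup>2 / 2 * W) \<le> M * (e + f + 1/2) - (M + 1) * (e + f)"
        using x2 by linarith
      also have "\<dots> = M / 2 - (e + f)" by (simp add: algebra_simps)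
      finally show ?thesis using e by simp
    qed
    finally show ?thesis by (simp add: x_def exp_add[symmetric])
  qed
  have "(\<lambda>k. \<bar>conj_coord h1 h2 p1 p2 k\<bar> * exp (- \<tau> * diag_weight a1 a2 p1 p2 k + (conj_coord h1 h2 p1 p2 k)\<^sup>2 / 2 * W)) summable_on UNIV"
  proof (rule summable_on_comparison_test[OF summable_on_cmult_right[OF summable_exp_minus_abs_int2]])
    fix k :: "int \<times> int"
    show "\<bar>conj_coord h1 h2 p1 p2 k\<bar> * exp (- \<tau> * diag_weight a1 a2 p1 p2 k + (conj_coord h1 h2 p1 p2 k)\<^sup>2 / 2 * W)
       \<le> exp (M / 2 + 2) * (case k of (k, l) \<Rightarrow> exp (- real_of_int \<bar>k\<bar>) * exp (- real_of_int \<bar>l\<bar>))"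
      using bound[of "fst k" "snd k"] by (simp add: case_prod_beta)
  qed auto
  then show ?thesis using \<tau> by blast
qed

lemma diag_theta_tail:
  assumes a: "a1 > 0" "a2 > 0" and p: "p1 \<in> {0, 1}" "p2 \<in> {0, 1}" and W: "W \<ge> 0"
  obtains \<tau>0 B where "\<tau>0 > 0" "B \<ge> 0"
    "\<And>\<tau> w J N. \<tau> \<ge> \<tau>0 \<Longrightarrow> norm w \<le> W \<Longrightarrow> finite J \<Longrightarrow> (\<And>k. k \<notin> J \<Longrightarrow> diag_weight a1 a2 p1 p2 k \<ge> N) \<Longrightarrow>
    norm (diag_theta h1 h2 a1 a2 p1 p2 s1 s2 \<tau> w - (\<Sum>k\<in>J. theta_term h1 h2 a1 a2 p1 p2 s1 s2 \<tau> w k))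
     \<le> exp (- (\<tau> - \<tau>0) * N) * B"
proof -
  obtain \<tau>0 where \<tau>: "\<tau>0 > 0" and S: "(\<lambda>k. \<bar>conj_coord h1 h2 p1 p2 k\<bar> *
     exp (- \<tau>0 * diag_weight a1 a2 p1 p2 k + (conj_coord h1 h2 p1 p2 k)\<^sup>2 / 2 * W)) summable_on UNIV"
    using diag_theta_summable[OF assms] by blast
  define c where "c k = (-1) powi (fst k * s1 + snd k * s2) * complex_of_real (conj_coord h1 h2 p1 p2 k)" for k
  define d where "d k = complex_of_real ((conj_coord h1 h2 p1 p2 k)\<^sup>2 / 2)" for k
  have nc: "norm (c k) = \<bar>conj_coord h1 h2 p1 p2 k\<bar>" for k by (simp add: c_def norm_mult norm_power_int)
  have nd: "norm (d k) = (conj_coord h1 h2 p1 p2 k)\<^sup>2 / 2" for k unfolding d_def norm_of_real by simp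
  have e: "diag_weight a1 a2 p1 p2 k \<ge> 0" for k
    using a int_square_plus_ge(1)[OF p(1), of "fst k"] int_square_plus_ge(1)[OF p(2), of "snd k"]
    unfolding diag_weight_def by (intro divide_nonneg_pos add_nonneg_nonneg mult_nonneg_nonneg) (auto simp del: of_int_add of_int_mult)
  define B where "B = (\<Sum>\<^sub>\<infinity>k. norm (c k) * exp (- \<tau>0 * diag_weight a1 a2 p1 p2 k + norm (d k) * W))"
  have B0: "B \<ge> 0" unfolding B_def by (intro infsum_nonneg) auto
  have "norm (diag_theta h1 h2 a1 a2 p1 p2 s1 s2 \<tau> w - (\<Sum>k\<in>J. c k * exp (- of_real (\<tau> * diag_weight a1 a2 p1 p2 k) + d k * w)))
     \<le> exp (- (\<tau> - \<tau>0) * N) * B"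
    if "\<tau> \<ge> \<tau>0" "norm w \<le> W" "finite J" "\<And>k. k \<notin> J \<Longrightarrow> diag_weight a1 a2 p1 p2 k \<ge> N" for \<tau> w J N
    unfolding diag_theta_def c_def[symmetric] d_def[symmetric] B_def
    by (rule exp_sum_tail_le[OF e _ that(3,4,1,2)]) (use S in \<open>auto simp: nc nd\<close>)
  then show thesis unfolding c_def d_def by (rule that[OF \<tau> B0])
qed

lemma diag_theta_swap: "diag_theta h1 h2 a1 a2 p1 p2 s1 s2 \<tau> w = diag_theta h2 h1 a2 a1 p2 p1 s2 s1 \<tau> w"
proof -
  have b: "bij_betw prod.swap (UNIV :: (int \<times> int) set) UNIV" by (simp add: bij_betw_def)
  have "conj_coord h1 h2 p1 p2 (prod.swap k) = conj_coord h2 h1 p2 p1 k"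
    "diag_weight a1 a2 p1 p2 (prod.swap k) = diag_weight a2 a1 p2 p1 k" for k
    by (simp_all add: conj_coord_def diag_weight_def add.commute)
  then show ?thesis
    unfolding diag_theta_def
    by (subst infsum_reindex_bij_betw[OF b, symmetric]) (simp add: add.commute)
qed

text \<open>Weight 0 occurs only at (0, 0) and (-1, 0), which are opposite vectors. As
  \<open>s1\<close> is odd their terms add up to h1 exp(h1^2 w / 8) instead of cancelling, and for
  large \<tau> the tail is smaller than this.\<close>

lemma diag_theta_10_nonzero:
  assumes a: "a1 > 0" "a2 > 0" and h: "h1 \<noteq> 0" and s: "odd s1" and W: "W \<ge> 0"
  shows "\<exists>\<tau>1. \<forall>\<tau>\<ge>\<tau>1. \<forall>w. norm w \<le> W \<longrightarrow> diag_theta h1 h2 a1 a2 1 0 s1 s2 \<tau> w \<noteq> 0"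
proof -
  obtain \<tau>0 B where \<tau>: "\<tau>0 > 0" and B: "B \<ge> 0" and tail: "\<And>\<tau> w J N. \<tau> \<ge> \<tau>0 \<Longrightarrow> norm w \<le> W \<Longrightarrow> finite J \<Longrightarrow> (\<And>k. k \<notin> J \<Longrightarrow> diag_weight a1 a2 1 0 k \<ge> N) \<Longrightarrow>
    norm (diag_theta h1 h2 a1 a2 1 0 s1 s2 \<tau> w - (\<Sum>k\<in>J. theta_term h1 h2 a1 a2 1 0 s1 s2 \<tau> w k))
     \<le> exp (- (\<tau> - \<tau>0) * N) * B"
    by (rule diag_theta_tail[of a1 a2 1 0 W h1 h2 s1 s2]) (use a W in auto)
  define N where "N = min a1 a2 / 2"
  have N: "N > 0" using a by (simp add: N_def)
  define J where "J = {(0, 0), (-1, 0 :: int) :: int \<times> int}"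
  have J: "diag_weight a1 a2 1 0 k \<ge> N" if "k \<notin> J" for k
  proof -
    obtain x y where k: "k = (x, y)" by (cases k)
    show ?thesis
    proof (cases "y = 0")
      case True
      then have "x \<noteq> 0" "x \<noteq> -1" using that by (auto simp: J_def k)
      then have "x \<ge> 1 \<or> x + 1 \<le> -1" by linarith
      then have "x * (x + 1) \<ge> 1 * 1"
        using mult_mono[of 1 x 1 "x + 1"] mult_mono[of 1 "- x" 1 "- (x + 1)"] by (auto simp: algebra_simps)
      then have "1 \<le> real_of_int (x * (x + 1))" by linarith
      then have "a1 * 1 \<le> a1 * real_of_int (x * (x + 1))" using a by (intro mult_left_mono) auto
      then show ?thesis using True a by (simp add: diag_weight_def k N_def power2_eq_square algebra_simps)
    next
      case False
      then have "1 \<le> y\<^sup>2" using zero_less_power2[of y] by linarith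
      then have "1 \<le> real_of_int (y\<^sup>2)" by linarith
      then have "a2 * 1 \<le> a2 * real_of_int (y\<^sup>2)" using a by (intro mult_left_mono) auto
      moreover have "a1 * real_of_int (x\<^sup>2 + 1 * x) \<ge> 0"
        using a int_square_plus_ge(1)[of 1 x] by (intro mult_nonneg_nonneg) (auto simp del: of_int_add)
      ultimately show ?thesis unfolding diag_weight_def k N_def by simp
    qed
  qed
  define m where "m = \<bar>h1\<bar> * exp (- (h1\<^sup>2 / 8 * W))"
  have m: "m > 0" using h by (simp add: m_def)
  show ?thesis
  \<comment> \<open>The threshold makes (B + 1) exp(-(\<tau> - \<tau>0) N) at most \<open>m\<close>,
    the lower bound of the leading term on the disc of radius W.\<close>
  proof (intro exI[of _ "max \<tau>0 (\<tau>0 + ln ((B + 1) / m) / N)"] allI impI)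
    fix \<tau> :: real and w :: complex
    assume t: "max \<tau>0 (\<tau>0 + ln ((B + 1) / m) / N) \<le> \<tau>" and w: "norm w \<le> W"
    have main: "(\<Sum>k\<in>J. theta_term h1 h2 a1 a2 1 0 s1 s2 \<tau> w k)
       = of_real h1 * exp (of_real (h1\<^sup>2 / 8) * w)"
      using s by (simp add: J_def conj_coord_def diag_weight_def power2_eq_square)
    have "ln ((B + 1) / m) \<le> (\<tau> - \<tau>0) * N" using t N by (simp add: field_simps)
    then have "exp (ln ((B + 1) / m)) \<le> exp ((\<tau> - \<tau>0) * N)" by (simp only: exp_le_cancel_iff)
    moreover define E where "E = exp ((\<tau> - \<tau>0) * N)"
    ultimately have "(B + 1) / m \<le> E" using B m by simp
    then have "B + 1 \<le> E * m" using m by (simp add: field_simps)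
    then have "exp (- (\<tau> - \<tau>0) * N) * (B + 1) \<le> exp (- (\<tau> - \<tau>0) * N) * (E * m)"
      by (rule mult_left_mono) simp
    also have "exp (- (\<tau> - \<tau>0) * N) * (E * m) = exp (- (\<tau> - \<tau>0) * N + (\<tau> - \<tau>0) * N) * m"
      unfolding exp_add E_def by simp
    also have "\<dots> = m" by (simp add: algebra_simps)
    finally have "exp (- (\<tau> - \<tau>0) * N) * (B + 1) \<le> m" .
    then have small: "exp (- (\<tau> - \<tau>0) * N) * B < m"
      by (simp add: distrib_left add_pos_nonneg) (smt (verit) exp_gt_zero)
    have "\<bar>Re (of_real (h1\<^sup>2 / 8) * w)\<bar> \<le> h1\<^sup>2 / 8 * W"
      using order_trans[OF abs_Re_le_cmod w] by (simp add: abs_mult mult_left_mono)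
    then have "exp (- (h1\<^sup>2 / 8 * W)) \<le> exp (Re (of_real (h1\<^sup>2 / 8) * w))" by simp
    then have big: "m \<le> norm (of_real h1 * exp (of_real (h1\<^sup>2 / 8) * w))"
      unfolding m_def norm_mult norm_of_real norm_exp_eq_Re by (rule mult_left_mono) simp
    show "diag_theta h1 h2 a1 a2 1 0 s1 s2 \<tau> w \<noteq> 0"
    proof
      assume "diag_theta h1 h2 a1 a2 1 0 s1 s2 \<tau> w = 0"
      then have "norm (0 - of_real h1 * exp (of_real (h1\<^sup>2 / 8) * w)) \<le> exp (- (\<tau> - \<tau>0) * N) * B"
        using tail[of \<tau> w J N, OF _ w _ J] t unfolding main by (simp add: J_def)
      then show False using small big by simp
    qed
  qed
qed

section \<open>The theta series of characteristic (1/2, 1/2) as a power series\<close>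

definition triangular :: "int \<Rightarrow> nat" where "triangular k = nat ((k\<^sup>2 + k) div 2)"

text \<open>The weights of the diagonal form will be traces of \<alpha> times squares of basis
  vectors, hence positive integers. So all exponents of q are natural numbers.\<close>

definition nat_weight :: "nat \<Rightarrow> nat \<Rightarrow> int \<times> int \<Rightarrow> nat" where
  "nat_weight A1 A2 k = A1 * triangular (fst k) + A2 * triangular (snd k)"

lemma triangular: "2 * int (triangular k) = k\<^sup>2 + k"
proof -
  have "even (k\<^sup>2 + k)" by simp
  then show ?thesis using int_square_plus_ge(1)[of 1 k] by (simp add: triangular_def)
qed

lemma diag_weight_11: "diag_weight (real A1) (real A2) 1 1 k = real (nat_weight A1 A2 k)"
proof -
  have "real_of_int ((fst k)\<^sup>2 + fst k) = 2 * real (triangular (fst k))" "real_of_int ((snd k)\<^sup>2 + snd k) = 2 * real (triangular (snd k))"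
    using triangular[of "fst k"] triangular[of "snd k"] by (metis of_int_mult of_int_numeral of_int_of_nat_eq)+
  then show ?thesis by (simp add: diag_weight_def nat_weight_def)
qed

lemma triangular_eq_0_iff: "triangular k = 0 \<longleftrightarrow> k = 0 \<or> k = -1"
proof -
  have "triangular k = 0 \<longleftrightarrow> k * (k + 1) = 0"
    using triangular[of k] by (auto simp: power2_eq_square algebra_simps)
  then show ?thesis by auto
qed

lemma finite_nat_weight_le:
  assumes "A1 > 0" "A2 > 0"
  shows "finite {k. nat_weight A1 A2 k \<le> N}"
proof (rule finite_subset)
  show "{k. nat_weight A1 A2 k \<le> N} \<subseteq> {- (2 * int N + 1)..2 * int N + 1} \<times> {- (2 * int N + 1)..2 * int N + 1}"
  proof
    fix k assume k: "k \<in> {k. nat_weight A1 A2 k \<le> N}"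
    have "triangular (fst k) \<le> A1 * triangular (fst k)" "triangular (snd k) \<le> A2 * triangular (snd k)"
      using assms by auto
    then have "triangular (fst k) \<le> N" "triangular (snd k) \<le> N"
      using k unfolding nat_weight_def mem_Collect_eq by linarith+
    moreover have "\<bar>fst k\<bar> - 1 \<le> 2 * int (triangular (fst k))" "\<bar>snd k\<bar> - 1 \<le> 2 * int (triangular (snd k))"
      using int_square_plus_ge(2)[of 1 "fst k"] int_square_plus_ge(2)[of 1 "snd k"] triangular by auto
    ultimately have "\<bar>fst k\<bar> \<le> 2 * int N + 1" "\<bar>snd k\<bar> \<le> 2 * int N + 1" by linarith+
    then show "k \<in> {- (2 * int N + 1)..2 * int N + 1} \<times> {- (2 * int N + 1)..2 * int N + 1}"
      by (cases k) auto
  qed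
qed simp

text \<open>Normalized by the term at (0, 0), the exponents become \<sigma>-conjugates of elements
  of the square of the ideal, up to half multiples of h1 h2. Their exponentials are therefore
  accessible through S and A.\<close>

definition conj_exponent :: "real \<Rightarrow> real \<Rightarrow> int \<times> int \<Rightarrow> real" where
  "conj_exponent h1 h2 k = ((conj_coord h1 h2 1 1 k)\<^sup>2 - (conj_coord h1 h2 1 1 (0, 0))\<^sup>2) / 2"

text \<open>Only the constant part \<open>c0\<close> of w is exponentiated here; the part \<epsilon>
  stays behind as a formal exponential.\<close>

definition theta_coeff :: "real \<Rightarrow> real \<Rightarrow> int \<Rightarrow> int \<Rightarrow> complex \<Rightarrow> int \<times> int \<Rightarrow> complex" where
  "theta_coeff h1 h2 s1 s2 c0 k = (-1) powi (fst k * s1 + snd k * s2) * of_real (conj_coord h1 h2 1 1 k)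
     * exp (of_real (conj_exponent h1 h2 k) * c0)"

lemma eventually_norm_add_eval_fps_le:
  fixes \<epsilon> :: "complex fps"
  assumes \<epsilon>: "fps_nth \<epsilon> 0 = 0" "fps_conv_radius \<epsilon> > 0" and q: "q \<longlonglongrightarrow> 0"
  shows "\<forall>\<^sub>F n in sequentially. norm (c0 + eval_fps \<epsilon> (q n)) \<le> norm c0 + 1"
proof -
  have "eval_fps \<epsilon> has_fps_expansion \<epsilon>" using \<epsilon> by (intro eval_fps_has_fps_expansion)
  then have "continuous (at 0) (eval_fps \<epsilon>)" by (rule has_fps_expansion_imp_continuous)
  then have "(\<lambda>n. eval_fps \<epsilon> (q n)) \<longlonglongrightarrow> eval_fps \<epsilon> 0" by (rule isCont_tendsto_compose[OF _ q])
  then have "(\<lambda>n. norm (eval_fps \<epsilon> (q n))) \<longlonglongrightarrow> 0"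
    using \<epsilon> tendsto_norm_zero by (fastforce simp: eval_fps_at_0)
  then have "\<forall>\<^sub>F n in sequentially. norm (eval_fps \<epsilon> (q n)) < 1" by (rule order_tendstoD) simp
  then show ?thesis
    by eventually_elim (smt (verit) norm_triangle_ineq)
qed

text \<open>
  The theta series restricted to the branch, divided by the exponential of its term at
  \<open>(0, 0)\<close>, is a power series in $q$ to all orders, and it has to vanish formally.
\<close>

lemma diag_theta_11_formal:
  fixes \<epsilon> :: "complex fps" and \<tau> :: "nat \<Rightarrow> real"
  assumes A: "A1 > 0" "A2 > 0" and \<epsilon>: "fps_nth \<epsilon> 0 = 0" "fps_conv_radius \<epsilon> > 0"
    and \<tau>: "filterlim \<tau> at_top sequentially"
    and zero: "\<And>n. diag_theta h1 h2 (real A1) (real A2) 1 1 s1 s2 (\<tau> n) (c0 + eval_fps \<epsilon> (of_real (exp (- \<tau> n)))) = 0"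
  shows "(\<Sum>k | nat_weight A1 A2 k \<le> N. theta_coeff h1 h2 s1 s2 c0 k *
    fps_nth (fps_exp (of_real (conj_exponent h1 h2 k)) oo \<epsilon>) (N - nat_weight A1 A2 k)) = 0"
proof -
  define q where "q n = complex_of_real (exp (- \<tau> n))" for n
  have "(\<lambda>n. exp (- \<tau> n)) \<longlonglongrightarrow> 0"
    using \<tau> by (intro filterlim_compose[OF exp_at_bot]) (simp add: filterlim_uminus_at_bot)
  then have q: "q \<longlonglongrightarrow> 0" unfolding q_def using tendsto_of_real[of "\<lambda>n. exp (- \<tau> n)" 0] by simp
  have q0: "q n \<noteq> 0" for n by (simp add: q_def)
  define J where "J = {k. nat_weight A1 A2 k \<le> N}"
  have J: "finite J" unfolding J_def by (rule finite_nat_weight_le[OF A])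
  define W where "W = norm c0 + 1"
  have evW: "\<forall>\<^sub>F n in sequentially. norm (c0 + eval_fps \<epsilon> (q n)) \<le> W"
    unfolding W_def by (rule eventually_norm_add_eval_fps_le[OF \<epsilon> q])
  obtain \<tau>0 B where B: "B \<ge> 0" and tail: "\<And>\<tau> w J N. \<tau> \<ge> \<tau>0 \<Longrightarrow> norm w \<le> W \<Longrightarrow> finite J \<Longrightarrow> (\<And>k. k \<notin> J \<Longrightarrow> diag_weight (real A1) (real A2) 1 1 k \<ge> N) \<Longrightarrow>
    norm (diag_theta h1 h2 (real A1) (real A2) 1 1 s1 s2 \<tau> w - (\<Sum>k\<in>J. theta_term h1 h2 (real A1) (real A2) 1 1 s1 s2 \<tau> w k))
     \<le> exp (- (\<tau> - \<tau>0) * N) * B"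
    by (rule diag_theta_tail[of "real A1" "real A2" 1 1 W h1 h2 s1 s2]) (use A in \<open>auto simp: W_def\<close>)
  define d where "d = (conj_coord h1 h2 1 1 (0, 0))\<^sup>2 / 2"
  define f where "f x = (\<Sum>k\<in>J. theta_coeff h1 h2 s1 s2 c0 k * (x ^ nat_weight A1 A2 k * exp (of_real (conj_exponent h1 h2 k) * eval_fps \<epsilon> x)))" for x
  define P where "P = (\<Sum>k\<in>J. fps_const (theta_coeff h1 h2 s1 s2 c0 k) * (fps_X ^ nat_weight A1 A2 k * (fps_exp (of_real (conj_exponent h1 h2 k)) oo \<epsilon>)))"
  have "((\<lambda>x. exp (c * x)) \<circ> eval_fps \<epsilon>) has_fps_expansion (fps_exp c oo \<epsilon>)" for c
    by (intro has_fps_expansion_compose has_fps_expansion_exp eval_fps_has_fps_expansion \<epsilon>)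
  then have "f has_fps_expansion P"
    unfolding f_def[abs_def] P_def o_def
    by (intro has_fps_expansion_sum has_fps_expansion_mult has_fps_expansion_const has_fps_expansion_fps_X_power) auto
  \<comment> \<open>All weights outside \<open>J\<close> are at least N + 1, so the vanishing of the
    full series leaves a partial sum of order q^(N+1), and the coefficient of index N must
    vanish.\<close>
  moreover have "\<forall>\<^sub>F n in sequentially. norm (f (q n)) \<le> (exp (\<bar>d\<bar> * W) * exp (\<tau>0 * (N + 1)) * B) * norm (q n) ^ (N + 1)"
    using evW filterlim_at_top_dense[of \<tau>, THEN iffD1, OF \<tau>, rule_format, of \<tau>0]
  proof eventually_elim
    case (elim n)
    define w where "w = c0 + eval_fps \<epsilon> (q n)"
    define S where "S = (\<Sum>k\<in>J. theta_term h1 h2 (real A1) (real A2) 1 1 s1 s2 (\<tau> n) w k)"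
    have "f (q n) = exp (- of_real d * w) * S"
      unfolding f_def S_def sum_distrib_left
    proof (intro sum.cong refl)
      fix k
      have 1: "q n ^ nat_weight A1 A2 k = exp (- of_real (\<tau> n * diag_weight (real A1) (real A2) 1 1 k))"
        by (simp only: q_def exp_of_real[symmetric] exp_of_nat_mult[symmetric]) (simp add: diag_weight_11 mult_ac)
      have 2: "complex_of_real (conj_exponent h1 h2 k) = of_real ((conj_coord h1 h2 1 1 k)\<^sup>2 / 2) - of_real d"
        by (simp add: conj_exponent_def d_def diff_divide_distrib)
      show "theta_coeff h1 h2 s1 s2 c0 k * (q n ^ nat_weight A1 A2 k * exp (of_real (conj_exponent h1 h2 k) * eval_fps \<epsilon> (q n))) =
        exp (- of_real d * w) * ((-1) powi (fst k * s1 + snd k * s2) * of_real (conj_coord h1 h2 1 1 k) *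
        exp (- of_real (\<tau> n * diag_weight (real A1) (real A2) 1 1 k) + of_real ((conj_coord h1 h2 1 1 k)\<^sup>2 / 2) * w))"
      proof -
        have shift: "exp ((x - y) * c0) * (exp z * exp ((x - y) * v)) = exp (- y * (c0 + v)) * exp (z + x * (c0 + v))"
          for x y z v :: complex
          unfolding exp_add[symmetric] by (simp add: algebra_simps)
        have "c * exp ((x - y) * c0) * (exp z * exp ((x - y) * v)) = exp (- y * (c0 + v)) * (c * exp (z + x * (c0 + v)))"
          for c x y z v :: complex
          unfolding mult.assoc shift by (rule mult.left_commute)
        then show ?thesis unfolding theta_coeff_def 1 2 w_def .
      qed
    qed
    moreover have "norm (exp (- of_real d * w)) \<le> exp (\<bar>d\<bar> * W)"
    proof -
      have "Re (- of_real d * w) \<le> \<bar>d\<bar> * W"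
      proof -
        have "norm (- of_real d * w) = \<bar>d\<bar> * norm w" by (simp add: norm_mult)
        also have "\<dots> \<le> \<bar>d\<bar> * W" unfolding w_def by (rule mult_left_mono[OF elim(1)]) simp
        finally show ?thesis using complex_Re_le_cmod[of "- of_real d * w"] by linarith
      qed
      then show ?thesis unfolding norm_exp_eq_Re by (simp only: exp_le_cancel_iff)
    qed
    moreover have "norm S \<le> exp (- (\<tau> n - \<tau>0) * (N + 1)) * B"
    proof -
      have "norm (0 - S) \<le> exp (- (\<tau> n - \<tau>0) * (N + 1)) * B"
        unfolding S_def w_def zero[of n, folded q_def, symmetric]
        using elim J by (intro tail) (auto simp: J_def diag_weight_11)
      then show ?thesis by simp
    qed
    ultimately have "norm (f (q n)) \<le> exp (\<bar>d\<bar> * W) * (exp (- (\<tau> n - \<tau>0) * (N + 1)) * B)"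
      by (simp add: norm_mult mult_mono)
    also have "exp (- (\<tau> n - \<tau>0) * (N + 1)) = exp (\<tau>0 * (N + 1)) * norm (q n) ^ (N + 1)"
    proof -
      have "norm (q n) ^ (N + 1) = exp (- \<tau> n * (N + 1))"
        unfolding q_def by (simp add: exp_of_nat_mult[symmetric] algebra_simps flip: power_Suc)
      then show ?thesis by (simp add: exp_add[symmetric] algebra_simps)
    qed
    finally show ?case by (simp add: mult_ac)
  qed
  ultimately have "fps_nth P N = 0" by (rule fps_nth_eq_0_of_decay[OF _ q q0]) simp
  moreover have "fps_nth P N = (\<Sum>k\<in>J. theta_coeff h1 h2 s1 s2 c0 k *
      fps_nth (fps_exp (of_real (conj_exponent h1 h2 k)) oo \<epsilon>) (N - nat_weight A1 A2 k))"
    unfolding P_def fps_sum_nth by (intro sum.cong refl) (auto simp: J_def fps_X_power_mult_nth)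
  ultimately show ?thesis by (simp add: J_def)
qed

subsection \<open>Recursion for the coefficients along the branch\<close>

text \<open>Coefficient comparison in the derivative of exp(\<kappa> \<epsilon>), which is \<kappa>
  exp(\<kappa> \<epsilon>) times the derivative of \<epsilon>.\<close>

lemma fps_exp_compose_rec:
  fixes \<kappa> :: "'a::field_char_0"
  assumes "fps_nth \<epsilon> 0 = 0"
  shows "of_nat (Suc n) * fps_nth (fps_exp \<kappa> oo \<epsilon>) (Suc n) =
    \<kappa> * (\<Sum>i\<le>n. fps_nth (fps_exp \<kappa> oo \<epsilon>) i * (of_nat (Suc (n - i)) * fps_nth \<epsilon> (Suc (n - i))))"
proof -
  let ?\<Phi> = "fps_exp \<kappa> oo \<epsilon>"
  have "fps_deriv ?\<Phi> = fps_const \<kappa> * (?\<Phi> * fps_deriv \<epsilon>)"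
    using assms by (simp add: fps_compose_deriv fps_compose_mult_distrib mult.assoc)
  then have "fps_nth (fps_deriv ?\<Phi>) n = fps_nth (fps_const \<kappa> * (?\<Phi> * fps_deriv \<epsilon>)) n" by simp
  then show ?thesis by (simp add: fps_mult_nth[of ?\<Phi> "fps_deriv \<epsilon>"] atLeast0AtMost)
qed

text \<open>These closure properties are the ones used in \<open>quad_field_adjoin\<close>; as that
  field is an intersection, membership is proved in one arbitrary such set.\<close>

definition subfield_set :: "complex set \<Rightarrow> bool" where
  "subfield_set F \<longleftrightarrow> 1 \<in> F \<and> (\<forall>x\<in>F. \<forall>y\<in>F. x - y \<in> F \<and> x * y \<in> F) \<and> (\<forall>x\<in>F. inverse x \<in> F)"

context
  fixes F :: "complex set" and A :: complex
  assumes F: "subfield_set F" and A: "A \<noteq> 0"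
begin

lemma F_0: "0 \<in> F" and F_1: "1 \<in> F"
  using F unfolding subfield_set_def by (metis diff_self, blast)
lemma F_diff: "x \<in> F \<Longrightarrow> y \<in> F \<Longrightarrow> x - y \<in> F" and F_mult: "x \<in> F \<Longrightarrow> y \<in> F \<Longrightarrow> x * y \<in> F"
  and F_inverse: "x \<in> F \<Longrightarrow> inverse x \<in> F"
  using F unfolding subfield_set_def by blast+
lemma F_uminus: "x \<in> F \<Longrightarrow> - x \<in> F" using F_diff[OF F_0, of x] by simp
lemma F_add: "x \<in> F \<Longrightarrow> y \<in> F \<Longrightarrow> x + y \<in> F" using F_diff[of x "- y"] F_uminus by simp
lemma F_divide: "x \<in> F \<Longrightarrow> y \<in> F \<Longrightarrow> x / y \<in> F" unfolding divide_inverse by (intro F_mult F_inverse)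
lemma F_of_nat: "of_nat n \<in> F" by (induction n) (auto intro: F_0 F_1 F_add)
lemma F_sum: "(\<And>a. a \<in> B \<Longrightarrow> f a \<in> F) \<Longrightarrow> sum f B \<in> F"
  by (induction B rule: infinite_finite_induct) (auto intro: F_0 F_add)
lemma F_power: "x \<in> F \<Longrightarrow> x ^ n \<in> F" by (induction n) (auto intro: F_1 F_mult)
lemma F_powi: "x \<in> F \<Longrightarrow> x powi n \<in> F" by (auto simp: power_int_def intro: F_power F_inverse)

text \<open>The recursion for exp(\<kappa> \<epsilon>) is homogeneous if degree n is measured
  against A^n. In degree n the unknown coefficient of \<epsilon> enters linearly with factor
  \<kappa>, and the rest involves lower coefficients only.\<close>

lemma graded_exp_compose:
  assumes \<epsilon>: "fps_nth \<epsilon> 0 = 0" and \<kappa>: "\<kappa> \<in> F" and IH: "\<And>j. j < n \<Longrightarrow> fps_nth \<epsilon> j / A ^ j \<in> F"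
  shows "m < n \<Longrightarrow> fps_nth (fps_exp \<kappa> oo \<epsilon>) m / A ^ m \<in> F"
    and "n > 0 \<Longrightarrow> (fps_nth (fps_exp \<kappa> oo \<epsilon>) n - \<kappa> * fps_nth \<epsilon> n) / A ^ n \<in> F"
proof -
  define \<Phi> where "\<Phi> = fps_exp \<kappa> oo \<epsilon>"
  have summand: "\<Phi>0 * (of_nat k * e) / A ^ Suc l \<in> F"
    if "\<Phi>0 / A ^ i \<in> F" "e / A ^ Suc (l - i) \<in> F" "i \<le> l" for \<Phi>0 e i l k
  proof -
    have eq: "\<Phi>0 * (of_nat k * e) / A ^ Suc l = (\<Phi>0 / A ^ i) * (of_nat k * (e / A ^ Suc (l - i)))"
      using that(3) A by (simp add: power_add[symmetric] field_simps flip: power_Suc)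
    show ?thesis unfolding eq by (intro F_mult that F_of_nat)
  qed
  have low: "\<Phi> $ m / A ^ m \<in> F" if "m < n" for m
    using that
  proof (induction m rule: less_induct)
    case (less m)
    show ?case
    proof (cases m)
      case 0
      then show ?thesis by (simp add: \<Phi>_def F_1)
    next
      case (Suc l)
      have "\<Phi> $ m = \<kappa> * (\<Sum>i\<le>l. \<Phi> $ i * (of_nat (Suc (l - i)) * \<epsilon> $ (Suc (l - i)))) / of_nat (Suc l)"
        using fps_exp_compose_rec[OF \<epsilon>, of l \<kappa>] unfolding \<Phi>_def Suc
        by (metis nonzero_mult_div_cancel_left of_nat_neq_0)
      then have "\<Phi> $ m / A ^ m = \<kappa> * (\<Sum>i\<le>l. \<Phi> $ i * (of_nat (Suc (l - i)) * \<epsilon> $ (Suc (l - i))) / A ^ Suc l) / of_nat (Suc l)"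
        unfolding sum_divide_distrib[symmetric] by (simp add: Suc field_simps)
      also have "\<dots> \<in> F"
        using less.prems Suc by (intro F_divide[of _ "of_nat (Suc l)"] F_mult[OF \<kappa>] F_sum summand[OF less.IH IH] F_of_nat) auto
      finally show ?thesis .
    qed
  qed
  then show "m < n \<Longrightarrow> fps_nth (fps_exp \<kappa> oo \<epsilon>) m / A ^ m \<in> F" by (simp add: \<Phi>_def)
  assume "n > 0"
  then obtain l where n: "n = Suc l" by (cases n) auto
  \<comment> \<open>The summand i = 0 is the only one containing the coefficient of \<epsilon> of
    degree n.\<close>
  have split: "(\<Sum>i\<le>l. \<Phi> $ i * (of_nat (Suc (l - i)) * \<epsilon> $ (Suc (l - i)))) =
      of_nat (Suc l) * \<epsilon> $ Suc l + (\<Sum>i\<in>{1..l}. \<Phi> $ i * (of_nat (Suc (l - i)) * \<epsilon> $ (Suc (l - i))))"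
  proof -
    have "{..l} = insert 0 {1..l}" by auto
    then show ?thesis by (simp add: \<Phi>_def)
  qed
  have "of_nat (Suc l) * (\<Phi> $ n - \<kappa> * \<epsilon> $ n) = \<kappa> * (\<Sum>i\<in>{1..l}. \<Phi> $ i * (of_nat (Suc (l - i)) * \<epsilon> $ (Suc (l - i))))"
    using fps_exp_compose_rec[OF \<epsilon>, of l \<kappa>] unfolding \<Phi>_def[symmetric] split n by (simp add: algebra_simps)
  then have "\<Phi> $ n - \<kappa> * \<epsilon> $ n = \<kappa> * (\<Sum>i\<in>{1..l}. \<Phi> $ i * (of_nat (Suc (l - i)) * \<epsilon> $ (Suc (l - i)))) / of_nat (Suc l)"
    by (metis nonzero_mult_div_cancel_left of_nat_neq_0)
  then have "(\<Phi> $ n - \<kappa> * \<epsilon> $ n) / A ^ n = \<kappa> * (\<Sum>i\<in>{1..l}. \<Phi> $ i * (of_nat (Suc (l - i)) * \<epsilon> $ (Suc (l - i))) / A ^ Suc l) / of_nat (Suc l)"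
    unfolding sum_divide_distrib[symmetric] by (simp add: n field_simps)
  also have "\<dots> \<in> F"
    by (intro F_divide[of _ "of_nat (Suc l)"] F_mult[OF \<kappa>] F_sum summand[OF low IH] F_of_nat) (auto simp: n)
  finally show "(fps_nth (fps_exp \<kappa> oo \<epsilon>) n - \<kappa> * fps_nth \<epsilon> n) / A ^ n \<in> F" by (simp add: \<Phi>_def)
qed

text \<open>The identity in degree n is linear in the coefficient of \<epsilon> of index n, which
  occurs only in the terms of weight 0. The condition \<open>lead\<close> says that these reduce to
  one exponential for positive degrees, and c1 \<kappa>1, the factor of the unknown, is
  invertible.\<close>

lemma graded_coefficients:
  fixes \<epsilon> :: "complex fps" and wt :: "'k \<Rightarrow> nat"
  assumes \<epsilon>: "fps_nth \<epsilon> 0 = 0"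
    and fin: "\<And>N. finite {k. wt k \<le> N}"
    and sum0: "\<And>N. (\<Sum>k | wt k \<le> N. c k * fps_nth (fps_exp (\<kappa> k) oo \<epsilon>) (N - wt k)) = 0"
    and c: "\<And>k. c k / A ^ wt k \<in> F" and \<kappa>: "\<And>k. \<kappa> k \<in> F"
    and lead: "\<And>N. N > 0 \<Longrightarrow> (\<Sum>k | wt k = 0. c k * fps_nth (fps_exp (\<kappa> k) oo \<epsilon>) N) = c1 * fps_nth (fps_exp \<kappa>1 oo \<epsilon>) N"
    and nz: "c1 \<in> F" "c1 \<noteq> 0" "\<kappa>1 \<in> F" "\<kappa>1 \<noteq> 0"
  shows "fps_nth \<epsilon> n / A ^ n \<in> F"
proof (induction n rule: less_induct)
  case (less n)
  show ?case
  proof (cases "n = 0")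
    case True
    then show ?thesis by (simp add: \<epsilon> F_0)
  next
    case False
    then have n: "n > 0" by simp
    have low: "fps_nth (fps_exp \<kappa> oo \<epsilon>) m / A ^ m \<in> F" if "\<kappa> \<in> F" "m < n" for \<kappa> m
      using graded_exp_compose(1)[OF \<epsilon> that(1) less that(2)] by simp
    have top: "(fps_nth (fps_exp \<kappa>1 oo \<epsilon>) n - \<kappa>1 * fps_nth \<epsilon> n) / A ^ n \<in> F"
      using graded_exp_compose(2)[OF \<epsilon> nz(3) less n] by simp
    let ?r = "\<Sum>k | 0 < wt k \<and> wt k \<le> n. c k * fps_nth (fps_exp (\<kappa> k) oo \<epsilon>) (n - wt k)"
    have "{k. wt k \<le> n} = {k. wt k = 0} \<union> {k. 0 < wt k \<and> wt k \<le> n}" by auto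
    then have "0 = (\<Sum>k\<in>{k. wt k = 0} \<union> {k. 0 < wt k \<and> wt k \<le> n}. c k * fps_nth (fps_exp (\<kappa> k) oo \<epsilon>) (n - wt k))"
      using sum0[of n] by simp
    also have "\<dots> = (\<Sum>k | wt k = 0. c k * fps_nth (fps_exp (\<kappa> k) oo \<epsilon>) (n - wt k)) + ?r"
      by (intro sum.union_disjoint finite_subset[OF _ fin[of n]]) auto
    also have "(\<Sum>k | wt k = 0. c k * fps_nth (fps_exp (\<kappa> k) oo \<epsilon>) (n - wt k)) = c1 * fps_nth (fps_exp \<kappa>1 oo \<epsilon>) n"
      using lead[OF n] by simp
    finally have eq: "c1 * fps_nth (fps_exp \<kappa>1 oo \<epsilon>) n = - ?r" by (simp add: add_eq_0_iff2)
    have "?r / A ^ n = (\<Sum>k | 0 < wt k \<and> wt k \<le> n. (c k / A ^ wt k) * (fps_nth (fps_exp (\<kappa> k) oo \<epsilon>) (n - wt k) / A ^ (n - wt k)))"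
      unfolding sum_divide_distrib
      by (intro sum.cong refl) (use A in \<open>auto simp: power_add[symmetric]\<close>)
    also have "\<dots> \<in> F"
      using n by (intro F_sum F_mult c low \<kappa>) auto
    finally have r: "?r / A ^ n \<in> F" .
    have "fps_nth \<epsilon> n / A ^ n = (- (?r / A ^ n) / c1 - (fps_nth (fps_exp \<kappa>1 oo \<epsilon>) n - \<kappa>1 * fps_nth \<epsilon> n) / A ^ n) / \<kappa>1"
    proof -
      have "fps_nth (fps_exp \<kappa>1 oo \<epsilon>) n = - ?r / c1" using eq nz(2) by (simp add: field_simps)
      then show ?thesis using nz A by (simp add: field_simps)
    qed
    also have "\<dots> \<in> F" by (rule F_divide[OF F_diff[OF F_divide[OF F_uminus[OF r] nz(1)] top] nz(3)])
    finally show ?thesis .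
  qed
qed

end

subsection \<open>Change of basis\<close>

lemma zbasis_mem:
  assumes "is_zbasis M x y"
  shows "x \<in> M" "y \<in> M"
proof -
  have M: "M = {of_int m * x + of_int n * y | m n :: int. True}"
    using assms unfolding is_zbasis_def by (rule conjunct1)
  have "x = of_int 1 * x + of_int 0 * y" "y = of_int 0 * x + of_int 1 * y" by simp_all
  then show "x \<in> M" "y \<in> M" unfolding M by blast+
qed

lemma zbasis_coords:
  assumes "is_zbasis M x y" "z \<in> M"
  obtains m n :: int where "z = of_int m * x + of_int n * y"
  using assms unfolding is_zbasis_def by blast

lemma zbasis_indep:
  assumes "is_zbasis M x y" "of_int m * x + of_int n * y = 0"
  shows "m = 0" "n = 0"
  using assms unfolding is_zbasis_def by blast+

text \<open>Both products of the transition matrices are recorded: one shows that the pairing of the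
  characteristics is preserved, both together give a bijection of the index lattice.\<close>

lemma zbasis_transition:
  assumes "is_zbasis M w1 w2" "is_zbasis M e1 e2"
  obtains u11 u12 u21 u22 v11 v12 v21 v22 :: int where
    "w1 = of_int u11 * e1 + of_int u12 * e2" "w2 = of_int u21 * e1 + of_int u22 * e2"
    "u11 * v11 + u12 * v21 = 1" "u11 * v12 + u12 * v22 = 0" "u21 * v11 + u22 * v21 = 0" "u21 * v12 + u22 * v22 = 1"
    "v11 * u11 + v12 * u21 = 1" "v11 * u12 + v12 * u22 = 0" "v21 * u11 + v22 * u21 = 0" "v21 * u12 + v22 * u22 = 1"
proof -
  obtain u11 u12 :: int where w1: "w1 = of_int u11 * e1 + of_int u12 * e2"
    by (rule zbasis_coords[OF assms(2) zbasis_mem(1)[OF assms(1)]])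
  obtain u21 u22 :: int where w2: "w2 = of_int u21 * e1 + of_int u22 * e2"
    by (rule zbasis_coords[OF assms(2) zbasis_mem(2)[OF assms(1)]])
  obtain v11 v12 :: int where e1: "e1 = of_int v11 * w1 + of_int v12 * w2"
    by (rule zbasis_coords[OF assms(1) zbasis_mem(1)[OF assms(2)]])
  obtain v21 v22 :: int where e2: "e2 = of_int v21 * w1 + of_int v22 * w2"
    by (rule zbasis_coords[OF assms(1) zbasis_mem(2)[OF assms(2)]])
  have "of_int (u11 * v11 + u12 * v21 - 1) * w1 + of_int (u11 * v12 + u12 * v22) * w2 = 0"
    using w1 unfolding e1 e2 by (simp add: algebra_simps)
  from zbasis_indep[OF assms(1) this] have 1: "u11 * v11 + u12 * v21 = 1" "u11 * v12 + u12 * v22 = 0" by auto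
  have "of_int (u21 * v11 + u22 * v21) * w1 + of_int (u21 * v12 + u22 * v22 - 1) * w2 = 0"
    using w2 unfolding e1 e2 by (simp add: algebra_simps)
  from zbasis_indep[OF assms(1) this] have 2: "u21 * v11 + u22 * v21 = 0" "u21 * v12 + u22 * v22 = 1" by auto
  have "of_int (v11 * u11 + v12 * u21 - 1) * e1 + of_int (v11 * u12 + v12 * u22) * e2 = 0"
    using e1 unfolding w1 w2 by (simp add: algebra_simps)
  from zbasis_indep[OF assms(2) this] have 3: "v11 * u11 + v12 * u21 = 1" "v11 * u12 + v12 * u22 = 0" by auto
  have "of_int (v21 * u11 + v22 * u21) * e1 + of_int (v21 * u12 + v22 * u22 - 1) * e2 = 0"
    using e2 unfolding w1 w2 by (simp add: algebra_simps)
  from zbasis_indep[OF assms(2) this] have 4: "v21 * u11 + v22 * u21 = 0" "v21 * u12 + v22 * u22 = 1" by auto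
  show thesis using that[OF w1 w2 1 2 3 4] .
qed

text \<open>The transition matrix has determinant 1 or -1. With f = \<open>\<sigma>\<close> this
  makes the lattice norm independent of the basis.\<close>

lemma zbasis_abs_det:
  fixes f :: "real \<Rightarrow> real"
  assumes "is_zbasis M w1 w2" "is_zbasis M e1 e2"
    and f: "\<And>m n :: int. f (of_int m * e1 + of_int n * e2) = of_int m * f e1 + of_int n * f e2"
  shows "\<bar>w1 * f w2 - f w1 * w2\<bar> = \<bar>e1 * f e2 - f e1 * e2\<bar>"
proof -
  obtain u11 u12 u21 u22 v11 v12 v21 v22 :: int where u:
    "w1 = of_int u11 * e1 + of_int u12 * e2" "w2 = of_int u21 * e1 + of_int u22 * e2"
    "u11 * v11 + u12 * v21 = 1" "u11 * v12 + u12 * v22 = 0" "u21 * v11 + u22 * v21 = 0" "u21 * v12 + u22 * v22 = 1"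
    using zbasis_transition[OF assms(1,2)] by metis
  have "(u11 * u22 - u12 * u21) * (v11 * v22 - v12 * v21) =
     (u11 * v11 + u12 * v21) * (u21 * v12 + u22 * v22) - (u11 * v12 + u12 * v22) * (u21 * v11 + u22 * v21)"
    by (simp add: algebra_simps)
  also have "\<dots> = 1" using u by simp
  finally have "\<bar>u11 * u22 - u12 * u21\<bar> = 1" by (auto simp: zmult_eq_1_iff)
  then have det: "\<bar>real_of_int (u11 * u22 - u12 * u21)\<bar> = 1" by linarith
  have "w1 * f w2 - f w1 * w2 = of_int (u11 * u22 - u12 * u21) * (e1 * f e2 - f e1 * e2)"
    unfolding u(1,2) f by (simp add: algebra_simps)
  then show ?thesis using det by (simp add: abs_mult)
qed

text \<open>The vector m transforms with the transition matrix and m' with its inverse, so their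
  pairing and its parity persist. The summand \<open>h\<close> is arbitrary because the change is a
  mere reindexing.\<close>

lemma odd_characteristic_base_change:
  fixes w1 w2 e1 e2 :: real
  assumes basis: "is_zbasis M w1 w2" "is_zbasis M e1 e2" and odd: "(m, m') \<in> odd_characteristics"
  obtains p1 p2 s1 s2 :: int and sg :: complex where "p1 \<in> {0, 1}" "p2 \<in> {0, 1}" "odd (p1 * s1 + p2 * s2)" "sg \<noteq> 0"
    "\<And>h :: real \<Rightarrow> complex. (\<Sum>\<^sub>\<infinity>(x1, x2)\<in>(UNIV :: (int \<times> int) set).
        (-1) powi \<lfloor>2 * (of_int x1 * fst m' + of_int x2 * snd m')\<rfloor> * h ((of_int x1 + fst m) * w1 + (of_int x2 + snd m) * w2))
     = sg * (\<Sum>\<^sub>\<infinity>k. (-1) powi (fst k * s1 + snd k * s2) * h ((of_int (fst k) + of_int p1 / 2) * e1 + (of_int (snd k) + of_int p2 / 2) * e2))"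
proof -
  have half: "\<exists>\<mu>::int. x = of_int \<mu> / 2" if "x \<in> {0, 1/2}" for x :: real
    using that by (auto intro: exI[of _ 0] exI[of _ 1])
  have "fst m \<in> {0, 1/2}" "snd m \<in> {0, 1/2}" "fst m' \<in> {0, 1/2}" "snd m' \<in> {0, 1/2}"
    using odd unfolding odd_characteristics_def by auto
  then obtain \<mu>1 \<mu>2 \<nu>1 \<nu>2 :: int where m: "fst m = of_int \<mu>1 / 2" "snd m = of_int \<mu>2 / 2" "fst m' = of_int \<nu>1 / 2" "snd m' = of_int \<nu>2 / 2"
    using half by metis
  obtain l :: int where l: "odd l" "4 * (fst m * fst m' + snd m * snd m') = of_int l"
    using odd unfolding odd_characteristics_def by auto
  have "real_of_int (\<mu>1 * \<nu>1 + \<mu>2 * \<nu>2) = of_int l" using l(2) by (simp add: m)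
  then have "\<mu>1 * \<nu>1 + \<mu>2 * \<nu>2 = l" by (simp only: of_int_eq_iff)
  then have odd\<mu>: "odd (\<mu>1 * \<nu>1 + \<mu>2 * \<nu>2)" using l(1) by simp
  obtain u11 u12 u21 u22 v11 v12 v21 v22 :: int where u:
    "w1 = of_int u11 * e1 + of_int u12 * e2" "w2 = of_int u21 * e1 + of_int u22 * e2"
    "u11 * v11 + u12 * v21 = 1" "u11 * v12 + u12 * v22 = 0" "u21 * v11 + u22 * v21 = 0" "u21 * v12 + u22 * v22 = 1"
    "v11 * u11 + v12 * u21 = 1" "v11 * u12 + v12 * u22 = 0" "v21 * u11 + v22 * u21 = 0" "v21 * u12 + v22 * u22 = 1"
    by (rule zbasis_transition[OF basis])
  \<comment> \<open>P/2 is the shift in the new coordinates. Its residues mod 2 form the new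
    characteristic; the integral part n moves into the summation index.\<close>
  define P1 P2 where "P1 = \<mu>1 * u11 + \<mu>2 * u21" and "P2 = \<mu>1 * u12 + \<mu>2 * u22"
  define p1 p2 n1 n2 where "p1 = P1 mod 2" and "p2 = P2 mod 2" and "n1 = P1 div 2" and "n2 = P2 div 2"
  define s1 s2 where "s1 = v11 * \<nu>1 + v12 * \<nu>2" and "s2 = v21 * \<nu>1 + v22 * \<nu>2"
  have P: "P1 = 2 * n1 + p1" "P2 = 2 * n2 + p2" by (simp_all add: p1_def p2_def n1_def n2_def)
  have pairing: "(x1 * u11 + x2 * u21) * s1 + (x1 * u12 + x2 * u22) * s2 = x1 * \<nu>1 + x2 * \<nu>2" for x1 x2
  proof -
    have "(x1 * u11 + x2 * u21) * s1 + (x1 * u12 + x2 * u22) * s2 =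
      x1 * ((u11 * v11 + u12 * v21) * \<nu>1 + (u11 * v12 + u12 * v22) * \<nu>2) + x2 * ((u21 * v11 + u22 * v21) * \<nu>1 + (u21 * v12 + u22 * v22) * \<nu>2)"
      by (simp add: s1_def s2_def algebra_simps)
    then show ?thesis by (simp add: u)
  qed
  have "odd (P1 * s1 + P2 * s2)" using pairing[of \<mu>1 \<mu>2] odd\<mu> by (simp add: P1_def P2_def)
  then have odd_ps: "odd (p1 * s1 + p2 * s2)" by (simp add: P)
  define G where "G = (\<lambda>(x1, x2). (x1 * u11 + x2 * u21 + n1, x1 * u12 + x2 * u22 + n2))"
  define G' where "G' = (\<lambda>(k1, k2). ((k1 - n1) * v11 + (k2 - n2) * v21, (k1 - n1) * v12 + (k2 - n2) * v22))"
  have GG: "G' (G x) = x" for x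
  proof -
    obtain x1 x2 where x: "x = (x1, x2)" by (cases x)
    have "(x1 * u11 + x2 * u21) * v11 + (x1 * u12 + x2 * u22) * v21 = x1 * (u11 * v11 + u12 * v21) + x2 * (u21 * v11 + u22 * v21)"
      "(x1 * u11 + x2 * u21) * v12 + (x1 * u12 + x2 * u22) * v22 = x1 * (u11 * v12 + u12 * v22) + x2 * (u21 * v12 + u22 * v22)"
      by (simp_all add: algebra_simps)
    then show ?thesis by (simp add: x G_def G'_def u)
  qed
  have GG': "G (G' k) = k" for k
  proof -
    obtain k1 k2 where k: "k = (k1, k2)" by (cases k)
    have "(a * v11 + b * v21) * u11 + (a * v12 + b * v22) * u21 = a * (v11 * u11 + v12 * u21) + b * (v21 * u11 + v22 * u21)"
      "(a * v11 + b * v21) * u12 + (a * v12 + b * v22) * u22 = a * (v11 * u12 + v12 * u22) + b * (v21 * u12 + v22 * u22)" for a b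
      by (simp_all add: algebra_simps)
    then show ?thesis by (simp add: k G_def G'_def u)
  qed
  have bij: "bij_betw G UNIV UNIV"
    by (rule bij_betw_byWitness[of _ G']) (auto simp: GG GG')
  \<comment> \<open>Shifting the index by n costs a constant sign.\<close>
  define sg :: complex where "sg = (-1) powi (- (n1 * s1 + n2 * s2))"
  have main: "(-1) powi \<lfloor>2 * (of_int x1 * fst m' + of_int x2 * snd m')\<rfloor> * h ((of_int x1 + fst m) * w1 + (of_int x2 + snd m) * w2)
     = sg * ((-1) powi (fst (G (x1, x2)) * s1 + snd (G (x1, x2)) * s2) *
       h ((of_int (fst (G (x1, x2))) + of_int p1 / 2) * e1 + (of_int (snd (G (x1, x2))) + of_int p2 / 2) * e2))" for x1 x2 and h :: "real \<Rightarrow> complex"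
  proof -
    have "2 * (of_int x1 * fst m' + of_int x2 * snd m') = real_of_int (x1 * \<nu>1 + x2 * \<nu>2)" by (simp add: m)
    then have fl: "\<lfloor>2 * (of_int x1 * fst m' + of_int x2 * snd m')\<rfloor> = x1 * \<nu>1 + x2 * \<nu>2" by (simp only: floor_of_int)
    have "x1 * \<nu>1 + x2 * \<nu>2 = - (n1 * s1 + n2 * s2) + (fst (G (x1, x2)) * s1 + snd (G (x1, x2)) * s2)"
      using pairing[of x1 x2] by (simp add: G_def algebra_simps)
    then have sign: "(-1 :: complex) powi (x1 * \<nu>1 + x2 * \<nu>2) = sg * (-1) powi (fst (G (x1, x2)) * s1 + snd (G (x1, x2)) * s2)"
      unfolding sg_def by (metis power_int_add one_neq_neg_one zero_neq_neg_one)
    have "2 * ((of_int x1 + fst m) * w1 + (of_int x2 + snd m) * w2) =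
       2 * of_int (x1 * u11 + x2 * u21) * e1 + of_int P1 * e1 + (2 * of_int (x1 * u12 + x2 * u22) * e2 + of_int P2 * e2)"
      by (simp add: m u(1,2) P1_def P2_def algebra_simps)
    also have "\<dots> = 2 * ((of_int (fst (G (x1, x2))) + of_int p1 / 2) * e1 + (of_int (snd (G (x1, x2))) + of_int p2 / 2) * e2)"
      unfolding P by (simp add: G_def algebra_simps)
    finally have arg: "(of_int x1 + fst m) * w1 + (of_int x2 + snd m) * w2 =
       (of_int (fst (G (x1, x2))) + of_int p1 / 2) * e1 + (of_int (snd (G (x1, x2))) + of_int p2 / 2) * e2" by simp
    show ?thesis unfolding fl sign arg by (simp only: mult.assoc)
  qed
  show thesis
  proof (rule that[of p1 p2 s1 s2 sg])
    show "p1 \<in> {0, 1}" "p2 \<in> {0, 1}" by (auto simp: p1_def p2_def)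
    show "odd (p1 * s1 + p2 * s2)" by fact
    show "sg \<noteq> 0" by (simp add: sg_def)
    fix h :: "real \<Rightarrow> complex"
    show "(\<Sum>\<^sub>\<infinity>(x1, x2)\<in>(UNIV :: (int \<times> int) set).
        (-1) powi \<lfloor>2 * (of_int x1 * fst m' + of_int x2 * snd m')\<rfloor> * h ((of_int x1 + fst m) * w1 + (of_int x2 + snd m) * w2))
     = sg * (\<Sum>\<^sub>\<infinity>k. (-1) powi (fst k * s1 + snd k * s2) * h ((of_int (fst k) + of_int p1 / 2) * e1 + (of_int (snd k) + of_int p2 / 2) * e2))"
      unfolding main infsum_cmult_right'[symmetric]
      by (subst infsum_reindex_bij_betw[OF bij, symmetric]) (simp add: case_prod_unfold)
  qed
qed

subsection \<open>Arithmetic of the diagonal basis\<close>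

locale diagonal_basis = real_quadratic +
  fixes I :: "real set" and \<eta>1 \<eta>2 \<alpha> :: real and a b c :: int
  assumes I_subset: "I \<subseteq> quad_field D"
    and basis: "is_zbasis I \<eta>1 \<eta>2" and \<eta>_pos: "\<eta>2 > \<eta>1" "\<eta>1 > 0"
    and diagonal: "qtr D (\<alpha> * \<eta>1 * \<eta>2) = 0"
    and positive: "qtr D (\<alpha> * \<eta>1\<^sup>2) > 0"
    and form: "of_int a * (\<eta>2 / \<eta>1)\<^sup>2 + of_int b * (\<eta>2 / \<eta>1) + of_int c = 0"
    and ac: "a > 0" "c < 0" and gcd: "Gcd {a, b, c} = 1" and disc: "b\<^sup>2 - 4 * a * c = D"
    and primitive: "primitive_in (trace_dual D (ideal_mult I I)) \<alpha>"
begin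

definition "\<xi> = \<eta>2 / \<eta>1"
definition "h1 = \<sigma> \<eta>1"
definition "h2 = \<sigma> \<eta>2"
abbreviation "I2 \<equiv> ideal_mult I I"
abbreviation "M \<equiv> trace_dual D I2"

lemma \<eta>_K [simp, intro]: "\<eta>1 \<in> K" "\<eta>2 \<in> K"
  using zbasis_mem[OF basis] I_subset by auto

lemma \<alpha>_M: "\<alpha> \<in> M" using primitive by (simp add: primitive_in_def)
lemma \<alpha>_K [simp, intro]: "\<alpha> \<in> K" using \<alpha>_M by (simp add: trace_dual_def)
lemma h_K [simp, intro]: "h1 \<in> K" "h2 \<in> K" by (auto simp: h1_def h2_def)
lemma \<xi>_K [simp, intro]: "\<xi> \<in> K" by (auto simp: \<xi>_def)
lemma h1_nz: "h1 \<noteq> 0" using \<eta>_pos by (simp add: h1_def)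
lemma h2_nz: "h2 \<noteq> 0" using \<eta>_pos by (simp add: h2_def)
lemma \<sigma>\<xi>: "\<sigma> \<xi> = h2 / h1" by (simp add: \<xi>_def h1_def h2_def)

lemma \<xi>_irrational: "\<xi> \<notin> \<rat>"
proof
  assume "\<xi> \<in> \<rat>"
  have "(2 * of_int a * \<xi> + of_int b)\<^sup>2 = 4 * of_int a * (of_int a * \<xi>\<^sup>2 + of_int b * \<xi> + of_int c) + of_int (b\<^sup>2 - 4 * a * c)"
    by (simp add: power2_eq_square algebra_simps)
  then have "(2 * of_int a * \<xi> + of_int b)\<^sup>2 = of_int D" using form disc by (simp add: \<xi>_def)
  then have "\<bar>2 * of_int a * \<xi> + of_int b\<bar> = rD" by (metis real_sqrt_abs)
  moreover have "\<bar>2 * of_int a * \<xi> + of_int b\<bar> \<in> \<rat>" using \<open>\<xi> \<in> \<rat>\<close> by (simp add: abs_if)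
  ultimately show False using sqrt_D_irrational by simp
qed

text \<open>Vieta: \<xi> is irrational, so its conjugate is the other root of the form.\<close>

lemma \<xi>_conj: "\<xi> * \<sigma> \<xi> = of_int c / of_int a"
proof -
  have 1: "of_int a * \<xi>\<^sup>2 + of_int b * \<xi> + of_int c = 0" using form by (simp add: \<xi>_def)
  have "\<sigma> (of_int a * \<xi>\<^sup>2 + of_int b * \<xi> + of_int c) = of_int a * (\<sigma> \<xi>)\<^sup>2 + of_int b * \<sigma> \<xi> + of_int c"
    by simp
  then have 2: "of_int a * (\<sigma> \<xi>)\<^sup>2 + of_int b * \<sigma> \<xi> + of_int c = 0" unfolding 1 by simp
  have "(\<xi> - \<sigma> \<xi>) * (of_int a * (\<xi> + \<sigma> \<xi>) + of_int b) = 0"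
    using 1 2 by (simp add: power2_eq_square algebra_simps)
  moreover have "\<xi> - \<sigma> \<xi> \<noteq> 0" using \<xi>_irrational qconj_eq_self_iff[of \<xi>] by auto
  ultimately have b: "of_int b = - (of_int a * (\<xi> + \<sigma> \<xi>))" by (simp add: add_eq_0_iff2)
  have "of_int c = - of_int a * \<xi>\<^sup>2 - of_int b * \<xi>" using 1 by linarith
  also have "\<dots> = of_int a * (\<xi> * \<sigma> \<xi>)" unfolding b by (simp add: power2_eq_square algebra_simps)
  finally have "of_int c = of_int a * (\<xi> * \<sigma> \<xi>)" .
  then show ?thesis using ac by simp
qed

lemma \<xi>_pos: "\<xi> > 0" using \<eta>_pos by (simp add: \<xi>_def)

lemma \<sigma>\<xi>_neg: "\<sigma> \<xi> < 0"
proof -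
  have "\<xi> * \<sigma> \<xi> < 0" using \<xi>_conj ac by (simp add: divide_neg_pos)
  then show ?thesis using \<xi>_pos by (simp add: mult_less_0_iff)
qed

lemma h12_neg: "h1 * h2 < 0"
proof -
  have "h1 * h2 = h1\<^sup>2 * \<sigma> \<xi>" using h1_nz by (simp add: \<sigma>\<xi> power2_eq_square)
  then show ?thesis using \<sigma>\<xi>_neg h1_nz by (simp add: mult_pos_neg)
qed

lemma \<eta>12_nz: "\<eta>1 * \<eta>2 \<noteq> 0" using \<eta>_pos by simp
lemma \<sigma>\<eta>12: "\<sigma> (\<eta>1 * \<eta>2) = h1 * h2" by (simp add: h1_def h2_def)

lemma h_ne: "h1 - h2 \<noteq> 0" "h1 + h2 \<noteq> 0"
proof -
  have "\<sigma> \<xi> \<notin> \<rat>" using \<xi>_irrational qconj_Rats by fastforce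
  then have "h2 / h1 \<noteq> 1" "h2 / h1 \<noteq> - 1" by (auto simp: \<sigma>\<xi>[symmetric])
  then show "h1 - h2 \<noteq> 0" "h1 + h2 \<noteq> 0" using h1_nz by (auto simp: field_simps add_eq_0_iff)
qed

lemma \<alpha>_diag: "\<alpha> * \<eta>1 * \<eta>2 + \<sigma> \<alpha> * h1 * h2 = 0"
  using diagonal by (simp add: qtr_def h1_def h2_def)

text \<open>Diagonality equates \<alpha> \<eta>1 \<eta>2 with -\<sigma>(\<alpha>) h1 h2, where h1 h2
  < 0. So \<alpha> and its conjugate have the same sign, and positivity of the form decides
  which.\<close>

lemma \<alpha>_pos: "\<alpha> > 0"
proof (rule ccontr)
  assume "\<not> \<alpha> > 0"
  then have "\<alpha> \<le> 0" by simp
  then have 1: "\<alpha> * \<eta>1 * \<eta>2 \<le> 0" using \<eta>_pos by (simp add: mult_nonpos_nonneg)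
  then have "\<sigma> \<alpha> * (h1 * h2) \<ge> 0" using \<alpha>_diag by (simp add: mult.assoc)
  then have "\<sigma> \<alpha> \<le> 0" using h12_neg by (smt (verit) mult_pos_neg)
  then have "\<alpha> * \<eta>1\<^sup>2 + \<sigma> \<alpha> * h1\<^sup>2 \<le> 0" using \<open>\<alpha> \<le> 0\<close>
    by (intro add_nonpos_nonpos mult_nonpos_nonneg) auto
  then show False using positive by (simp add: qtr_def h1_def)
qed

lemma \<sigma>\<alpha>_pos: "\<sigma> \<alpha> > 0"
proof -
  have "\<alpha> * \<eta>1 * \<eta>2 > 0" using \<alpha>_pos \<eta>_pos by simp
  then have "\<sigma> \<alpha> * (h1 * h2) < 0" using \<alpha>_diag by (simp add: mult.assoc)
  then show ?thesis using h12_neg by (simp add: mult_less_0_iff)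
qed

lemma Tr_\<eta>2_pos: "Tr (\<alpha> * \<eta>2\<^sup>2) > 0"
  using \<alpha>_pos \<sigma>\<alpha>_pos \<eta>_pos h2_nz by (simp add: qtr_def h2_def[symmetric] add_pos_nonneg)

lemma I2_eq: "I2 = {of_int i * \<eta>1\<^sup>2 + of_int j * (\<eta>1 * \<eta>2) + of_int k * \<eta>2\<^sup>2 | i j k. True}" (is "_ = ?S")
proof
  have add: "x + y \<in> ?S" if "x \<in> ?S" "y \<in> ?S" for x y
  proof -
    from that obtain i j k i' j' k' where "x = of_int i * \<eta>1\<^sup>2 + of_int j * (\<eta>1 * \<eta>2) + of_int k * \<eta>2\<^sup>2"
      "y = of_int i' * \<eta>1\<^sup>2 + of_int j' * (\<eta>1 * \<eta>2) + of_int k' * \<eta>2\<^sup>2" by blast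
    then have "x + y = of_int (i + i') * \<eta>1\<^sup>2 + of_int (j + j') * (\<eta>1 * \<eta>2) + of_int (k + k') * \<eta>2\<^sup>2"
      by (simp add: algebra_simps)
    then show ?thesis by blast
  qed
  have prod: "x * y \<in> ?S" if xI: "x \<in> I" and yI: "y \<in> I" for x y
  proof -
    obtain i j where x: "x = of_int i * \<eta>1 + of_int j * \<eta>2" by (rule zbasis_coords[OF basis xI])
    obtain k l where y: "y = of_int k * \<eta>1 + of_int l * \<eta>2" by (rule zbasis_coords[OF basis yI])
    have "x * y = of_int (i * k) * \<eta>1\<^sup>2 + of_int (i * l + j * k) * (\<eta>1 * \<eta>2) + of_int (j * l) * \<eta>2\<^sup>2"
      by (simp add: x y power2_eq_square algebra_simps)
    then show ?thesis by blast
  qed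
  show "I2 \<subseteq> ?S"
  proof
    fix x assume "x \<in> I2"
    then obtain n :: nat and f h where x: "x = (\<Sum>i<n. f i * h i)" and fh: "\<And>i. i < n \<Longrightarrow> f i \<in> I \<and> h i \<in> I"
      unfolding ideal_mult_def by blast
    have "0 = of_int 0 * \<eta>1\<^sup>2 + of_int 0 * (\<eta>1 * \<eta>2) + of_int 0 * \<eta>2\<^sup>2" by simp
    then have zero: "0 \<in> ?S" by blast
    have "(\<Sum>i<k. f i * h i) \<in> ?S" if "k \<le> n" for k
      using that
    proof (induction k)
      case (Suc k)
      then show ?case using add[of "\<Sum>i<k. f i * h i" "f k * h k"] prod[of "f k" "h k"] fh[of k] by simp
    qed (use zero in simp)
    then show "x \<in> ?S" by (simp add: x)
  qed
  show "?S \<subseteq> I2"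
  proof
    fix x assume "x \<in> ?S"
    then obtain i j k :: int where x: "x = of_int i * \<eta>1\<^sup>2 + of_int j * (\<eta>1 * \<eta>2) + of_int k * \<eta>2\<^sup>2" by blast
    have mem: "of_int i * \<eta>1 + of_int j * \<eta>2 \<in> I" for i j
      using basis unfolding is_zbasis_def by blast
    have "of_int i * \<eta>1 + of_int j * \<eta>2 \<in> I" "of_int k * \<eta>2 \<in> I" using mem[of i j] mem[of 0 k] by simp_all
    moreover define f h where "f l = (if l = 0 then of_int i * \<eta>1 + of_int j * \<eta>2 else of_int k * \<eta>2)"
      and "h l = (if l = 0 then \<eta>1 else \<eta>2)" for l :: nat
    ultimately have "x = (\<Sum>l<2. f l * h l) \<and> (\<forall>l<2. f l \<in> I \<and> h l \<in> I)"
      using zbasis_mem[OF basis] by (simp add: x power2_eq_square algebra_simps numeral_2_eq_2)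
    then show "x \<in> I2" unfolding ideal_mult_def by (intro CollectI exI[of _ 2] exI[of _ f] exI[of _ h])
  qed
qed

lemma I2_mem: "\<eta>1\<^sup>2 \<in> I2" "\<eta>1 * \<eta>2 \<in> I2" "\<eta>2\<^sup>2 \<in> I2"
proof -
  have "\<eta>1\<^sup>2 = of_int 1 * \<eta>1\<^sup>2 + of_int 0 * (\<eta>1 * \<eta>2) + of_int 0 * \<eta>2\<^sup>2"
    "\<eta>1 * \<eta>2 = of_int 0 * \<eta>1\<^sup>2 + of_int 1 * (\<eta>1 * \<eta>2) + of_int 0 * \<eta>2\<^sup>2"
    "\<eta>2\<^sup>2 = of_int 0 * \<eta>1\<^sup>2 + of_int 0 * (\<eta>1 * \<eta>2) + of_int 1 * \<eta>2\<^sup>2" by simp_all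
  then show "\<eta>1\<^sup>2 \<in> I2" "\<eta>1 * \<eta>2 \<in> I2" "\<eta>2\<^sup>2 \<in> I2" unfolding I2_eq by blast+
qed

lemma I2_K: "\<nu> \<in> I2 \<Longrightarrow> \<nu> \<in> K"
  unfolding I2_eq by (auto intro!: K_add K_mult)

lemma M_Tr: "x \<in> M \<Longrightarrow> \<nu> \<in> I2 \<Longrightarrow> Tr (x * \<nu>) \<in> \<int>"
  unfolding trace_dual_def by blast

lemma M_K: "x \<in> M \<Longrightarrow> x \<in> K"
  unfolding trace_dual_def by blast

lemma qtr_add: "x \<in> K \<Longrightarrow> y \<in> K \<Longrightarrow> Tr (x + y) = Tr x + Tr y"
  by (simp add: qtr_def)
lemma qtr_rat_mult: "r \<in> \<rat> \<Longrightarrow> x \<in> K \<Longrightarrow> Tr (r * x) = r * Tr x"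
  using Rats_K[of r] qconj_Rats[of r] by (simp add: qtr_def distrib_left)

text \<open>Otherwise x/y would be fixed by \<sigma>, hence rational, and the trace of \<alpha> x
  would vanish together with that of \<alpha> y.\<close>

lemma conj_independent_of_traces:
  assumes x: "x \<in> K" "y \<in> K" "y \<noteq> 0" and tr: "Tr (\<alpha> * x) \<noteq> 0" "Tr (\<alpha> * y) = 0"
  shows "\<sigma> x * y - x * \<sigma> y \<noteq> 0"
proof
  assume eq: "\<sigma> x * y - x * \<sigma> y = 0"
  have y0: "\<sigma> \<alpha> * \<sigma> y = - (\<alpha> * y)" using tr(2) x by (simp add: qtr_def add_eq_0_iff)
  have "Tr (\<alpha> * x) * y = \<alpha> * x * y + \<sigma> \<alpha> * (\<sigma> x * y)" using x by (simp add: qtr_def algebra_simps)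
  also have "\<dots> = \<alpha> * x * y + x * (\<sigma> \<alpha> * \<sigma> y)" using eq by simp
  also have "\<dots> = 0" by (simp add: y0)
  finally show False using tr(1) x(3) by simp
qed

section \<open>Integral bases of the square of the ideal and of its dual\<close>

abbreviation "g \<equiv> gcd a c"

lemma g_pos: "g > 0" using ac by simp

text \<open>Three generators with one relation, whose coefficients a, b, c are coprime, generate a
  lattice of rank 2. Modulo \<eta>1 \<eta>2 the relation is divisible exactly by g, whence \<eta>1
  \<eta>2 is g times a basis vector.\<close>

lemma I2_zbasis:
  obtains x y where "x \<in> I2" "y \<in> I2" "\<And>z. z \<in> I2 \<Longrightarrow> \<exists>i j::int. z = of_int i * x + of_int j * y"
    "of_int g * y = \<eta>1 * \<eta>2"
proof -
  define a' c' where "a' = a div g" and "c' = c div g"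
  have a': "a = g * a'" and c': "c = g * c'" by (simp_all add: a'_def c'_def)
  have "coprime a' c'" unfolding a'_def c'_def using ac by (intro div_gcd_coprime) auto
  then obtain p r0 where "a' * p + c' * r0 = 1" by (metis bezout_int coprime_imp_gcd_eq_1 mult.commute)
  then obtain r where pr: "a' * p - c' * r = 1" by (intro that[of "- r0"]) simp
  have "gcd b g = 1" using gcd by (simp add: gcd.left_commute gcd.commute gcd.assoc)
  then obtain u v where uv: "u * b + v * g = 1" by (metis bezout_int)
  \<comment> \<open>The Bezout coefficients p, r give a system of determinant 1 expressing \<eta>1^2
    and \<eta>2^2 through x and b y.\<close>
  define x where "x = of_int p * \<eta>1\<^sup>2 + of_int r * \<eta>2\<^sup>2"
  \<comment> \<open>Multiplied by g, the squares combine by the relation to u b \<eta>1 \<eta>2, and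
    u b + v g = 1 leaves \<eta>1 \<eta>2.\<close>
  define y where "y = of_int (- u * c') * \<eta>1\<^sup>2 + of_int v * (\<eta>1 * \<eta>2) + of_int (- u * a') * \<eta>2\<^sup>2"
  have "x = of_int p * \<eta>1\<^sup>2 + of_int 0 * (\<eta>1 * \<eta>2) + of_int r * \<eta>2\<^sup>2" by (simp add: x_def)
  then have xI: "x \<in> I2" unfolding I2_eq by blast
  have yI: "y \<in> I2" unfolding I2_eq y_def by blast
  have F: "of_int a * \<eta>2\<^sup>2 + of_int b * (\<eta>1 * \<eta>2) + of_int c * \<eta>1\<^sup>2 = 0"
  proof -
    have "of_int a * \<eta>2\<^sup>2 + of_int b * (\<eta>1 * \<eta>2) + of_int c * \<eta>1\<^sup>2
      = \<eta>1\<^sup>2 * (of_int a * (\<eta>2 / \<eta>1)\<^sup>2 + of_int b * (\<eta>2 / \<eta>1) + of_int c)"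
      using \<eta>_pos by (simp add: power2_eq_square field_simps)
    also have "\<dots> = 0" unfolding form by simp
    finally show ?thesis .
  qed
  have gy: "of_int g * y = \<eta>1 * \<eta>2"
  proof -
    have "of_int g * y = of_int (v * g) * (\<eta>1 * \<eta>2) - of_int u * (of_int (g * a') * \<eta>2\<^sup>2 + of_int (g * c') * \<eta>1\<^sup>2)"
      by (simp add: y_def algebra_simps)
    also have "of_int (g * a') * \<eta>2\<^sup>2 + of_int (g * c') * \<eta>1\<^sup>2 = - (of_int b * (\<eta>1 * \<eta>2))"
      using F unfolding a'[symmetric] c'[symmetric] by linarith
    also have "of_int (v * g) * (\<eta>1 * \<eta>2) - of_int u * - (of_int b * (\<eta>1 * \<eta>2)) = of_int (u * b + v * g) * (\<eta>1 * \<eta>2)"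
      by (simp add: algebra_simps)
    finally show ?thesis by (simp add: uv)
  qed
  have by': "of_int b * y = - (of_int a' * \<eta>2\<^sup>2 + of_int c' * \<eta>1\<^sup>2)"
  proof -
    have "of_int g * (of_int b * y) = of_int b * (of_int g * y)" by simp
    also have "\<dots> = - (of_int a * \<eta>2\<^sup>2 + of_int c * \<eta>1\<^sup>2)" unfolding gy using F by linarith
    also have "\<dots> = of_int g * - (of_int a' * \<eta>2\<^sup>2 + of_int c' * \<eta>1\<^sup>2)"
      by (subst a', subst c') (simp add: algebra_simps)
    finally show ?thesis using ac by (simp only: mult_cancel_left) simp
  qed
  have prR: "of_int a' * of_int p - of_int c' * of_int r = (1::real)"
    using arg_cong[OF pr, of real_of_int] by simp
  have e1: "\<eta>1\<^sup>2 = of_int a' * x + of_int (r * b) * y"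
  proof -
    have "of_int a' * x + of_int (r * b) * y = of_int a' * x + of_int r * (of_int b * y)" by simp
    also have "\<dots> = (of_int a' * of_int p - of_int c' * of_int r) * \<eta>1\<^sup>2"
      unfolding by' x_def by (simp add: algebra_simps)
    finally show ?thesis by (simp add: prR)
  qed
  have e2: "\<eta>2\<^sup>2 = of_int (- c') * x + of_int (- p * b) * y"
  proof -
    have "of_int (- c') * x + of_int (- p * b) * y = - of_int c' * x - of_int p * (of_int b * y)" by simp
    also have "\<dots> = (of_int a' * of_int p - of_int c' * of_int r) * \<eta>2\<^sup>2"
      unfolding by' x_def by (simp add: algebra_simps)
    finally show ?thesis by (simp add: prR)
  qed
  have "\<exists>i j::int. z = of_int i * x + of_int j * y" if z: "z \<in> I2" for z
  proof -
    from z obtain i j k :: int where "z = of_int i * \<eta>1\<^sup>2 + of_int j * (\<eta>1 * \<eta>2) + of_int k * \<eta>2\<^sup>2" unfolding I2_eq by blast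
    then have "z = of_int (i * a' - k * c') * x + of_int (i * (r * b) + j * g - k * (p * b)) * y"
      unfolding e1 e2 gy[symmetric] by (simp add: algebra_simps)
    then show ?thesis by blast
  qed
  then show thesis using that[OF xI yI _ gy] by blast
qed

text \<open>Pairing with \<alpha> kills y, so its values on the lattice are the multiples of the
  trace of \<alpha> x. Primitivity of \<alpha> forces this trace to be a unit.\<close>

lemma Tr_alpha_dual_vector:
  obtains x y where "x \<in> I2" "y \<in> I2" "\<And>z. z \<in> I2 \<Longrightarrow> \<exists>i j::int. z = of_int i * x + of_int j * y"
    "of_int g * y = \<eta>1 * \<eta>2" "Tr (\<alpha> * x) \<in> {1, -1}" "Tr (\<alpha> * y) = 0"
proof -
  obtain x y where xy: "x \<in> I2" "y \<in> I2" "\<And>z. z \<in> I2 \<Longrightarrow> \<exists>i j::int. z = of_int i * x + of_int j * y"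
    "of_int g * y = \<eta>1 * \<eta>2" by (rule I2_zbasis) blast
  have K: "x \<in> K" "y \<in> K" using xy I2_K by auto
  have "of_int g * Tr (\<alpha> * y) = Tr (\<alpha> * (of_int g * y))"
    using K qtr_rat_mult[of "of_int g" "\<alpha> * y"] by (simp add: mult.left_commute)
  then have Ty: "Tr (\<alpha> * y) = 0" using diagonal ac by (simp add: xy(4) mult.assoc)
  obtain t :: int where t: "Tr (\<alpha> * x) = of_int t" using M_Tr[OF \<alpha>_M xy(1)] by (auto elim: Ints_cases)
  have Tz: "Tr (\<alpha> * (of_int i * x + of_int j * y)) = of_int (i * t)" for i j :: int
  proof -
    have "\<alpha> * (of_int i * x + of_int j * y) = of_int i * (\<alpha> * x) + of_int j * (\<alpha> * y)" by (simp add: algebra_simps)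
    moreover have "Tr (of_int i * (\<alpha> * x) + of_int j * (\<alpha> * y)) = of_int i * Tr (\<alpha> * x) + of_int j * Tr (\<alpha> * y)"
      using K qtr_rat_mult[of "of_int i" "\<alpha> * x"] qtr_rat_mult[of "of_int j" "\<alpha> * y"] by (simp add: qtr_add)
    ultimately show ?thesis by (simp add: Ty t)
  qed
  have "t \<noteq> 0"
  proof
    assume "t = 0"
    obtain i j where "\<eta>1\<^sup>2 = of_int i * x + of_int j * y" using xy(3)[OF I2_mem(1)] by blast
    then show False using Tz[of i j] positive \<open>t = 0\<close> by simp
  qed
  have "\<not> nat \<bar>t\<bar> \<ge> 2"
  proof
    assume 2: "nat \<bar>t\<bar> \<ge> 2"
    \<comment> \<open>Every value of the pairing is divisible by t, so \<alpha>/|t| would still lie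
      in the dual lattice.\<close>
    have "\<alpha> / of_nat (nat \<bar>t\<bar>) \<in> M"
      unfolding trace_dual_def
    proof (intro CollectI conjI ballI)
      show "\<alpha> / of_nat (nat \<bar>t\<bar>) \<in> K" by (intro K_divide \<alpha>_K K_of_nat)
      fix z assume "z \<in> I2"
      then obtain i j where z: "z = of_int i * x + of_int j * y" using xy(3) by blast
      have zK: "z \<in> K" using K by (simp add: z)
      have "\<alpha> / of_nat (nat \<bar>t\<bar>) * z = inverse (of_int \<bar>t\<bar>) * (\<alpha> * z)" by (simp add: field_simps)
      then have "Tr (\<alpha> / of_nat (nat \<bar>t\<bar>) * z) = inverse (of_int \<bar>t\<bar>) * Tr (\<alpha> * z)"
        using qtr_rat_mult[of "inverse (of_int \<bar>t\<bar>)" "\<alpha> * z"] zK by simp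
      also have "\<dots> = of_int (i * sgn t)"
        unfolding z Tz using \<open>t \<noteq> 0\<close> by (simp add: sgn_if abs_if)
      finally show "Tr (\<alpha> / of_nat (nat \<bar>t\<bar>) * z) \<in> \<int>" by (simp only: Ints_of_int)
    qed
    then show False using primitive 2 unfolding primitive_in_def by blast
  qed
  then have "t \<in> {1, -1}" using \<open>t \<noteq> 0\<close> by auto
  then have "Tr (\<alpha> * x) \<in> {1, -1}" by (auto simp: t)
  then show thesis using that[OF xy] Ty by blast
qed

text \<open>Up to the sign of \<alpha>, the basis is the trace dual of x, y. Its covolume expresses
  the norm of the dual lattice through g and h1 h2.\<close>

lemma M_zbasis_det:
  obtains \<beta> where "is_zbasis M \<alpha> \<beta>" "\<bar>\<alpha> * \<sigma> \<beta> - \<sigma> \<alpha> * \<beta>\<bar> = \<alpha> * of_int g / (- (h1 * h2))"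
proof -
  obtain x y where xy: "x \<in> I2" "y \<in> I2" "\<And>z. z \<in> I2 \<Longrightarrow> \<exists>i j::int. z = of_int i * x + of_int j * y"
    "of_int g * y = \<eta>1 * \<eta>2" "Tr (\<alpha> * x) \<in> {1, -1}" "Tr (\<alpha> * y) = 0"
    by (rule Tr_alpha_dual_vector) blast
  have K: "x \<in> K" "y \<in> K" using xy I2_K by auto
  have y0: "y \<noteq> 0" using xy(4) \<eta>12_nz by auto
  define t where "t = Tr (\<alpha> * x)"
  have t: "t \<in> {1, -1}" "t * t = 1" "t \<in> \<int>" using xy(5) by (auto simp: t_def)
  define \<theta> where "\<theta> = \<sigma> x * y - x * \<sigma> y"
  have \<theta>: "\<theta> \<noteq> 0" unfolding \<theta>_def using K y0 xy(5,6) by (intro conj_independent_of_traces) auto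
  have \<theta>K: "\<theta> \<in> K" "\<sigma> \<theta> = - \<theta>" using K by (auto simp: \<theta>_def)
  \<comment> \<open>Cramer's rule: as \<sigma>(\<theta>) = -\<theta>, the trace of \<beta> v is
    (\<sigma>(x) v - x \<sigma>(v))/\<theta>, which is 0 at x and 1 at y.\<close>
  define \<beta> where "\<beta> = \<sigma> x / \<theta>"
  have \<beta>K: "\<beta> \<in> K" "\<sigma> \<beta> = - (x / \<theta>)" using K \<theta>K by (auto simp: \<beta>_def)
  have T\<beta>: "Tr (\<beta> * x) = 0" "Tr (\<beta> * y) = 1"
  proof -
    have T: "Tr (\<beta> * v) = \<sigma> x / \<theta> * v - x / \<theta> * \<sigma> v" if "v \<in> K" for v
    proof -
      have "Tr (\<beta> * v) = \<beta> * v + \<sigma> \<beta> * \<sigma> v" using that \<beta>K(1) by (simp add: qtr_def)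
      then show ?thesis unfolding \<beta>K(2) by (simp add: \<beta>_def)
    qed
    show "Tr (\<beta> * x) = 0" unfolding T[OF K(1)] by simp
    have "Tr (\<beta> * y) = (\<sigma> x * y - x * \<sigma> y) / \<theta>" unfolding T[OF K(2)] by (simp add: diff_divide_distrib)
    then show "Tr (\<beta> * y) = 1" using \<theta> by (simp add: \<theta>_def)
  qed
  have Tlin: "Tr (z * (of_int i * x + of_int j * y)) = of_int i * Tr (z * x) + of_int j * Tr (z * y)" if "z \<in> K" for z i j
    using that K by (simp add: qtr_def algebra_simps)
  have \<beta>M: "\<beta> \<in> M"
    unfolding trace_dual_def
  proof (intro CollectI conjI ballI \<beta>K)
    fix z assume "z \<in> I2"
    then obtain i j where z: "z = of_int i * x + of_int j * y" using xy(3) by blast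
    show "Tr (\<beta> * z) \<in> \<int>" unfolding z Tlin[OF \<beta>K(1)] by (simp add: T\<beta>)
  qed
  have inj: "z = 0" if "z \<in> K" "Tr (z * x) = 0" "Tr (z * y) = 0" for z
  proof -
    have zy: "z * y = - (\<sigma> z * \<sigma> y)" and zx: "z * x = - (\<sigma> z * \<sigma> x)"
      using that K by (simp_all add: qtr_def add_eq_0_iff2)
    have "z * \<theta> = z * y * \<sigma> x - z * x * \<sigma> y" by (simp add: \<theta>_def algebra_simps)
    also have "\<dots> = 0" unfolding zy zx by simp
    finally show ?thesis using \<theta> by simp
  qed
  have span: "z = of_int m * \<alpha> + of_int n * \<beta>" if "z \<in> M" "Tr (z * x) = of_int m * t" "Tr (z * y) = of_int n" for z m n
  proof -
    have zK: "z \<in> K" using M_K[OF that(1)] .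
    have "z - (of_int m * \<alpha> + of_int n * \<beta>) = 0"
    proof (rule inj)
      have e: "Tr ((z - (of_int m * \<alpha> + of_int n * \<beta>)) * v) = Tr (z * v) - of_int m * Tr (\<alpha> * v) - of_int n * Tr (\<beta> * v)" if "v \<in> K" for v
        using that zK \<beta>K(1) by (simp add: qtr_def algebra_simps)
      show "Tr ((z - (of_int m * \<alpha> + of_int n * \<beta>)) * x) = 0" unfolding e[OF K(1)] using that by (simp add: T\<beta> t_def)
      show "Tr ((z - (of_int m * \<alpha> + of_int n * \<beta>)) * y) = 0" unfolding e[OF K(2)] using that by (simp add: T\<beta> xy(6))
    qed (use zK \<beta>K in auto)
    then show ?thesis by simp
  qed
  have "is_zbasis M \<alpha> \<beta>"
    unfolding is_zbasis_def
  proof (intro conjI allI impI equalityI subsetI)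
    fix z assume z: "z \<in> M"
    obtain m' :: int where m': "Tr (z * x) = of_int m'" using M_Tr[OF z xy(1)] by (auto elim: Ints_cases)
    obtain n :: int where n: "Tr (z * y) = of_int n" using M_Tr[OF z xy(2)] by (auto elim: Ints_cases)
    obtain t' :: int where t': "t = of_int t'" using t(3) by (auto elim: Ints_cases)
    have "Tr (z * x) = of_int (m' * t') * t" using m' t(2) by (simp add: t')
    from span[OF z this n] show "z \<in> {of_int m * \<alpha> + of_int n * \<beta> |m n. True}" by blast
  next
    fix z assume "z \<in> {of_int m * \<alpha> + of_int n * \<beta> |(m::int) (n::int). True}"
    then obtain m n :: int where z: "z = of_int m * \<alpha> + of_int n * \<beta>" by blast
    show "z \<in> M" unfolding trace_dual_def
    proof (intro CollectI conjI ballI)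
      show "z \<in> K" using \<beta>K by (auto simp: z)
      fix \<nu> assume \<nu>: "\<nu> \<in> I2"
      have "Tr (z * \<nu>) = of_int m * Tr (\<alpha> * \<nu>) + of_int n * Tr (\<beta> * \<nu>)"
        using I2_K[OF \<nu>] \<beta>K(1) by (simp add: z qtr_def algebra_simps)
      then show "Tr (z * \<nu>) \<in> \<int>" using M_Tr[OF \<alpha>_M \<nu>] M_Tr[OF \<beta>M \<nu>] by simp
    qed
  next
    fix m n :: int assume 0: "of_int m * \<alpha> + of_int n * \<beta> = 0"
    have e: "Tr ((of_int m * \<alpha> + of_int n * \<beta>) * v) = of_int m * Tr (\<alpha> * v) + of_int n * Tr (\<beta> * v)" if "v \<in> K" for v
      using that \<beta>K(1) by (simp add: qtr_def algebra_simps)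
    have "Tr 0 = 0" by (simp add: qtr_def)
    then show "m = 0" "n = 0" using e[OF K(1)] e[OF K(2)] t(1) by (auto simp: 0 T\<beta> xy(6) t_def[symmetric])
  qed
  moreover have "\<bar>\<alpha> * \<sigma> \<beta> - \<sigma> \<alpha> * \<beta>\<bar> = \<alpha> * of_int g / (- (h1 * h2))"
  proof -
    have "\<alpha> * \<sigma> \<beta> - \<sigma> \<alpha> * \<beta> = \<alpha> * - (x / \<theta>) - \<sigma> \<alpha> * \<beta>" by (simp only: \<beta>K(2))
    also have "\<dots> = - Tr (\<alpha> * x) / \<theta>" using K \<theta> by (simp add: \<beta>_def qtr_def field_simps)
    finally have "\<alpha> * \<sigma> \<beta> - \<sigma> \<alpha> * \<beta> = - Tr (\<alpha> * x) / \<theta>" .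
    \<comment> \<open>Orthogonality of \<alpha> and y turns \<theta> into a multiple of \<sigma>(y)
      = h1 h2 / g; this is where g enters the covolume.\<close>
    moreover have "\<theta> = - t * \<sigma> y / \<alpha>"
    proof -
      have yy: "\<sigma> \<alpha> * \<sigma> y = - (\<alpha> * y)" using xy(6) K by (simp add: qtr_def add_eq_0_iff)
      have "t * \<sigma> y = \<alpha> * x * \<sigma> y + \<sigma> x * (\<sigma> \<alpha> * \<sigma> y)" using K by (simp add: t_def qtr_def algebra_simps)
      also have "\<dots> = - \<alpha> * \<theta>" unfolding yy by (simp add: \<theta>_def algebra_simps)
      finally show ?thesis using \<alpha>_pos by (simp add: field_simps)
    qed
    moreover have \<sigma>y: "\<sigma> y = h1 * h2 / of_int g"
    proof -
      have "\<sigma> (of_int g * y) = h1 * h2" unfolding xy(4) by (rule \<sigma>\<eta>12)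
      then show ?thesis using K g_pos by (simp add: field_simps)
    qed
    ultimately have "\<alpha> * \<sigma> \<beta> - \<sigma> \<alpha> * \<beta> = \<alpha> * of_int g / (h1 * h2)"
      using t h1_nz h2_nz \<alpha>_pos ac by (auto simp: t_def[symmetric] field_simps)
    moreover have "\<alpha> * of_int g / (h1 * h2) < 0"
      using \<alpha>_pos g_pos h12_neg ac by (intro divide_pos_neg mult_pos_pos) auto
    ultimately show ?thesis by (simp only: abs_of_neg minus_divide_right)
  qed
  ultimately show thesis by (rule that)
qed

lemma M_det:
  assumes "is_zbasis M x y"
  shows "\<bar>x * \<sigma> y - \<sigma> x * y\<bar> = \<alpha> * of_int g / (- (h1 * h2))"
proof -
  obtain \<beta> where \<beta>: "is_zbasis M \<alpha> \<beta>" "\<bar>\<alpha> * \<sigma> \<beta> - \<sigma> \<alpha> * \<beta>\<bar> = \<alpha> * of_int g / (- (h1 * h2))"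
    by (rule M_zbasis_det)
  have "\<beta> \<in> K" using zbasis_mem(2)[OF \<beta>(1)] by (rule M_K)
  then have "\<bar>x * \<sigma> y - \<sigma> x * y\<bar> = \<bar>\<alpha> * \<sigma> \<beta> - \<sigma> \<alpha> * \<beta>\<bar>"
    by (intro zbasis_abs_det[OF assms \<beta>(1)]) simp
  then show ?thesis using \<beta>(2) by simp
qed

lemma lattice_norm_M: "lattice_norm D M * rD = \<alpha> * of_int g / (- (h1 * h2))"
proof -
  have "lattice_norm D M = \<alpha> * of_int g / (- (h1 * h2)) / rD"
    unfolding lattice_norm_def
  proof (rule the_equality)
    obtain \<beta> where "is_zbasis M \<alpha> \<beta>" by (rule M_zbasis_det)
    then show "\<exists>x y. is_zbasis M x y \<and> \<alpha> * of_int g / (- (h1 * h2)) / rD = \<bar>x * \<sigma> y - \<sigma> x * y\<bar> / rD"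
      using M_det by metis
  qed (use M_det in auto)
  then show ?thesis using D_pos by simp
qed

text \<open>With the primitive vector y = \<eta>1 \<eta>2 / g this says S = e(-\<sigma>(y) C). The
  minus sign reflects h1 h2 < 0 against a positive norm.\<close>

lemma branch_exponent_eq: "branch_exponent D I \<alpha> C = - C * of_real (h1 * h2) / of_int g"
  unfolding branch_exponent_def lattice_norm_M using \<alpha>_pos g_pos h1_nz h2_nz by simp

end

section \<open>The theta product along a branch\<close>

lemma ee_add: "ee (x + y) = ee x * ee y"
  by (simp add: ee_def distrib_left exp_add)

lemma ee_powi: "ee x powi n = ee (of_int n * x)"
  by (simp add: ee_def exp_power_int mult_ac)

lemma ee_nz [simp]: "ee x \<noteq> 0"
  by (simp add: ee_def)

lemma finite_odd_characteristics: "finite odd_characteristics"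
  by (rule finite_subset[of _ "({0, 1/2} \<times> {0, 1/2}) \<times> ({0, 1/2} \<times> {0, 1/2})"])
    (auto simp: odd_characteristics_def)

context diagonal_basis
begin

definition "A1 = nat \<lfloor>Tr (\<alpha> * \<eta>1\<^sup>2)\<rfloor>"
definition "A2 = nat \<lfloor>Tr (\<alpha> * \<eta>2\<^sup>2)\<rfloor>"

lemma A_eq: "real A1 = Tr (\<alpha> * \<eta>1\<^sup>2)" "real A2 = Tr (\<alpha> * \<eta>2\<^sup>2)"
proof -
  have "Tr (\<alpha> * \<eta>1\<^sup>2) \<in> \<int>" "Tr (\<alpha> * \<eta>2\<^sup>2) \<in> \<int>" using M_Tr[OF \<alpha>_M] I2_mem by auto
  then show "real A1 = Tr (\<alpha> * \<eta>1\<^sup>2)" "real A2 = Tr (\<alpha> * \<eta>2\<^sup>2)"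
    using positive Tr_\<eta>2_pos by (auto simp: A1_def A2_def elim!: Ints_cases)
qed

lemma A_pos: "A1 > 0" "A2 > 0"
  using A_eq positive Tr_\<eta>2_pos by (metis of_nat_0_less_iff)+

lemma coord_conj:
  fixes k :: "int \<times> int" and p1 p2 :: int
  defines "\<rho> \<equiv> (of_int (fst k) + of_int p1 / 2) * \<eta>1 + (of_int (snd k) + of_int p2 / 2) * \<eta>2"
  shows "\<sigma> \<rho> = conj_coord h1 h2 p1 p2 k"
    and "\<alpha> * \<rho>\<^sup>2 + \<sigma> \<alpha> * (\<sigma> \<rho>)\<^sup>2 = 2 * diag_weight A1 A2 p1 p2 k + (A1 * of_int (p1\<^sup>2) + A2 * of_int (p2\<^sup>2)) / 4"
proof -
  show c: "\<sigma> \<rho> = conj_coord h1 h2 p1 p2 k"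
    unfolding \<rho>_def conj_coord_def h1_def h2_def by simp
  define u v where "u = real_of_int (fst k) + of_int p1 / 2" and "v = real_of_int (snd k) + of_int p2 / 2"
  have "\<alpha> * \<rho>\<^sup>2 + \<sigma> \<alpha> * (\<sigma> \<rho>)\<^sup>2 = u\<^sup>2 * (\<alpha> * \<eta>1\<^sup>2 + \<sigma> \<alpha> * h1\<^sup>2) + v\<^sup>2 * (\<alpha> * \<eta>2\<^sup>2 + \<sigma> \<alpha> * h2\<^sup>2)
      + 2 * u * v * (\<alpha> * \<eta>1 * \<eta>2 + \<sigma> \<alpha> * h1 * h2)"
    unfolding c unfolding \<rho>_def conj_coord_def u_def[symmetric] v_def[symmetric]
    by (simp add: power2_eq_square algebra_simps)
  also have "\<dots> = u\<^sup>2 * A1 + v\<^sup>2 * A2"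
    unfolding \<alpha>_diag A_eq by (simp add: qtr_def h1_def h2_def)
  also have "\<dots> = 2 * diag_weight A1 A2 p1 p2 k + (A1 * of_int (p1\<^sup>2) + A2 * of_int (p2\<^sup>2)) / 4"
    unfolding diag_weight_def u_def v_def by (simp add: power2_eq_square field_simps)
  finally show "\<alpha> * \<rho>\<^sup>2 + \<sigma> \<alpha> * (\<sigma> \<rho>)\<^sup>2 = 2 * diag_weight A1 A2 p1 p2 k + (A1 * of_int (p1\<^sup>2) + A2 * of_int (p2\<^sup>2)) / 4" .
qed

text \<open>At z = i t the exponent of the term of \<rho> is -\<tau>/2 times the trace of \<alpha>
  \<rho>^2, plus w \<sigma>(\<rho>)^2 / 2, with \<tau> = 2 \<pi> t / \<alpha>. Since a sign and the
  constant part of the trace are split off, only zero sets are compared.\<close>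

lemma D2_theta_diagonal:
  assumes "is_zbasis I w1 w2" "(m, m') \<in> odd_characteristics"
  obtains p1 p2 s1 s2 :: int where "p1 \<in> {0, 1}" "p2 \<in> {0, 1}" "odd (p1 * s1 + p2 * s2)"
    "\<And>t w. D2_theta D w1 w2 m m' (\<i> * of_real t) (of_real (\<sigma> \<alpha> / \<alpha>) * (\<i> * of_real t) + w / (2 * of_real pi * \<i>)) = 0 \<longleftrightarrow>
      diag_theta h1 h2 A1 A2 p1 p2 s1 s2 (2 * pi * t / \<alpha>) w = 0"
proof -
  obtain p1 p2 s1 s2 :: int and sg :: complex where p: "p1 \<in> {0, 1}" "p2 \<in> {0, 1}" and odd: "odd (p1 * s1 + p2 * s2)" and sg: "sg \<noteq> 0"
    and change: "\<And>h :: real \<Rightarrow> complex. (\<Sum>\<^sub>\<infinity>(x1, x2)\<in>(UNIV :: (int \<times> int) set).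
        (-1) powi \<lfloor>2 * (of_int x1 * fst m' + of_int x2 * snd m')\<rfloor> * h ((of_int x1 + fst m) * w1 + (of_int x2 + snd m) * w2))
     = sg * (\<Sum>\<^sub>\<infinity>k. (-1) powi (fst k * s1 + snd k * s2) * h ((of_int (fst k) + of_int p1 / 2) * \<eta>1 + (of_int (snd k) + of_int p2 / 2) * \<eta>2))"
    by (rule odd_characteristic_base_change[OF assms(1) basis assms(2)]) blast
  show thesis
  proof (rule that[OF p odd])
    fix t w
    let ?z = "\<i> * complex_of_real t" and ?z2 = "of_real (\<sigma> \<alpha> / \<alpha>) * (\<i> * of_real t) + w / (2 * of_real pi * \<i>)"
    define \<tau> where "\<tau> = 2 * pi * t / \<alpha>"
    define e0 where "e0 = (A1 * of_int (p1\<^sup>2) + A2 * of_int (p2\<^sup>2)) / 8"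
    define h where "h \<rho> = of_real (\<sigma> \<rho>) * ee (of_real (\<rho>\<^sup>2) * ?z / 2 + of_real ((\<sigma> \<rho>)\<^sup>2) * ?z2 / 2)" for \<rho>
    have ex: "h \<rho> = of_real (\<sigma> \<rho>) * exp (- of_real (\<tau> * (\<alpha> * \<rho>\<^sup>2 + \<sigma> \<alpha> * (\<sigma> \<rho>)\<^sup>2) / 2) + of_real ((\<sigma> \<rho>)\<^sup>2 / 2) * w)" for \<rho>
    proof -
      have "2 * of_real pi * \<i> * (of_real (\<rho>\<^sup>2) * ?z / 2 + of_real ((\<sigma> \<rho>)\<^sup>2) * ?z2 / 2) =
         - of_real (\<tau> * (\<alpha> * \<rho>\<^sup>2 + \<sigma> \<alpha> * (\<sigma> \<rho>)\<^sup>2) / 2) + of_real ((\<sigma> \<rho>)\<^sup>2 / 2) * w"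
        using \<alpha>_pos by (simp add: \<tau>_def field_simps)
      then show ?thesis by (simp add: h_def ee_def)
    qed
    have hk: "h ((of_int (fst k) + of_int p1 / 2) * \<eta>1 + (of_int (snd k) + of_int p2 / 2) * \<eta>2) =
       exp (- of_real (\<tau> * e0)) * (of_real (conj_coord h1 h2 p1 p2 k) *
         exp (- of_real (\<tau> * diag_weight A1 A2 p1 p2 k) + of_real ((conj_coord h1 h2 p1 p2 k)\<^sup>2 / 2) * w))" for k
    proof -
      have "- complex_of_real (\<tau> * (2 * diag_weight A1 A2 p1 p2 k + (A1 * of_int (p1\<^sup>2) + A2 * of_int (p2\<^sup>2)) / 4) / 2) =
         - of_real (\<tau> * e0) + - of_real (\<tau> * diag_weight A1 A2 p1 p2 k)"
        by (simp add: e0_def field_simps)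
      then show ?thesis
        unfolding ex coord_conj(2) unfolding coord_conj(1)
        by (simp only: exp_add add.assoc mult.left_commute mult.assoc)
    qed
    have "D2_theta D w1 w2 m m' ?z ?z2 = (\<Sum>\<^sub>\<infinity>(x1, x2)\<in>(UNIV :: (int \<times> int) set).
        (-1) powi \<lfloor>2 * (of_int x1 * fst m' + of_int x2 * snd m')\<rfloor> * h ((of_int x1 + fst m) * w1 + (of_int x2 + snd m) * w2))"
      unfolding D2_theta_def h_def Let_def by (simp only: mult.assoc)
    also have "\<dots> = sg * (\<Sum>\<^sub>\<infinity>k. exp (- of_real (\<tau> * e0)) * ((-1) powi (fst k * s1 + snd k * s2) * of_real (conj_coord h1 h2 p1 p2 k) *
         exp (- of_real (\<tau> * diag_weight A1 A2 p1 p2 k) + of_real ((conj_coord h1 h2 p1 p2 k)\<^sup>2 / 2) * w)))"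
      unfolding change hk by (simp only: mult.left_commute mult.assoc)
    also have "\<dots> = sg * (exp (- of_real (\<tau> * e0)) * diag_theta h1 h2 A1 A2 p1 p2 s1 s2 \<tau> w)"
      unfolding diag_theta_def infsum_cmult_right' ..
    finally show "D2_theta D w1 w2 m m' ?z ?z2 = 0 \<longleftrightarrow> diag_theta h1 h2 A1 A2 p1 p2 s1 s2 (2 * pi * t / \<alpha>) w = 0"
      using sg by (simp add: \<tau>_def)
  qed
qed

text \<open>Finitely many factors and infinitely many points: one factor vanishes infinitely often.
  Its characteristic is nonzero by oddness, and the two mixed cases are excluded for large \<tau>,
  with exchanged basis vectors for the second.\<close>

lemma branch_lift_formal:
  assumes w: "is_zbasis I w1 w2" and branch: "branch_lift D w1 w2 \<alpha> C \<epsilon> T \<phi>"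
  obtains s1 s2 :: int where "odd (s1 + s2)"
    "\<And>N. (\<Sum>k | nat_weight A1 A2 k \<le> N. theta_coeff h1 h2 s1 s2 (2 * of_real pi * \<i> * C) k *
      fps_nth (fps_exp (of_real (conj_exponent h1 h2 k)) oo \<epsilon>) (N - nat_weight A1 A2 k)) = 0"
proof -
  define c0 where "c0 = 2 * of_real pi * \<i> * C"
  define t where "t n = T + 1 + real n" for n
  define \<tau> where "\<tau> n = 2 * pi * t n / \<alpha>" for n
  define q where "q n = complex_of_real (exp (- \<tau> n))" for n
  define w' where "w' n = c0 + eval_fps \<epsilon> (q n)" for n
  have \<epsilon>: "fps_nth \<epsilon> 0 = 0" using branch by (simp add: branch_lift_def)
  have eeq: "ee (\<i> * of_real (t n) / of_real \<alpha>) = q n" for n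
    by (simp add: ee_def q_def \<tau>_def exp_of_real[symmetric] mult_ac)
  have conv: "ereal (norm (q n)) < fps_conv_radius \<epsilon>"
    and \<phi>: "\<phi> (\<i> * of_real (t n)) = of_real (\<sigma> \<alpha> / \<alpha>) * (\<i> * of_real (t n)) + w' n / (2 * of_real pi * \<i>)"
    and zero: "theta_product D w1 w2 (\<i> * of_real (t n)) (\<phi> (\<i> * of_real (t n))) = 0" for n
  proof -
    have "Im (\<i> * of_real (t n)) > T" by (simp add: t_def)
    then have "ereal (norm (q n)) < fps_conv_radius \<epsilon> \<and>
       \<phi> (\<i> * of_real (t n)) = of_real (\<sigma> \<alpha> / \<alpha>) * (\<i> * of_real (t n)) + C + eval_fps \<epsilon> (q n) / (2 * of_real pi * \<i>) \<and>
       theta_product D w1 w2 (\<i> * of_real (t n)) (\<phi> (\<i> * of_real (t n))) = 0"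
      using branch unfolding branch_lift_def Let_def eeq[symmetric] by blast
    then show "ereal (norm (q n)) < fps_conv_radius \<epsilon>"
      "\<phi> (\<i> * of_real (t n)) = of_real (\<sigma> \<alpha> / \<alpha>) * (\<i> * of_real (t n)) + w' n / (2 * of_real pi * \<i>)"
      "theta_product D w1 w2 (\<i> * of_real (t n)) (\<phi> (\<i> * of_real (t n))) = 0"
      by (auto simp: w'_def c0_def field_simps)
  qed
  have "0 \<le> ereal (norm (q 0))" by simp
  then have rad: "fps_conv_radius \<epsilon> > 0" using conv[of 0] by (rule le_less_trans)
  have \<tau>_lim: "filterlim \<tau> at_top sequentially"
  proof -
    have "filterlim (\<lambda>n. 2 * pi / \<alpha> * (T + 1 + real n)) at_top sequentially"
      using \<alpha>_pos by (intro filterlim_tendsto_pos_mult_at_top[OF tendsto_const]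
        filterlim_tendsto_add_at_top[OF tendsto_const] filterlim_real_sequentially) auto
    then show ?thesis by (simp add: \<tau>_def[abs_def] t_def)
  qed
  then have "(\<lambda>n. exp (- \<tau> n)) \<longlonglongrightarrow> 0"
    by (intro filterlim_compose[OF exp_at_bot]) (simp add: filterlim_uminus_at_bot)
  then have q: "q \<longlonglongrightarrow> 0" unfolding q_def using tendsto_of_real[of "\<lambda>n. exp (- \<tau> n)" 0] by simp
  have "\<exists>x\<in>odd_characteristics. D2_theta D w1 w2 (fst x) (snd x) (\<i> * of_real (t n)) (\<phi> (\<i> * of_real (t n))) = 0" for n
    using zero[of n] finite_odd_characteristics by (auto simp: theta_product_def case_prod_unfold)
  then have "(\<Union>x\<in>odd_characteristics. {n. D2_theta D w1 w2 (fst x) (snd x) (\<i> * of_real (t n)) (\<phi> (\<i> * of_real (t n))) = 0}) = UNIV"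
    by blast
  then obtain x where x: "x \<in> odd_characteristics"
    and inf: "infinite {n. D2_theta D w1 w2 (fst x) (snd x) (\<i> * of_real (t n)) (\<phi> (\<i> * of_real (t n))) = 0}"
    using finite_odd_characteristics infinite_UNIV_nat by (metis (no_types, lifting) finite_UN)
  obtain p1 p2 s1 s2 :: int where p: "p1 \<in> {0, 1}" "p2 \<in> {0, 1}" and odd: "odd (p1 * s1 + p2 * s2)"
    and iff: "\<And>t w. D2_theta D w1 w2 (fst x) (snd x) (\<i> * of_real t) (of_real (\<sigma> \<alpha> / \<alpha>) * (\<i> * of_real t) + w / (2 * of_real pi * \<i>)) = 0 \<longleftrightarrow>
      diag_theta h1 h2 A1 A2 p1 p2 s1 s2 (2 * pi * t / \<alpha>) w = 0"
    using D2_theta_diagonal[OF w, of "fst x" "snd x"] x by (metis prod.collapse)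
  define Z where "Z = {n. diag_theta h1 h2 A1 A2 p1 p2 s1 s2 (\<tau> n) (w' n) = 0}"
  have Z: "infinite Z" using inf unfolding \<phi> iff Z_def \<tau>_def .
  have bounded: "\<forall>\<^sub>F n in sequentially. norm (w' n) \<le> norm c0 + 1"
    unfolding w'_def by (rule eventually_norm_add_eval_fps_le[OF \<epsilon> rad q])
  have excl: False if "\<forall>\<tau>\<ge>\<tau>1. \<forall>v. norm v \<le> norm c0 + 1 \<longrightarrow> diag_theta h1 h2 A1 A2 p1 p2 s1 s2 \<tau> v \<noteq> 0" for \<tau>1
  proof -
    have "\<forall>\<^sub>F n in sequentially. \<tau> n \<ge> \<tau>1" using \<tau>_lim by (simp add: filterlim_at_top)
    with bounded have "\<forall>\<^sub>F n in sequentially. n \<notin> Z"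
      by eventually_elim (use that in \<open>auto simp: Z_def\<close>)
    then have "finite Z" by (simp add: cofinite_eq_sequentially[symmetric] eventually_cofinite)
    then show False using Z by simp
  qed
  have p11: "p1 = 1 \<and> p2 = 1"
  proof (rule ccontr)
    assume "\<not> (p1 = 1 \<and> p2 = 1)"
    moreover have "\<not> (p1 = 0 \<and> p2 = 0)" using odd by auto
    ultimately consider "p1 = 1" "p2 = 0" | "p1 = 0" "p2 = 1" using p by auto
    then show False
    proof cases
      case 1
      have "\<exists>\<tau>1. \<forall>\<tau>\<ge>\<tau>1. \<forall>v. norm v \<le> norm c0 + 1 \<longrightarrow> diag_theta h1 h2 A1 A2 1 0 s1 s2 \<tau> v \<noteq> 0"
        using odd 1 A_pos h1_nz by (intro diag_theta_10_nonzero) auto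
      then show False using excl 1 by blast
    next
      case 2
      have "\<exists>\<tau>1. \<forall>\<tau>\<ge>\<tau>1. \<forall>v. norm v \<le> norm c0 + 1 \<longrightarrow> diag_theta h2 h1 A2 A1 1 0 s2 s1 \<tau> v \<noteq> 0"
        using odd 2 A_pos h2_nz by (intro diag_theta_10_nonzero) auto
      then show False using excl 2 unfolding diag_theta_swap[of h2] by blast
    qed
  qed
  \<comment> \<open>Enumerating the points where the chosen factor vanishes gives a subsequence that
    still tends to the cusp.\<close>
  define r where "r = enumerate Z"
  have r: "strict_mono r" "\<And>n. r n \<in> Z"
    using Z by (auto simp: r_def strict_mono_enumerate enumerate_in_set)
  show thesis
  proof (rule that)
    show "odd (s1 + s2)" using odd p11 by simp
    fix N
    show "(\<Sum>k | nat_weight A1 A2 k \<le> N. theta_coeff h1 h2 s1 s2 (2 * of_real pi * \<i> * C) k *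
      fps_nth (fps_exp (of_real (conj_exponent h1 h2 k)) oo \<epsilon>) (N - nat_weight A1 A2 k)) = 0"
      unfolding c0_def[symmetric]
    proof (rule diag_theta_11_formal[OF A_pos \<epsilon> rad])
      show "filterlim (\<lambda>n. \<tau> (r n)) at_top sequentially"
        by (rule filterlim_compose[OF \<tau>_lim filterlim_subseq[OF r(1)]])
      show "diag_theta h1 h2 A1 A2 1 1 s1 s2 (\<tau> (r n)) (c0 + eval_fps \<epsilon> (of_real (exp (- \<tau> (r n))))) = 0" for n
        using r(2)[of n] p11 by (simp add: Z_def w'_def q_def)
    qed
  qed
qed

end

subsection \<open>Constants of a branch\<close>

lemma conj_coord_corner: "conj_coord h1 h2 1 1 (0, 0) = (h1 + h2) / 2" "conj_coord h1 h2 1 1 (-1, -1) = - ((h1 + h2) / 2)"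
  "conj_coord h1 h2 1 1 (0, -1) = (h1 - h2) / 2" "conj_coord h1 h2 1 1 (-1, 0) = - ((h1 - h2) / 2)"
  by (simp_all add: conj_coord_def field_simps)

lemma conj_exponent_corner: "conj_exponent h1 h2 (0, 0) = 0" "conj_exponent h1 h2 (-1, -1) = 0"
  "conj_exponent h1 h2 (0, -1) = - (h1 * h2) / 2" "conj_exponent h1 h2 (-1, 0) = - (h1 * h2) / 2"
  by (simp_all only: conj_exponent_def conj_coord_corner) (simp_all add: power2_eq_square field_simps)

text \<open>The four corners of weight 0 form two opposite pairs; reversal changes both the
  coordinate and, by oddness, the sign, so each pair doubles. The function G is 1 for the constant
  term and a coefficient of exp(\<kappa> \<epsilon>) for the recursion.\<close>

lemma theta_leading_sum:
  assumes "odd (s1 + s2)" "B1 > 0" "B2 > 0"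
  shows "(\<Sum>k | nat_weight B1 B2 k = 0. theta_coeff h1 h2 s1 s2 c0 k * G (conj_exponent h1 h2 k)) =
    of_real (h1 + h2) * G 0 + 2 * theta_coeff h1 h2 s1 s2 c0 (0, -1) * G (- (h1 * h2) / 2)"
proof -
  have "{k. nat_weight B1 B2 k = 0} = {(0, 0), (-1, -1), (0, -1), (-1, 0)}"
    using assms(2,3) by (auto simp: nat_weight_def triangular_eq_0_iff)
  moreover have "theta_coeff h1 h2 s1 s2 c0 (0, 0) = of_real ((h1 + h2) / 2)"
    "theta_coeff h1 h2 s1 s2 c0 (-1, -1) = of_real ((h1 + h2) / 2)"
    using assms(1) by (simp_all add: theta_coeff_def conj_coord_corner conj_exponent_corner field_simps)
  moreover have "theta_coeff h1 h2 s1 s2 c0 (-1, 0) = theta_coeff h1 h2 s1 s2 c0 (0, -1)"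
    unfolding theta_coeff_def conj_coord_corner conj_exponent_corner of_real_minus
    using assms(1) by (cases "even s1") (simp_all del: of_real_diff of_real_divide)
  moreover have "complex_of_real (h1 + h2) = 2 * of_real ((h1 + h2) / 2)" by simp
  ultimately show ?thesis by (simp add: conj_exponent_corner algebra_simps del: of_real_add of_real_divide)
qed

context diagonal_basis
begin

text \<open>Quotient of the coefficients of the two leading pairs. Up to sign it is the value e(C h1
  h2 / 2).\<close>

definition "x0 = (h1 - h2) / (h1 + h2)"

lemma x0_K [simp, intro]: "x0 \<in> K" by (auto simp: x0_def)
lemma x0_nz: "x0 \<noteq> 0" using h_ne by (simp add: x0_def)

text \<open>Otherwise conjugation fixes or negates x0. The first makes \<xi> rational, the second
  gives \<xi> the norm 1, although its conjugate is negative.\<close>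

lemma x0_square_irrational: "x0\<^sup>2 \<notin> \<rat>"
proof
  assume "x0\<^sup>2 \<in> \<rat>"
  then have "\<sigma> (x0\<^sup>2) = x0\<^sup>2" by (rule qconj_Rats)
  moreover have \<sigma>x: "\<sigma> x0 = (\<eta>1 - \<eta>2) / (\<eta>1 + \<eta>2)" by (simp add: x0_def h1_def h2_def)
  ultimately have "\<sigma> x0 = x0 \<or> \<sigma> x0 = - x0" by (simp add: power2_eq_iff)
  then show False
  proof
    assume "\<sigma> x0 = x0"
    then have "(\<eta>1 - \<eta>2) / (\<eta>1 + \<eta>2) = (h1 - h2) / (h1 + h2)"
      unfolding \<sigma>x[symmetric] by (simp only: x0_def)
    then have "(\<eta>1 - \<eta>2) * (h1 + h2) = (h1 - h2) * (\<eta>1 + \<eta>2)"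
      using \<eta>_pos h_ne by (subst (asm) frac_eq_eq) auto
    then have "\<eta>1 * h2 = \<eta>2 * h1" by (simp add: algebra_simps)
    then have "\<sigma> \<xi> = \<xi>" using h1_nz \<eta>_pos unfolding \<sigma>\<xi> by (simp add: \<xi>_def field_simps)
    then show False using \<xi>_irrational qconj_eq_self_iff[of \<xi>] by auto
  next
    assume "\<sigma> x0 = - x0"
    then have "(\<eta>1 - \<eta>2) / (\<eta>1 + \<eta>2) = (- (h1 - h2)) / (h1 + h2)"
      unfolding \<sigma>x[symmetric] minus_divide_left[symmetric] by (simp only: x0_def)
    then have "(\<eta>1 - \<eta>2) * (h1 + h2) = (- (h1 - h2)) * (\<eta>1 + \<eta>2)"
      using \<eta>_pos h_ne by (subst (asm) frac_eq_eq) auto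
    then have eq: "\<eta>1 * h1 = \<eta>2 * h2" by (simp add: algebra_simps)
    have "\<xi> * \<sigma> \<xi> = \<eta>2 * h2 / (\<eta>1 * h1)" unfolding \<sigma>\<xi> by (simp add: \<xi>_def)
    also have "\<dots> = 1" unfolding eq[symmetric] using h1_nz \<eta>_pos by simp
    finally have "\<xi> * \<sigma> \<xi> = 1" .
    then show False using \<xi>_pos \<sigma>\<xi>_neg mult_pos_neg[of \<xi> "\<sigma> \<xi>"] by simp
  qed
qed

lemma conj_exponent_eq:
  "conj_exponent h1 h2 k = real (triangular (fst k)) * h1\<^sup>2 + real (triangular (snd k)) * h2\<^sup>2
    + of_int (fst k + snd k + 2 * fst k * snd k) * (h1 * h2 / 2)"
proof -
  have t: "real (triangular j) = (of_int j * of_int j + of_int j) / 2" for j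
  proof -
    have "real_of_int (2 * int (triangular j)) = of_int (j\<^sup>2 + j)" by (simp only: triangular)
    then show ?thesis by (simp add: power2_eq_square)
  qed
  show ?thesis unfolding conj_exponent_def conj_coord_def t by (simp add: power2_eq_square field_simps)
qed

text \<open>On the branch the coefficient of z is the trace of \<alpha> \<nu> divided by \<alpha>;
  this trace is an integer, so a power of q appears.\<close>

lemma branch_phase:
  assumes branch: "branch_lift D w1 w2 \<alpha> C \<epsilon> T \<phi>" and z: "Im z > T" and \<nu>: "\<nu> \<in> I2"
  shows "ee (of_real \<nu> * z + of_real (\<sigma> \<nu>) * \<phi> z) =
    ee (of_real (\<sigma> \<nu>) * C) * ee (z / of_real \<alpha>) powi \<lfloor>Tr (\<alpha> * \<nu>)\<rfloor> * exp (of_real (\<sigma> \<nu>) * eval_fps \<epsilon> (ee (z / of_real \<alpha>)))"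
proof -
  define n where "n = \<lfloor>Tr (\<alpha> * \<nu>)\<rfloor>"
  have n: "Tr (\<alpha> * \<nu>) = of_int n" using M_Tr[OF \<alpha>_M \<nu>] by (auto simp: n_def elim: Ints_cases)
  have \<phi>: "\<phi> z = of_real (\<sigma> \<alpha> / \<alpha>) * z + C + eval_fps \<epsilon> (ee (z / of_real \<alpha>)) / (2 * of_real pi * \<i>)"
    using branch z unfolding branch_lift_def Let_def by blast
  have "\<alpha> * \<nu> + \<sigma> \<nu> * \<sigma> \<alpha> = of_int n" using n I2_K[OF \<nu>] by (simp add: qtr_def mult.commute)
  then have "\<nu> + \<sigma> \<nu> * (\<sigma> \<alpha> / \<alpha>) = of_int n / \<alpha>" using \<alpha>_pos by (simp add: field_simps)
  then have "complex_of_real (\<nu> + \<sigma> \<nu> * (\<sigma> \<alpha> / \<alpha>)) = of_int n / of_real \<alpha>" by simp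
  then have "of_real \<nu> * z + of_real (\<sigma> \<nu>) * (of_real (\<sigma> \<alpha> / \<alpha>) * z) = of_int n / of_real \<alpha> * z"
    by (metis distrib_right mult.assoc of_real_add of_real_mult)
  then have "of_real \<nu> * z + of_real (\<sigma> \<nu>) * \<phi> z = of_real (\<sigma> \<nu>) * C + of_int n * (z / of_real \<alpha>)
      + of_real (\<sigma> \<nu>) * eval_fps \<epsilon> (ee (z / of_real \<alpha>)) / (2 * of_real pi * \<i>)"
    unfolding \<phi> by (simp add: distrib_left)
  then have "ee (of_real \<nu> * z + of_real (\<sigma> \<nu>) * \<phi> z) = ee (of_real (\<sigma> \<nu>) * C) * ee (of_int n * (z / of_real \<alpha>))
      * ee (of_real (\<sigma> \<nu>) * eval_fps \<epsilon> (ee (z / of_real \<alpha>)) / (2 * of_real pi * \<i>))"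
    by (simp only: ee_add)
  moreover have "ee (v / (2 * of_real pi * \<i>)) = exp v" for v by (simp add: ee_def)
  ultimately show ?thesis by (simp only: ee_powi n_def)
qed

text \<open>Comparison at one point of the branch expresses the constant e(\<sigma>(\<nu>) C)
  through S and A. The exponent of S stays unspecified, as only membership in K(S) will
  matter.\<close>

lemma adapted_phase:
  assumes branch: "branch_lift D w1 w2 \<alpha> C \<epsilon> T \<phi>" and adapted: "adapted_parameter D I \<alpha> \<beta> S \<epsilon> T \<phi> A" and \<nu>: "\<nu> \<in> I2"
  shows "\<exists>n::int. ee (of_real (\<sigma> \<nu>) * C) = S powi n * A powi \<lfloor>Tr (\<alpha> * \<nu>)\<rfloor>"
proof -
  define z where "z = \<i> * complex_of_real (T + 1)"
  have z: "Im z > T" by (simp add: z_def)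
  define q where "q = ee (z / of_real \<alpha>)"
  obtain n :: int where "ee (of_real \<nu> * z + of_real (\<sigma> \<nu>) * \<phi> z) =
      S powi n * (A * q) powi \<lfloor>Tr (\<alpha> * \<nu>)\<rfloor> * exp (of_real (\<sigma> \<nu>) * eval_fps \<epsilon> q)"
    using adapted \<nu> z unfolding adapted_parameter_def Let_def q_def by blast
  then have "ee (of_real (\<sigma> \<nu>) * C) * q powi \<lfloor>Tr (\<alpha> * \<nu>)\<rfloor> * exp (of_real (\<sigma> \<nu>) * eval_fps \<epsilon> q)
     = S powi n * A powi \<lfloor>Tr (\<alpha> * \<nu>)\<rfloor> * q powi \<lfloor>Tr (\<alpha> * \<nu>)\<rfloor> * exp (of_real (\<sigma> \<nu>) * eval_fps \<epsilon> q)"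
    unfolding branch_phase[OF branch z \<nu>] q_def[symmetric] by (simp add: power_int_mult_distrib mult_ac)
  moreover have "q \<noteq> 0" by (simp add: q_def)
  ultimately show ?thesis by (intro exI[of _ n]) simp
qed

text \<open>Solving the two traces of \<alpha> \<nu> and \<beta> \<nu> for \<sigma>(\<nu>) by
  Cramer's rule splits e(\<sigma>(\<nu>) C) into a power of S and a power of A = e(-\<beta> C /
  \<Delta>).\<close>

lemma branch_parameter:
  assumes branch: "branch_lift D w1 w2 \<alpha> C \<epsilon> T \<phi>" and \<beta>: "is_zbasis M \<alpha> \<beta>"
  defines "\<Delta> \<equiv> \<alpha> * \<sigma> \<beta> - \<sigma> \<alpha> * \<beta>"
  shows "adapted_parameter D I \<alpha> \<beta> (branch_S D I \<alpha> C) \<epsilon> T \<phi> (ee (of_real (- \<beta> / \<Delta>) * C))"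
proof -
  define s where "s = (if \<alpha> * \<sigma> \<beta> - \<sigma> \<alpha> * \<beta> > 0 then 1 else - 1 :: int)"
  have \<beta>M: "\<beta> \<in> M" using zbasis_mem[OF \<beta>] by simp
  have abs: "\<bar>\<Delta>\<bar> = \<alpha> * of_int g / (- (h1 * h2))" unfolding \<Delta>_def by (rule M_det[OF \<beta>])
  have "\<alpha> * of_int g / (- (h1 * h2)) > 0"
    using \<alpha>_pos ac h12_neg by (intro divide_pos_pos mult_pos_pos) auto
  then have \<Delta>: "\<Delta> \<noteq> 0" using abs by auto
  \<comment> \<open>S is normalized by the positive covolume |\<Delta>|; the orientation sign s
    converts it to \<Delta>.\<close>
  have s\<Delta>: "of_int s / (of_int g / (- (h1 * h2))) = \<alpha> / \<Delta>"
  proof -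
    have "\<Delta> = of_int s * \<bar>\<Delta>\<bar>" using \<Delta> by (auto simp: s_def \<Delta>_def)
    then have "\<alpha> / \<Delta> = \<alpha> / (of_int s * (\<alpha> * of_int g / (- (h1 * h2))))" by (simp only: abs)
    then show ?thesis using \<alpha>_pos by (cases "\<alpha> * \<sigma> \<beta> - \<sigma> \<alpha> * \<beta> > 0") (simp_all add: s_def)
  qed
  have sS: "branch_S D I \<alpha> C powi (s * k) = ee (of_int k * (of_real (\<alpha> / \<Delta>) * C))" for k
  proof -
    have "complex_of_real (\<alpha> / \<Delta>) = of_int s / (of_int g / (- of_real (h1 * h2)))"
      unfolding s\<Delta>[symmetric] by simp
    then have "of_int (s * k) * branch_exponent D I \<alpha> C = of_int k * (of_real (\<alpha> / \<Delta>) * C)"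
      unfolding branch_exponent_eq by (simp only: of_int_mult) simp
    then show ?thesis unfolding branch_S_def ee_powi by simp
  qed
  show ?thesis
    unfolding adapted_parameter_def Let_def s_def[symmetric]
  proof (intro conjI ballI allI impI)
    fix \<nu> z assume \<nu>: "\<nu> \<in> I2" and z: "Im z > T"
    have \<nu>K: "\<nu> \<in> K" using I2_K[OF \<nu>] .
    define n1 n2 where "n1 = \<lfloor>Tr (\<alpha> * \<nu>)\<rfloor>" and "n2 = \<lfloor>Tr (\<beta> * \<nu>)\<rfloor>"
    have n: "Tr (\<alpha> * \<nu>) = of_int n1" "Tr (\<beta> * \<nu>) = of_int n2"
      using M_Tr[OF \<alpha>_M \<nu>] M_Tr[OF \<beta>M \<nu>] by (auto simp: n1_def n2_def elim: Ints_cases)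
    have "of_int n2 * \<alpha> - of_int n1 * \<beta> = \<sigma> \<nu> * \<Delta>"
      unfolding n[symmetric] \<Delta>_def using \<nu>K M_K[OF \<beta>M] by (simp add: qtr_def algebra_simps)
    then have "\<sigma> \<nu> = of_int n2 * (\<alpha> / \<Delta>) + of_int n1 * (- \<beta> / \<Delta>)" using \<Delta> by (simp add: field_simps)
    then have "complex_of_real (\<sigma> \<nu>) = of_int n2 * of_real (\<alpha> / \<Delta>) + of_int n1 * of_real (- \<beta> / \<Delta>)"
      by (simp only: of_real_add of_real_mult of_real_of_int_eq)
    then have "ee (of_real (\<sigma> \<nu>) * C) = ee (of_int n2 * (of_real (\<alpha> / \<Delta>) * C) + of_int n1 * (of_real (- \<beta> / \<Delta>) * C))"
      by (simp only: distrib_right mult.assoc)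
    also have "\<dots> = branch_S D I \<alpha> C powi (s * n2) * ee (of_real (- \<beta> / \<Delta>) * C) powi n1"
      by (simp only: ee_add ee_powi sS)
    finally show "ee (of_real \<nu> * z + of_real (\<sigma> \<nu>) * \<phi> z) =
      branch_S D I \<alpha> C powi (s * \<lfloor>Tr (\<beta> * \<nu>)\<rfloor>) * (ee (of_real (- \<beta> / \<Delta>) * C) * ee (z / of_real \<alpha>)) powi \<lfloor>Tr (\<alpha> * \<nu>)\<rfloor> *
      exp (of_real (\<sigma> \<nu>) * eval_fps \<epsilon> (ee (z / of_real \<alpha>)))"
      unfolding branch_phase[OF branch z \<nu>] n1_def[symmetric] n2_def[symmetric] power_int_mult_distrib by (simp only: mult.assoc)
  qed simp
qed

text \<open>This is the formal identity in degree 0. The sign depends on the characteristic, and it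
  disappears in the square used for S and A.\<close>

lemma branch_leading_coefficient:
  assumes "is_zbasis I w1 w2" "branch_lift D w1 w2 \<alpha> C \<epsilon> T \<phi>"
  shows "exp (of_real (h1 * h2 / 2) * (2 * of_real pi * \<i> * C)) \<in> {of_real x0, - of_real x0}"
proof -
  define c0 where "c0 = 2 * of_real pi * \<i> * C"
  obtain s1 s2 :: int where odd: "odd (s1 + s2)" and
    eq: "\<And>N. (\<Sum>k | nat_weight A1 A2 k \<le> N. theta_coeff h1 h2 s1 s2 c0 k *
      fps_nth (fps_exp (of_real (conj_exponent h1 h2 k)) oo \<epsilon>) (N - nat_weight A1 A2 k)) = 0"
    unfolding c0_def by (rule branch_lift_formal[OF assms]) blast
  define X where "X = exp (of_real (h1 * h2 / 2) * c0)"
  have X0: "X \<noteq> 0" by (simp add: X_def)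
  have "0 = (\<Sum>k | nat_weight A1 A2 k = 0. theta_coeff h1 h2 s1 s2 c0 k * 1)"
    using eq[of 0] by simp
  also have "\<dots> = of_real (h1 + h2) * 1 + 2 * theta_coeff h1 h2 s1 s2 c0 (0, -1) * 1"
    by (rule theta_leading_sum[OF odd A_pos, of _ _ _ "\<lambda>_. 1"])
  finally have 0: "of_real (h1 + h2) + 2 * theta_coeff h1 h2 s1 s2 c0 (0, -1) = 0" by simp
  have "exp (of_real (- (h1 * h2) / 2) * c0) = inverse X"
    unfolding X_def exp_minus[symmetric] by simp
  then have lead: "2 * theta_coeff h1 h2 s1 s2 c0 (0, -1) = (-1) powi (- s2) * of_real (h1 - h2) * inverse X"
    by (simp add: theta_coeff_def conj_coord_corner conj_exponent_corner)
  have "of_real (h1 + h2) * X + u * of_real (h1 - h2) = (of_real (h1 + h2) + u * of_real (h1 - h2) * inverse X) * X" for u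
    using X0 by (simp add: field_simps)
  then have "of_real (h1 + h2) * X + (-1) powi (- s2) * of_real (h1 - h2) = 0"
    by (simp only: lead[symmetric] 0 mult_zero_left)
  moreover have "complex_of_real (h1 + h2) \<noteq> 0" using h_ne(2) by (simp only: of_real_eq_0_iff) simp
  ultimately have "X = - ((-1) powi (- s2)) * (of_real (h1 - h2) / of_real (h1 + h2))"
    by (simp add: field_simps add_eq_0_iff del: of_real_add of_real_diff)
  also have "of_real (h1 - h2) / of_real (h1 + h2) = complex_of_real x0" by (simp add: x0_def)
  finally show ?thesis by (cases "even s2") (simp_all add: X_def c0_def)
qed

lemma branch_conjugate_norm:
  assumes "is_zbasis I w1 w2" "branch_lift D w1 w2 \<alpha> C \<epsilon> T \<phi>"
  shows "exp (2 * of_real pi * \<i> * of_real (h1 * h2) * C) = of_real (x0\<^sup>2)"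
proof -
  have "exp (2 * of_real pi * \<i> * of_real (h1 * h2) * C) = (exp (of_real (h1 * h2 / 2) * (2 * of_real pi * \<i> * C)))\<^sup>2"
    by (simp add: exp_double[symmetric] mult_ac)
  then show ?thesis using branch_leading_coefficient[OF assms] by auto
qed

lemma branch_S_power:
  assumes "is_zbasis I w1 w2" "branch_lift D w1 w2 \<alpha> C \<epsilon> T \<phi>"
  shows "ee (of_int g * branch_exponent D I \<alpha> C) = of_real (inverse (x0\<^sup>2))"
proof -
  have "of_int g * branch_exponent D I \<alpha> C = - (C * of_real (h1 * h2))"
    unfolding branch_exponent_eq using ac by simp
  then have "ee (of_int g * branch_exponent D I \<alpha> C) = inverse (exp (2 * of_real pi * \<i> * of_real (h1 * h2) * C))"
    by (simp add: ee_def exp_minus mult_ac)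
  then show ?thesis unfolding branch_conjugate_norm[OF assms] by simp
qed

text \<open>A is a power of x0^2 with exponent -\<beta>/(\<Delta> h1 h2). Since \<Delta> h1 h2 is g
  \<alpha> up to sign, a rational exponent would make \<beta> a rational multiple of \<alpha>,
  contrary to their independence. Irrationality of x0^2 keeps the base away from 1 and -1.\<close>

lemma branch_parameter_power_value:
  assumes w: "is_zbasis I w1 w2" and branch: "branch_lift D w1 w2 \<alpha> C \<epsilon> T \<phi>" and \<beta>: "is_zbasis M \<alpha> \<beta>"
  defines "A \<equiv> ee (of_real (- \<beta> / (\<alpha> * \<sigma> \<beta> - \<sigma> \<alpha> * \<beta>)) * C)"
  shows "\<exists>x\<in>K - \<rat>. \<exists>y\<in>K - \<rat>. is_power_value (of_real x) (of_real y) A \<and> \<not> algebraic A"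
proof -
  define \<Delta> where "\<Delta> = \<alpha> * \<sigma> \<beta> - \<sigma> \<alpha> * \<beta>"
  have \<beta>K: "\<beta> \<in> K" using zbasis_mem[OF \<beta>] M_K by blast
  have abs: "\<bar>\<Delta>\<bar> = \<alpha> * of_int g / (- (h1 * h2))" unfolding \<Delta>_def by (rule M_det[OF \<beta>])
  have "\<alpha> * of_int g / (- (h1 * h2)) > 0"
    using \<alpha>_pos ac h12_neg by (intro divide_pos_pos mult_pos_pos) auto
  then have \<Delta>: "\<Delta> \<noteq> 0" using abs by auto
  have \<Delta>h: "\<bar>\<Delta> * (h1 * h2)\<bar> = \<alpha> * of_int g"
    using h12_neg h1_nz h2_nz unfolding abs_mult[of \<Delta>] abs by (simp only: abs_of_neg) simp
  define y where "y = - \<beta> / (\<Delta> * (h1 * h2))"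
  define l where "l = 2 * of_real pi * \<i> * of_real (h1 * h2) * C"
  have l: "exp l = of_real (x0\<^sup>2)" unfolding l_def by (rule branch_conjugate_norm[OF w branch])
  have A: "A = exp (of_real y * l)"
  proof -
    have "complex_of_real y * of_real (h1 * h2) = of_real (y * (h1 * h2))" by simp
    also have "y * (h1 * h2) = - \<beta> / \<Delta>" using h1_nz h2_nz by (simp add: y_def)
    finally have "of_real y * l = 2 * of_real pi * \<i> * (of_real (- \<beta> / \<Delta>) * C)"
      unfolding l_def by (metis mult.assoc mult.left_commute)
    then show ?thesis by (simp only: A_def ee_def \<Delta>_def)
  qed
  have yK: "y \<in> K" unfolding y_def \<Delta>_def using \<beta>K by (intro K_divide K_uminus K_mult K_diff) auto
  have yQ: "y \<notin> \<rat>"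
  proof
    assume y: "y \<in> \<rat>"
    have "\<beta> = - y * (\<Delta> * (h1 * h2))" using \<Delta> h1_nz h2_nz by (simp add: y_def)
    also have "\<Delta> * (h1 * h2) = \<alpha> * of_int g \<or> \<Delta> * (h1 * h2) = \<alpha> * - of_int g"
      using \<Delta>h by (simp only: abs_if) (auto split: if_splits)
    ultimately obtain r where r: "r \<in> \<rat>" "\<beta> = r * \<alpha>"
    proof -
      assume \<beta>y: "\<beta> = - y * (\<Delta> * (h1 * h2))"
        and "\<Delta> * (h1 * h2) = \<alpha> * of_int g \<or> \<Delta> * (h1 * h2) = \<alpha> * - of_int g"
        and goal: "\<And>r. r \<in> \<rat> \<Longrightarrow> \<beta> = r * \<alpha> \<Longrightarrow> thesis"
      then show thesis
        using goal[of "- y * of_int g"] goal[of "y * of_int g"] y by auto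
    qed
    then have "\<Delta> = 0" using qconj_Rats[OF r(1)] Rats_K[OF r(1)] by (simp add: \<Delta>_def)
    then show False using \<Delta> by simp
  qed
  have "\<bar>x0\<^sup>2\<bar> \<noteq> 1" using x0_square_irrational by (auto simp: abs_if split: if_splits)
  then have "\<not> algebraic A"
    unfolding A by (intro gelfond_schneider_real_base[OF l] K_algebraic yK yQ) auto
  moreover have "is_power_value (of_real (x0\<^sup>2)) (of_real y) A"
    unfolding is_power_value_def using l A by blast
  ultimately show ?thesis using x0_square_irrational yK yQ x0_K by (intro bexI[of _ "x0\<^sup>2"] bexI[of _ y]) auto
qed

text \<open>Every coefficient of the theta factor lies in K(S) times the power of A given by its
  weight, so the graded recursion applies to any field containing K and S.\<close>

lemma branch_coefficients:
  assumes w: "is_zbasis I w1 w2" and branch: "branch_lift D w1 w2 \<alpha> C \<epsilon> T \<phi>"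
    and adapted: "adapted_parameter D I \<alpha> \<beta> S \<epsilon> T \<phi> A" and E: "\<epsilon> = fps_compose E (fps_const A * fps_X)"
  shows "fps_nth E n \<in> quad_field_adjoin D S"
  unfolding quad_field_adjoin_def
proof (intro InterI, clarify)
  fix F :: "complex set"
  assume KF: "of_real ` K \<subseteq> F" and SF: "S \<in> F" and op: "\<forall>x\<in>F. \<forall>y\<in>F. x - y \<in> F \<and> x * y \<in> F" and inv: "\<forall>x\<in>F. inverse x \<in> F"
  have K: "complex_of_real x \<in> F" if "x \<in> K" for x using KF that by auto
  have F: "subfield_set F" unfolding subfield_set_def using op inv K[of 1] by simp
  have A: "A \<noteq> 0" using adapted by (simp add: adapted_parameter_def)
  define c0 where "c0 = 2 * of_real pi * \<i> * C"
  have \<epsilon>0: "fps_nth \<epsilon> 0 = 0" using branch by (simp add: branch_lift_def)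
  obtain s1 s2 :: int where odd: "odd (s1 + s2)" and
    eq: "\<And>N. (\<Sum>k | nat_weight A1 A2 k \<le> N. theta_coeff h1 h2 s1 s2 c0 k *
      fps_nth (fps_exp (of_real (conj_exponent h1 h2 k)) oo \<epsilon>) (N - nat_weight A1 A2 k)) = 0"
    unfolding c0_def by (rule branch_lift_formal[OF w branch]) blast
  define X where "X = exp (of_real (h1 * h2 / 2) * c0)"
  have XF: "X \<in> F"
    using branch_leading_coefficient[OF w branch] K[of x0] K[of "- x0"] by (auto simp: X_def c0_def)
  have square: "\<exists>n::int. exp (of_real (\<sigma> \<nu>) * c0) = S powi n * A powi \<lfloor>Tr (\<alpha> * \<nu>)\<rfloor>" if "\<nu> \<in> I2" for \<nu>
  proof -
    have "exp (of_real (\<sigma> \<nu>) * c0) = ee (of_real (\<sigma> \<nu>) * C)" by (simp add: ee_def c0_def mult_ac)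
    then show ?thesis using adapted_phase[OF branch adapted that] by simp
  qed
  obtain n1 :: int where n1: "exp (of_real (h1\<^sup>2) * c0) = S powi n1 * A ^ A1"
    using square[OF I2_mem(1)] by (auto simp: h1_def[symmetric] A_eq(1)[symmetric])
  obtain n2 :: int where n2: "exp (of_real (h2\<^sup>2) * c0) = S powi n2 * A ^ A2"
    using square[OF I2_mem(3)] by (auto simp: h2_def[symmetric] A_eq(2)[symmetric])
  \<comment> \<open>The squares of h1 and h2 are covered by the adapted formula. Multiples of h1 h2
    / 2 are covered by \<open>X\<close>, which is x0 up to sign and therefore in K.\<close>
  have phase: "exp (of_real (conj_exponent h1 h2 k) * c0) / A ^ nat_weight A1 A2 k \<in> F" for k
  proof -
    define d where "d = fst k + snd k + 2 * fst k * snd k"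
    have "of_real (conj_exponent h1 h2 k) * c0 = of_nat (triangular (fst k)) * (of_real (h1\<^sup>2) * c0)
        + of_nat (triangular (snd k)) * (of_real (h2\<^sup>2) * c0) + of_int d * (of_real (h1 * h2 / 2) * c0)"
      unfolding conj_exponent_eq d_def[symmetric] by (simp add: algebra_simps)
    then have "exp (of_real (conj_exponent h1 h2 k) * c0) = exp (of_real (h1\<^sup>2) * c0) ^ triangular (fst k)
        * exp (of_real (h2\<^sup>2) * c0) ^ triangular (snd k) * X powi d"
      unfolding X_def by (simp only: exp_add exp_of_nat_mult exp_power_int)
    also have "\<dots> = (S powi n1) ^ triangular (fst k) * (S powi n2) ^ triangular (snd k) * X powi d * A ^ nat_weight A1 A2 k"
      unfolding n1 n2 nat_weight_def by (simp add: power_mult_distrib power_add power_mult[symmetric] mult_ac)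
    finally have "exp (of_real (conj_exponent h1 h2 k) * c0) / A ^ nat_weight A1 A2 k =
      (S powi n1) ^ triangular (fst k) * (S powi n2) ^ triangular (snd k) * X powi d" using A by simp
    then show ?thesis
      using SF XF by (auto intro!: F_mult[OF F A] F_power[OF F A] F_powi[OF F A])
  qed
  have cc: "conj_coord h1 h2 1 1 k \<in> K" for k unfolding conj_coord_def by (intro K_add K_mult K_divide) auto
  have \<kappa>: "complex_of_real (conj_exponent h1 h2 k) \<in> F" for k
    unfolding conj_exponent_def by (intro K K_divide K_diff K_power cc) auto
  have c: "theta_coeff h1 h2 s1 s2 c0 k / A ^ nat_weight A1 A2 k \<in> F" for k
  proof -
    have "(-1) powi m \<in> F" for m :: int using K[of "-1"] by (intro F_powi[OF F A]) simp
    then have "(-1) powi (fst k * s1 + snd k * s2) * of_real (conj_coord h1 h2 1 1 k) *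
        (exp (of_real (conj_exponent h1 h2 k) * c0) / A ^ nat_weight A1 A2 k) \<in> F"
      by (intro F_mult[OF F A] phase K cc)
    then show ?thesis by (simp add: theta_coeff_def)
  qed
  have "fps_nth \<epsilon> n / A ^ n \<in> F"
  proof (rule graded_coefficients[OF F A \<epsilon>0 finite_nat_weight_le[OF A_pos] eq c \<kappa>])
    show "(\<Sum>k | nat_weight A1 A2 k = 0. theta_coeff h1 h2 s1 s2 c0 k * fps_nth (fps_exp (of_real (conj_exponent h1 h2 k)) oo \<epsilon>) N) =
      2 * theta_coeff h1 h2 s1 s2 c0 (0, -1) * fps_nth (fps_exp (of_real (- (h1 * h2) / 2)) oo \<epsilon>) N" if "N > 0" for N
      using theta_leading_sum[OF odd A_pos, of h1 h2 c0 "\<lambda>x. fps_nth (fps_exp (of_real x) oo \<epsilon>) N"] that by simp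
    show "2 * theta_coeff h1 h2 s1 s2 c0 (0, -1) \<in> F"
    proof -
      have "nat_weight A1 A2 (0, -1) = 0" by (simp add: nat_weight_def triangular_eq_0_iff)
      then have "theta_coeff h1 h2 s1 s2 c0 (0, -1) \<in> F" using c[of "(0, -1)"] by simp
      then show ?thesis using K[of 2] by (intro F_mult[OF F A]) auto
    qed
    show "2 * theta_coeff h1 h2 s1 s2 c0 (0, -1) \<noteq> 0"
      using h_ne(1) by (simp add: theta_coeff_def conj_coord_corner)
    show "complex_of_real (- (h1 * h2) / 2) \<in> F" by (intro K K_divide K_uminus K_mult) auto
    show "complex_of_real (- (h1 * h2) / 2) \<noteq> 0" using h1_nz h2_nz by simp
  qed
  \<comment> \<open>Substituting Q = A q multiplies the coefficient of index n by A^n, so the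
    quotient is the coefficient of \<open>E\<close>.\<close>
  then show "fps_nth E n \<in> F" using A by (simp add: E)
qed

end

theorem theorem13p1:
  fixes D a b c :: int and g :: nat
    and I :: "real set" and \<omega>\<^sub>1 \<omega>\<^sub>2 \<alpha> T :: real
    and C S :: complex and \<epsilon> :: "complex fps" and \<phi> :: "complex \<Rightarrow> complex"
  assumes "nonsquare_discriminant D"
    and "invertible_ideal D I"
    and "is_zbasis I \<omega>\<^sub>1 \<omega>\<^sub>2"
    and "primitive_in (trace_dual D (ideal_mult I I)) \<alpha>"
    and "multiminimizer D I \<alpha>"
    and "branch_lift D \<omega>\<^sub>1 \<omega>\<^sub>2 \<alpha> C \<epsilon> T \<phi>"
    and "associated_form D I \<alpha> a b c"
    and "g = nat (gcd a c)"
    and "S = branch_S D I \<alpha> C"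
  shows
    "((\<exists>\<kappa>\<in>quad_field D - {0}. \<exists>l. exp l \<in> of_real ` (quad_field D - {0}) \<and>
          C = of_real \<kappa> * l / (2 * of_real pi * \<i>)) \<and>
      ee (of_nat g * branch_exponent D I \<alpha> C) \<in> of_real ` (quad_field D - \<rat>)) \<and>
     S ^ g \<in> of_real ` quad_field D \<and>
     (\<forall>\<beta>. is_zbasis (trace_dual D (ideal_mult I I)) \<alpha> \<beta> \<longrightarrow>
        (\<exists>A. adapted_parameter D I \<alpha> \<beta> S \<epsilon> T \<phi> A \<and>
             gelfond_schneider_type A \<and>
             (\<exists>x\<in>quad_field D - \<rat>. \<exists>y\<in>quad_field D - \<rat>.
                is_power_value (of_real x) (of_real y) A))) \<and>
     (\<forall>\<beta> A E. is_zbasis (trace_dual D (ideal_mult I I)) \<alpha> \<beta> \<and>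
        adapted_parameter D I \<alpha> \<beta> S \<epsilon> T \<phi> A \<and>
        \<epsilon> = fps_compose E (fps_const A * fps_X) \<longrightarrow>
        (\<forall>n\<ge>1. fps_nth E n \<in> quad_field_adjoin D S))"
proof -
  have I: "I \<subseteq> quad_field D"
    using assms(2) by (simp add: invertible_ideal_def fractional_ideal_def)
  obtain \<eta>1 \<eta>2 where \<eta>: "is_zbasis I \<eta>1 \<eta>2" "\<eta>2 > \<eta>1" "\<eta>1 > 0" "qtr D (\<alpha> * \<eta>1 * \<eta>2) = 0"
    "of_int a * (\<eta>2 / \<eta>1)\<^sup>2 + of_int b * (\<eta>2 / \<eta>1) + of_int c = 0"
    and form: "standard_form D a b c" "Gcd {a, b, c} = 1"
    using assms(7) unfolding associated_form_def Let_def by blast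
  have "qtr D (\<alpha> * \<eta>1\<^sup>2) > 0"
    using assms(5) zbasis_mem(1)[OF \<eta>(1)] \<eta>(3) unfolding multiminimizer_def by auto
  then interpret diagonal_basis D I \<eta>1 \<eta>2 \<alpha> a b c
    using assms(1,4) I \<eta> form by unfold_locales (auto simp: nonsquare_discriminant_def standard_form_def)
  note w = assms(3) and branch = assms(6)
  have g: "int g = gcd a c" using assms(8) by simp
  then have gC: "of_nat g = (of_int (gcd a c) :: complex)" by (metis of_int_of_nat_eq)
  \<comment> \<open>The exponent of S is -C h1 h2 / g, hence S^g is the inverse of x0^2.\<close>
  define y where "y = inverse (x0\<^sup>2)"
  have yK: "y \<in> K" unfolding y_def by (intro K_inverse K_power x0_K)
  have yQ: "y \<notin> \<rat>" using x0_square_irrational Rats_inverse[of y] by (auto simp: y_def)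
  have eg: "ee (of_nat g * branch_exponent D I \<alpha> C) = of_real y"
    unfolding gC y_def by (rule branch_S_power[OF w branch])
  have i: "(\<exists>\<kappa>\<in>K - {0}. \<exists>l. exp l \<in> of_real ` (K - {0}) \<and> C = of_real \<kappa> * l / (2 * of_real pi * \<i>))"
  proof (intro bexI exI conjI)
    \<comment> \<open>This is a logarithm of x0^2; dividing by h1 h2 recovers C.\<close>
    define l where "l = 2 * of_real pi * \<i> * of_real (h1 * h2) * C"
    show "exp l \<in> of_real ` (K - {0})"
      unfolding l_def branch_conjugate_norm[OF w branch] by (intro imageI) (simp add: x0_nz)
    show "C = of_real (inverse (h1 * h2)) * l / (2 * of_real pi * \<i>)"
      using h1_nz h2_nz by (simp add: l_def field_simps)
    show "inverse (h1 * h2) \<in> K - {0}" using h1_nz h2_nz by auto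
  qed
  have ii: "S ^ g = of_real y"
    using eg ee_powi[of "branch_exponent D I \<alpha> C" "int g"] assms(9) by (simp add: branch_S_def)
  have iii: "\<exists>A. adapted_parameter D I \<alpha> \<beta> S \<epsilon> T \<phi> A \<and> gelfond_schneider_type A \<and>
      (\<exists>x\<in>K - \<rat>. \<exists>y\<in>K - \<rat>. is_power_value (of_real x) (of_real y) A)" if \<beta>: "is_zbasis M \<alpha> \<beta>" for \<beta>
  proof -
    let ?A = "ee (of_real (- \<beta> / (\<alpha> * \<sigma> \<beta> - \<sigma> \<alpha> * \<beta>)) * C)"
    obtain x y where xy: "x \<in> K - \<rat>" "y \<in> K - \<rat>" "is_power_value (of_real x) (of_real y) ?A" "\<not> algebraic ?A"
      using branch_parameter_power_value[OF w branch \<beta>] by blast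
    have "algebraic (complex_of_real x)" "algebraic (complex_of_real y)"
      using xy(1,2) K_algebraic by auto
    then have "gelfond_schneider_type ?A" unfolding gelfond_schneider_type_def using xy by blast
    then show ?thesis using branch_parameter[OF branch \<beta>] xy assms(9) by blast
  qed
  show ?thesis
    using i ii iii eg yK yQ branch_coefficients[OF w branch] by blast
qed

end
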